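(* Let $F$ be a field, let $D$ be a subring of $F$, let $Z$ be a subspace of the Zariski-Riemann space of $F/D$ with $F \in Z$, regarded as a locally ringed space over $\mathrm{Spec}(D)$, and let $A = \bigcap_{V \in Z} V$. Then $A$ is a Prüfer domain with quotient field $F$ if and only if every $D$-morphism $Z \rightarrow \mathbb{P}^1_D$ factors through an affine scheme.
   Context: A subring $V$ of $F$ is a valuation ring of $F$ if for each nonzero $x \in F$, $x \in V$ or $x^{-1} \in V$ (so $F$ itself is one). $D$ need not have quotient field $F$. The Zariski-Riemann space $\mathfrak{X}$ of $F/D$ is the set of all valuation rings of $F$ containing $D$, with the topology whose basic open sets are $\{V \in \mathfrak{X} : t_1,\ldots,t_n \in V\}$, $t_1,\ldots,t_n \in F$; $Z$ is any subset of $\mathfrak{X}$ containing $F$, with the subspace topology (not necessarily open or closed). $Z$ is a locally ringed space with structure sheaf $\mathcal{O}_Z(U) = \bigcap_{V \in U} V$ for nonempty open $U \subseteq Z$ and $\mathcal{O}_Z(\emptyset) = 0$; restriction maps off the empty set are inclusions, and the stalk at $V \in Z$ is $V$. The structure morphism $Z \to \mathrm{Spec}(D)$ sends $V$ to its center in $D$ (the contraction to $D$ of the maximal ideal of $V$), and is given on sections by the inclusions $\mathcal{O}_{\mathrm{Spec}(D)}(U) \to \mathcal{O}_Z(d^{-1}(U))$, where $d$ is the underlying continuous map (when $D \to F$ is viewed as inclusion into $F$). All morphisms are morphisms of locally ringed spaces. A $D$-morphism is a morphism commuting with the given morphisms to $\mathrm{Spec}(D)$. $\mathbb{P}^1_D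 = \mathrm{Proj}(D[T_0,T_1])$. A morphism $Z\to \mathbb{P}^1_D$ factors through an affine scheme if it is a composition of morphisms $Z \to \mathrm{Spec}(R) \to \mathbb{P}^1_D$ for some commutative ring $R$. $A$ is a Prüfer domain with quotient field $F$ if for every prime ideal $P$ of $A$ the localization $A_P$ is a valuation ring of $F$. *)

theory Defs
  imports "HOL-Algebra.UnivPoly" "HOL-Algebra.Subrings" "HOL-Analysis.Abstract_Topology"
begin

section \<open>Locally ringed spaces and their morphisms\<close>

text \<open>
  The record carries the data of a ringed space: the topology, the ring of sections over each
  open set, and the restriction maps (\<open>lrs_restr X U V\<close> restricts from \<open>U\<close> to \<open>V \<subseteq> U\<close>).  Values at
  sets that are not open are irrelevant.
\<close>

record ('p, 's) ringed_space =
  lrs_top :: "'p topology"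
  lrs_sections :: "'p set \<Rightarrow> 's ring"
  lrs_restr :: "'p set \<Rightarrow> 'p set \<Rightarrow> 's \<Rightarrow> 's"

abbreviation lrs_points :: "('p, 's) ringed_space \<Rightarrow> 'p set" where
  "lrs_points X \<equiv> topspace (lrs_top X)"

definition germ_rel ::
  "('p, 's) ringed_space \<Rightarrow> 'p \<Rightarrow> (('p set \<times> 's) \<times> ('p set \<times> 's)) set" where
  "germ_rel X x = {((U, s), (V, t)).
     openin (lrs_top X) U \<and> x \<in> U \<and> s \<in> carrier (lrs_sections X U) \<and>
     openin (lrs_top X) V \<and> x \<in> V \<and> t \<in> carrier (lrs_sections X V) \<and>
     (\<exists>W. openin (lrs_top X) W \<and> x \<in> W \<and> W \<subseteq> U \<inter> V \<and>
          lrs_restr X U W s = lrs_restr X V W t)}"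

definition stalk :: "('p, 's) ringed_space \<Rightarrow> 'p \<Rightarrow> ('p set \<times> 's) set ring" where
  "stalk X x = \<lparr>
     carrier = {(U, s). openin (lrs_top X) U \<and> x \<in> U \<and> s \<in> carrier (lrs_sections X U)}
                 // germ_rel X x,
     monoid.mult = (\<lambda>g h. \<Union>(U, s)\<in>g. \<Union>(V, t)\<in>h. germ_rel X x ``
       {(U \<inter> V, lrs_restr X U (U \<inter> V) s \<otimes>\<^bsub>lrs_sections X (U \<inter> V)\<^esub> lrs_restr X V (U \<inter> V) t)}),
     one = germ_rel X x `` {(lrs_points X, \<one>\<^bsub>lrs_sections X (lrs_points X)\<^esub>)},
     zero = germ_rel X x `` {(lrs_points X, \<zero>\<^bsub>lrs_sections X (lrs_points X)\<^esub>)},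
     add = (\<lambda>g h. \<Union>(U, s)\<in>g. \<Union>(V, t)\<in>h. germ_rel X x ``
       {(U \<inter> V, lrs_restr X U (U \<inter> V) s \<oplus>\<^bsub>lrs_sections X (U \<inter> V)\<^esub> lrs_restr X V (U \<inter> V) t)})\<rparr>"

definition the_maximal_ideal :: "('a, 'm) ring_scheme \<Rightarrow> 'a set" where
  "the_maximal_ideal R = (THE M. maximalideal M R)"

text \<open>The underlying map of points, and the maps on sections \<open>O\<^sub>Y(U) \<rightarrow> O\<^sub>X(f\<^sup>-\<^sup>1(U))\<close>.\<close>

record ('p, 's, 'q, 't) lrs_map =
  lrs_pt :: "'p \<Rightarrow> 'q"
  lrs_comorph :: "'q set \<Rightarrow> 't \<Rightarrow> 's"

definition lrs_pre ::
  "('p, 's) ringed_space \<Rightarrow> ('p, 's, 'q, 't) lrs_map \<Rightarrow> 'q set \<Rightarrow> 'p set" where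
  "lrs_pre X \<phi> U = {x \<in> lrs_points X. lrs_pt \<phi> x \<in> U}"

definition stalk_map ::
  "('p, 's) ringed_space \<Rightarrow> ('p, 's, 'q, 't) lrs_map \<Rightarrow> 'p \<Rightarrow> ('q set \<times> 't) set \<Rightarrow> ('p set \<times> 's) set"
  where
  "stalk_map X \<phi> x g = (\<Union>(U, s)\<in>g. germ_rel X x `` {(lrs_pre X \<phi> U, lrs_comorph \<phi> U s)})"

definition local_ring_hom ::
  "('a, 'm) ring_scheme \<Rightarrow> ('b, 'n) ring_scheme \<Rightarrow> ('a \<Rightarrow> 'b) set" where
  "local_ring_hom R S = {h \<in> ring_hom R S.
     {a \<in> carrier R. h a \<in> the_maximal_ideal S} = the_maximal_ideal R}"

definition lrs_morphism ::
  "('p, 's) ringed_space \<Rightarrow> ('q, 't) ringed_space \<Rightarrow> ('p, 's, 'q, 't) lrs_map \<Rightarrow> bool" where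
  "lrs_morphism X Y \<phi> \<longleftrightarrow>
     continuous_map (lrs_top X) (lrs_top Y) (lrs_pt \<phi>) \<and>
     (\<forall>U. openin (lrs_top Y) U \<longrightarrow>
        lrs_comorph \<phi> U \<in> ring_hom (lrs_sections Y U) (lrs_sections X (lrs_pre X \<phi> U))) \<and>
     (\<forall>U V. openin (lrs_top Y) U \<and> openin (lrs_top Y) V \<and> V \<subseteq> U \<longrightarrow>
        (\<forall>s \<in> carrier (lrs_sections Y U).
           lrs_comorph \<phi> V (lrs_restr Y U V s) =
           lrs_restr X (lrs_pre X \<phi> U) (lrs_pre X \<phi> V) (lrs_comorph \<phi> U s))) \<and>
     (\<forall>x \<in> lrs_points X.
        stalk_map X \<phi> x \<in> local_ring_hom (stalk Y (lrs_pt \<phi> x)) (stalk X x))"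

text \<open>The composite \<open>\<psi> \<circ> \<phi>\<close>, where \<open>Y\<close> is the source of \<open>\<psi>\<close>.\<close>

definition lrs_comp ::
  "('q, 't) ringed_space \<Rightarrow> ('q, 't, 'r, 'u) lrs_map \<Rightarrow> ('p, 's, 'q, 't) lrs_map
     \<Rightarrow> ('p, 's, 'r, 'u) lrs_map" where
  "lrs_comp Y \<psi> \<phi> = \<lparr>
     lrs_pt = lrs_pt \<psi> \<circ> lrs_pt \<phi>,
     lrs_comorph = (\<lambda>U. lrs_comorph \<phi> (lrs_pre Y \<psi> U) \<circ> lrs_comorph \<psi> U)\<rparr>"

text \<open>Equality of morphisms \<open>X \<rightarrow> Y\<close>, disregarding values outside the relevant domains.\<close>

definition lrs_map_eq ::
  "('p, 's) ringed_space \<Rightarrow> ('q, 't) ringed_space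
     \<Rightarrow> ('p, 's, 'q, 't) lrs_map \<Rightarrow> ('p, 's, 'q, 't) lrs_map \<Rightarrow> bool" where
  "lrs_map_eq X Y \<phi> \<psi> \<longleftrightarrow>
     (\<forall>x \<in> lrs_points X. lrs_pt \<phi> x = lrs_pt \<psi> x) \<and>
     (\<forall>U. openin (lrs_top Y) U \<longrightarrow>
        (\<forall>s \<in> carrier (lrs_sections Y U). lrs_comorph \<phi> U s = lrs_comorph \<psi> U s))"

text \<open>Morphisms of spaces over a base \<open>B\<close>, with structure morphisms \<open>\<pi>X\<close> and \<open>\<pi>Y\<close>.\<close>

definition lrs_morphism_over ::
  "('b, 'u) ringed_space
     \<Rightarrow> ('p, 's) ringed_space \<Rightarrow> ('p, 's, 'b, 'u) lrs_map
     \<Rightarrow> ('q, 't) ringed_space \<Rightarrow> ('q, 't, 'b, 'u) lrs_map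
     \<Rightarrow> ('p, 's, 'q, 't) lrs_map \<Rightarrow> bool" where
  "lrs_morphism_over B X \<pi>X Y \<pi>Y \<phi> \<longleftrightarrow>
     lrs_morphism X Y \<phi> \<and> lrs_map_eq X B (lrs_comp Y \<pi>Y \<phi>) \<pi>X"


section \<open>Spaces of prime ideals with a sheaf of fractions\<close>

text \<open>
  Common to Spec and Proj.  \<open>Q\<close> is the set of pairs \<open>(a, f)\<close> admitted as fractions \<open>a/f\<close>:
  all of \<open>R \<times> (R - p)\<close> for the localization \<open>R\<^sub>p\<close>, and the pairs of homogeneous elements of equal
  degree with \<open>f \<notin> p\<close> for the homogeneous localization \<open>R\<^bsub>(p)\<^esub>\<close>.
\<close>

definition frac_rel ::
  "('a, 'm) ring_scheme \<Rightarrow> ('a \<times> 'a) set \<Rightarrow> (('a \<times> 'a) \<times> ('a \<times> 'a)) set" where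
  "frac_rel R Q = {((a, f), (b, g)). (a, f) \<in> Q \<and> (b, g) \<in> Q \<and>
     (\<exists>u \<in> snd ` Q. u \<otimes>\<^bsub>R\<^esub> ((a \<otimes>\<^bsub>R\<^esub> g) \<ominus>\<^bsub>R\<^esub> (b \<otimes>\<^bsub>R\<^esub> f)) = \<zero>\<^bsub>R\<^esub>)}"

definition frac_ring ::
  "('a, 'm) ring_scheme \<Rightarrow> ('a \<times> 'a) set \<Rightarrow> ('a \<times> 'a) set ring" where
  "frac_ring R Q = \<lparr>
     carrier = Q // frac_rel R Q,
     monoid.mult = (\<lambda>x y. \<Union>(a, f)\<in>x. \<Union>(b, g)\<in>y.
       frac_rel R Q `` {(a \<otimes>\<^bsub>R\<^esub> b, f \<otimes>\<^bsub>R\<^esub> g)}),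
     one = frac_rel R Q `` {(\<one>\<^bsub>R\<^esub>, \<one>\<^bsub>R\<^esub>)},
     zero = frac_rel R Q `` {(\<zero>\<^bsub>R\<^esub>, \<one>\<^bsub>R\<^esub>)},
     add = (\<lambda>x y. \<Union>(a, f)\<in>x. \<Union>(b, g)\<in>y.
       frac_rel R Q `` {((a \<otimes>\<^bsub>R\<^esub> g) \<oplus>\<^bsub>R\<^esub> (b \<otimes>\<^bsub>R\<^esub> f), f \<otimes>\<^bsub>R\<^esub> g)})\<rparr>"

text \<open>
  A section over \<open>U\<close> is a function assigning to each \<open>p \<in> U\<close> an element of the ring of fractions
  at \<open>p\<close> that is locally given by a single fraction \<open>a/f\<close>.
\<close>

definition frac_sections ::
  "('a, 'm) ring_scheme \<Rightarrow> 'a set topology \<Rightarrow> ('a set \<Rightarrow> ('a \<times> 'a) set) \<Rightarrow> 'a set set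
     \<Rightarrow> ('a set \<Rightarrow> ('a \<times> 'a) set) ring" where
  "frac_sections R T Q U = \<lparr>
     carrier = {s \<in> (\<Pi>\<^sub>E p\<in>U. carrier (frac_ring R (Q p))).
       \<forall>p\<in>U. \<exists>W a f. openin T W \<and> p \<in> W \<and> W \<subseteq> U \<and>
         (\<forall>q\<in>W. (a, f) \<in> Q q \<and> s q = frac_rel R (Q q) `` {(a, f)})},
     monoid.mult = (\<lambda>s t. \<lambda>p\<in>U. s p \<otimes>\<^bsub>frac_ring R (Q p)\<^esub> t p),
     one = (\<lambda>p\<in>U. \<one>\<^bsub>frac_ring R (Q p)\<^esub>),
     zero = (\<lambda>p\<in>U. \<zero>\<^bsub>frac_ring R (Q p)\<^esub>),
     add = (\<lambda>s t. \<lambda>p\<in>U. s p \<oplus>\<^bsub>frac_ring R (Q p)\<^esub> t p)\<rparr>"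

definition frac_space ::
  "('a, 'm) ring_scheme \<Rightarrow> 'a set topology \<Rightarrow> ('a set \<Rightarrow> ('a \<times> 'a) set)
     \<Rightarrow> ('a set, 'a set \<Rightarrow> ('a \<times> 'a) set) ringed_space" where
  "frac_space R T Q = \<lparr>
     lrs_top = T,
     lrs_sections = frac_sections R T Q,
     lrs_restr = (\<lambda>U V s. restrict s V)\<rparr>"

definition zariski_topology :: "('a, 'm) ring_scheme \<Rightarrow> 'a set topology" where
  "zariski_topology R = topology_generated_by
     ((\<lambda>f. {p. primeideal p R \<and> f \<notin> p}) ` carrier R)"

definition Spec ::
  "('a, 'm) ring_scheme \<Rightarrow> ('a set, 'a set \<Rightarrow> ('a \<times> 'a) set) ringed_space" where
  "Spec R = frac_space R (zariski_topology R) (\<lambda>p. carrier R \<times> (carrier R - p))"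

text \<open>
  In the following, \<open>S\<close> is a ring graded by \<open>G\<close>, that is, \<open>S\<close> is the direct sum of the additive
  subgroups \<open>G n\<close>.  An ideal is homogeneous iff it is generated by homogeneous elements.
\<close>

definition homogeneous_ideal ::
  "('a, 'm) ring_scheme \<Rightarrow> (nat \<Rightarrow> 'a set) \<Rightarrow> 'a set \<Rightarrow> bool" where
  "homogeneous_ideal S G I \<longleftrightarrow> ideal I S \<and> I = Idl\<^bsub>S\<^esub> (I \<inter> (\<Union>n. G n))"

definition irrelevant_ideal :: "('a, 'm) ring_scheme \<Rightarrow> (nat \<Rightarrow> 'a set) \<Rightarrow> 'a set" where
  "irrelevant_ideal S G = Idl\<^bsub>S\<^esub> (\<Union>n\<in>{1..}. G n)"

definition Proj_points :: "('a, 'm) ring_scheme \<Rightarrow> (nat \<Rightarrow> 'a set) \<Rightarrow> 'a set set" where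
  "Proj_points S G =
     {p. primeideal p S \<and> homogeneous_ideal S G p \<and> \<not> irrelevant_ideal S G \<subseteq> p}"

definition homogeneous_fracs :: "(nat \<Rightarrow> 'a set) \<Rightarrow> 'a set \<Rightarrow> ('a \<times> 'a) set" where
  "homogeneous_fracs G p = {(a, f). \<exists>n. a \<in> G n \<and> f \<in> G n - p}"

definition Proj ::
  "('a, 'm) ring_scheme \<Rightarrow> (nat \<Rightarrow> 'a set)
     \<Rightarrow> ('a set, 'a set \<Rightarrow> ('a \<times> 'a) set) ringed_space" where
  "Proj S G = frac_space S
     (subtopology (zariski_topology S) (Proj_points S G)) (homogeneous_fracs G)"

text \<open>
  The structure morphism \<open>Proj S \<rightarrow> Spec R\<close> induced by a ring homomorphism \<open>c\<close> from \<open>R\<close> to the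
  degree zero part of \<open>S\<close>; on stalks it is \<open>R\<^sub>p \<rightarrow> S\<^bsub>(q)\<^esub>\<close>, \<open>a/f \<mapsto> c(a)/c(f)\<close> with \<open>p = c\<^sup>-\<^sup>1(q)\<close>.
\<close>

definition Proj_structure_map ::
  "('b, 'n) ring_scheme \<Rightarrow> ('b \<Rightarrow> 'a) \<Rightarrow> ('a, 'm) ring_scheme \<Rightarrow> (nat \<Rightarrow> 'a set)
     \<Rightarrow> ('a set, 'a set \<Rightarrow> ('a \<times> 'a) set, 'b set, 'b set \<Rightarrow> ('b \<times> 'b) set) lrs_map" where
  "Proj_structure_map R c S G = \<lparr>
     lrs_pt = (\<lambda>q. {a \<in> carrier R. c a \<in> q}),
     lrs_comorph = (\<lambda>U s. \<lambda>q\<in>{q \<in> Proj_points S G. {a \<in> carrier R. c a \<in> q} \<in> U}.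
       \<Union>(a, f)\<in>s {a \<in> carrier R. c a \<in> q}.
         frac_rel S (homogeneous_fracs G q) `` {(c a, c f)})\<rparr>"


section \<open>The projective line\<close>

text \<open>
  The ring \<open>R[T\<^sub>0,T\<^sub>1]\<close> is taken to be \<open>R[T\<^sub>0][T\<^sub>1]\<close>, that is, \<open>UP (UP R)\<close>; the coefficient of
  \<open>T\<^sub>0\<^sup>i T\<^sub>1\<^sup>j\<close> is the coefficient at \<open>i\<close> of the coefficient at \<open>j\<close>.
\<close>

definition homogeneous_poly2 :: "('a, 'm) ring_scheme \<Rightarrow> nat \<Rightarrow> (nat \<Rightarrow> nat \<Rightarrow> 'a) set" where
  "homogeneous_poly2 R n = {P \<in> carrier (UP (UP R)).
     \<forall>i j. coeff (UP R) (coeff (UP (UP R)) P j) i \<noteq> \<zero>\<^bsub>R\<^esub> \<longrightarrow> i + j = n}"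

definition const_poly2 :: "('a, 'm) ring_scheme \<Rightarrow> 'a \<Rightarrow> (nat \<Rightarrow> nat \<Rightarrow> 'a)" where
  "const_poly2 R a = monom (UP (UP R)) (monom (UP R) a 0) 0"

definition Proj_line ::
  "('a, 'm) ring_scheme \<Rightarrow> ((nat \<Rightarrow> nat \<Rightarrow> 'a) set,
     (nat \<Rightarrow> nat \<Rightarrow> 'a) set \<Rightarrow> ((nat \<Rightarrow> nat \<Rightarrow> 'a) \<times> (nat \<Rightarrow> nat \<Rightarrow> 'a)) set) ringed_space" where
  "Proj_line R = Proj (UP (UP R)) (homogeneous_poly2 R)"

definition Proj_line_structure_map ::
  "('a, 'm) ring_scheme \<Rightarrow> ((nat \<Rightarrow> nat \<Rightarrow> 'a) set,
     (nat \<Rightarrow> nat \<Rightarrow> 'a) set \<Rightarrow> ((nat \<Rightarrow> nat \<Rightarrow> 'a) \<times> (nat \<Rightarrow> nat \<Rightarrow> 'a)) set,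
     'a set, 'a set \<Rightarrow> ('a \<times> 'a) set) lrs_map" where
  "Proj_line_structure_map R =
     Proj_structure_map R (const_poly2 R) (UP (UP R)) (homogeneous_poly2 R)"


section \<open>Factoring through affine schemes\<close>

text \<open>
  HOL cannot quantify over types inside a formula, so the type \<open>'r\<close> of the elements of the rings
  \<open>R\<close> is a parameter.  A statement about factorizations through arbitrary rings is obtained by
  using a type \<open>'f + 'r\<close> with \<open>'r\<close> arbitrary: a ring on any type \<open>'r\<close> has a copy on \<open>'f + 'r\<close>, and
  so do the subrings of a field on \<open>'f\<close>.
\<close>

definition factors_through_affine ::
  "'r itself \<Rightarrow> ('p, 's) ringed_space \<Rightarrow> ('q, 't) ringed_space
     \<Rightarrow> ('p, 's, 'q, 't) lrs_map \<Rightarrow> bool" where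
  "factors_through_affine (_ :: 'r itself) X Y \<phi> \<longleftrightarrow>
     (\<exists>(R :: 'r ring) \<alpha> \<beta>. cring R \<and> lrs_morphism X (Spec R) \<alpha> \<and> lrs_morphism (Spec R) Y \<beta> \<and>
        lrs_map_eq X Y \<phi> (lrs_comp (Spec R) \<beta> \<alpha>))"


section \<open>Valuation rings and the Zariski-Riemann space\<close>

definition valuation_ring_of :: "('f, 'm) ring_scheme \<Rightarrow> 'f set \<Rightarrow> bool" where
  "valuation_ring_of F V \<longleftrightarrow> subring V F \<and>
     (\<forall>x \<in> carrier F. x \<noteq> \<zero>\<^bsub>F\<^esub> \<longrightarrow> x \<in> V \<or> inv\<^bsub>F\<^esub> x \<in> V)"

definition ZR :: "('f, 'm) ring_scheme \<Rightarrow> 'f set \<Rightarrow> 'f set set" where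
  "ZR F D = {V. valuation_ring_of F V \<and> D \<subseteq> V}"

definition ZR_topology :: "('f, 'm) ring_scheme \<Rightarrow> 'f set \<Rightarrow> 'f set topology" where
  "ZR_topology F D = topology_generated_by
     {{V \<in> ZR F D. E \<subseteq> V} | E. finite E \<and> E \<subseteq> carrier F}"

text \<open>Over the empty set the ring of sections is the zero ring \<open>{\<zero>}\<close>, with \<open>\<one> = \<zero>\<close>.\<close>

definition ZR_space :: "'f ring \<Rightarrow> 'f set \<Rightarrow> 'f set set \<Rightarrow> ('f set, 'f) ringed_space" where
  "ZR_space F D Z = \<lparr>
     lrs_top = subtopology (ZR_topology F D) Z,
     lrs_sections = (\<lambda>U. if U = {} then F\<lparr>carrier := {\<zero>\<^bsub>F\<^esub>}, one := \<zero>\<^bsub>F\<^esub>\<rparr>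
                         else F\<lparr>carrier := \<Inter>U\<rparr>),
     lrs_restr = (\<lambda>U V s. if V = {} then \<zero>\<^bsub>F\<^esub> else s)\<rparr>"

definition center :: "('f, 'm) ring_scheme \<Rightarrow> 'f set \<Rightarrow> 'f set \<Rightarrow> 'f set" where
  "center F D V = D \<inter> the_maximal_ideal (F\<lparr>carrier := V\<rparr>)"

text \<open>
  For a nonempty open set \<open>U\<close> of \<open>Spec D\<close>, a section \<open>s\<close> over \<open>U\<close> is a family of elements of the
  localizations of \<open>D\<close> that all represent the same element \<open>x = a/f\<close> of \<open>F\<close>; the inclusion into \<open>F\<close>
  sends \<open>s\<close> to \<open>x\<close>.  The preimage of a nonempty \<open>U\<close> is nonempty as soon as \<open>F\<close> is a point of the
  space, since the center of \<open>F\<close> is the zero ideal.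
\<close>

definition ZR_structure_map ::
  "'f ring \<Rightarrow> 'f set \<Rightarrow> ('f set, 'f, 'f set, 'f set \<Rightarrow> ('f \<times> 'f) set) lrs_map" where
  "ZR_structure_map F D = \<lparr>
     lrs_pt = center F D,
     lrs_comorph = (\<lambda>U s. if U = {} then \<zero>\<^bsub>F\<^esub> else
       (THE x. x \<in> carrier F \<and> (\<forall>p\<in>U. \<forall>(a, f)\<in>s p. a = f \<otimes>\<^bsub>F\<^esub> x)))\<rparr>"


section \<open>Pruefer domains\<close>

definition localization_in :: "('f, 'm) ring_scheme \<Rightarrow> 'f set \<Rightarrow> 'f set \<Rightarrow> 'f set" where
  "localization_in F A P = {a \<otimes>\<^bsub>F\<^esub> inv\<^bsub>F\<^esub> s | a s. a \<in> A \<and> s \<in> A - P}"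

definition pruefer_domain_in :: "('f, 'm) ring_scheme \<Rightarrow> 'f set \<Rightarrow> bool" where
  "pruefer_domain_in F A \<longleftrightarrow> subring A F \<and>
     (\<forall>P. primeideal P (F\<lparr>carrier := A\<rparr>) \<longrightarrow> valuation_ring_of F (localization_in F A P))"

end

theory Submission
  imports Defs
begin

text \<open>
  A morphism to the projective line is given by a point \<open>(t\<^sub>0 : t\<^sub>1)\<close> of the projective line over \<open>F\<close>:
  a section \<open>a/f\<close> pulls back to \<open>a(t\<^sub>0, t\<^sub>1) / f(t\<^sub>0, t\<^sub>1)\<close>, and \<open>V\<close> is sent to the homogeneous prime of
  the forms that vanish, in suitably scaled coordinates, modulo the maximal ideal of \<open>V\<close>.  Conversely
  \<open>(t\<^sub>0 : t\<^sub>1)\<close> defines a morphism on every space whose local rings \<open>L \<subseteq> F\<close> contain \<open>t\<^sub>0/t\<^sub>1\<close> or \<open>t\<^sub>1/t\<^sub>0\<close>.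

  Valuation rings always do.  If \<open>A = \<Inter>Z\<close> is Pruefer, then so do the localizations of \<open>A\<close>, and the
  morphism from \<open>Z\<close> is the composite of the center map \<open>Z \<rightarrow> Spec A\<close> with the morphism that the same
  point defines on \<open>Spec A\<close>.

  If, for \<open>x \<in> F\<close>, the morphism given by \<open>(1 : x)\<close> factors through \<open>Spec R\<close>, let \<open>h : R \<rightarrow> A\<close> be the map
  on global sections, \<open>P\<close> a prime of \<open>A\<close> and \<open>p = h\<^sup>-\<^sup>1(P)\<close>.  Near \<open>p\<close>, the pullback to \<open>Spec R\<close> of one of
  \<open>T\<^sub>1/T\<^sub>0\<close> and \<open>T\<^sub>0/T\<^sub>1\<close> is a fraction \<open>a/f\<close> with \<open>f \<notin> p\<close>.  The image of the point \<open>F\<close> lies in this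
  neighbourhood because it is a generization of \<open>p\<close>, so \<open>x\<close> or \<open>x\<^sup>-\<^sup>1\<close> equals \<open>h(a)/h(f) \<in> A\<^sub>P\<close>.
\<close>

section \<open>Local rings and stalks\<close>

text \<open>\<open>Z\<close>, \<open>Spec D\<close> and \<open>Spec A\<close> share one feature:
  their sections are elements of \<open>F\<close>, and a generic point lies in every nonempty open
  set. A morphism from such a space to a space of fractions is therefore fixed by its point map and
  by one ring homomorphism into \<open>F\<close>, read at the generic point
  (\<open>realizes\<close>). For an arbitrary \<open>D\<close>-morphism, let \<open>k\<close> be a
  chart containing the image of \<open>F\<close>, and let \<open>t\<^sub>i\<close> be the pullback
  of \<open>T\<^sub>i/T\<^sub>k\<close>. Commutation with the maps to \<open>Spec D\<close> says
  that constants pull back to themselves, so \<open>f/T\<^sub>k^n\<close> pulls back to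
  \<open>f(t)\<close>. The point map is not visible on sections. Locality supplies it: a fraction
  has its numerator in the image prime exactly when its value is a nonunit of \<open>V\<close>, and
  by \<open>adapted_unique\<close> only one homogeneous prime has this property. The composite
  through \<open>Spec A\<close> satisfies the same condition, since \<open>V\<close> dominates the
  localization of \<open>A\<close> at the center of \<open>V\<close>. Primes of Proj also contain
  inhomogeneous polynomials. Evaluation in \<open>F[Y]\<close>, with \<open>Y\<close> recording the
  degree, treats all homogeneous components at once.\<close>

definition local_with :: "('a, 'm) ring_scheme \<Rightarrow> 'a set \<Rightarrow> bool" where
  "local_with K N \<longleftrightarrow> cring K \<and> ideal N K \<and> N \<noteq> carrier K \<and> carrier K - N \<subseteq> Units K"

lemma local_with_subset: "local_with K N \<Longrightarrow> N \<subseteq> carrier K"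
  using ideal.Icarr[of N K] by (auto simp: local_with_def)

text \<open>An ideal not contained in \<open>N\<close> contains a unit and is the whole ring, so
  every proper ideal lies below \<open>N\<close>; this settles the definite description in
  \<open>the_maximal_ideal\<close>.\<close>

lemma the_maximal_ideal_eq:
  assumes "local_with K N"
  shows "the_maximal_ideal K = N"
  unfolding the_maximal_ideal_def
proof (rule the_equality)
  have K: "cring K" and N: "ideal N K" "N \<noteq> carrier K" and U: "carrier K - N \<subseteq> Units K"
    using assms by (auto simp: local_with_def)
  interpret cring K by fact
  have full: "J = carrier K" if "ideal J K" "y \<in> J" "y \<in> Units K" for J y
  proof -
    interpret J: ideal J K by fact
    have "inv\<^bsub>K\<^esub> y \<otimes>\<^bsub>K\<^esub> y \<in> J" using that by (intro J.I_l_closed) auto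
    then show ?thesis using that J.one_imp_carrier by simp
  qed
  show max: "maximalideal N K"
  proof (rule maximalidealI[OF N(1)])
    show "carrier K \<noteq> N" using N by simp
    fix J assume J: "ideal J K" "N \<subseteq> J" "J \<subseteq> carrier K"
    show "J = N \<or> J = carrier K"
      using J U full[OF J(1)] by blast
  qed
  fix M assume M: "maximalideal M K"
  interpret M: maximalideal M K by fact
  have "M \<subseteq> N"
  proof
    fix y assume "y \<in> M"
    then show "y \<in> N"
      using U full[OF M.is_ideal] M.I_notcarr M.Icarr by blast
  qed
  moreover have "N \<subseteq> carrier K" using ideal.Icarr[OF N(1)] by auto
  ultimately show "M = N"
    using M.I_maximal[OF N(1)] N(2) by auto
qed

text \<open>Carries the maximal ideal from a concrete model over to a stalk. \<open>ring_iso\<close>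
  says nothing about zeros and \<open>S\<close> is not yet known to be a ring, hence the hypothesis
  \<open>z\<close>.\<close>

lemma local_with_iso:
  fixes K :: "('a, 'm) ring_scheme" and S :: "('b, 'n) ring_scheme"
  assumes "local_with K N" and h: "h \<in> ring_iso K S" and z: "h \<zero>\<^bsub>K\<^esub> = \<zero>\<^bsub>S\<^esub>"
  shows "local_with S (h ` N)"
proof -
  have K: "cring K" and N: "ideal N K" "N \<noteq> carrier K" and U: "carrier K - N \<subseteq> Units K"
    using assms by (auto simp: local_with_def)
  interpret K: cring K by fact
  have bij: "bij_betw h (carrier K) (carrier S)" using ring_iso_memE(5)[OF h] .
  have "cring (S\<lparr>zero := h \<zero>\<^bsub>K\<^esub>\<rparr>)" by (rule K.ring_iso_imp_img_cring[OF h])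
  then have S: "cring S" by (simp add: z)
  interpret S: cring S by fact
  let ?g = "inv_into (carrier K) h"
  have g: "?g \<in> ring_iso S K" using ring_iso_set_sym[OF K.ring_axioms h] .
  interpret g: ring_hom_ring S K ?g
    using g by unfold_locales (auto simp: ring_iso_def)
  have NK: "N \<subseteq> carrier K" using ideal.Icarr[OF N(1)] by auto
  have eq: "{y \<in> carrier S. ?g y \<in> N} = h ` N"
  proof -
    have "?g (h a) = a" if "a \<in> N" for a
      using that NK bij by (simp add: bij_betw_inv_into_left subset_iff)
    moreover have "h (?g y) = y" if "y \<in> carrier S" for y
      using that bij by (simp add: bij_betw_inv_into_right)
    ultimately show ?thesis
      using NK bij by (force simp: bij_betw_def)
  qed
  have "ideal (h ` N) S" using g.ideal_vimage[OF N(1)] eq by simp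
  moreover have "h ` N \<noteq> carrier S"
    using N(2) NK bij by (metis bij_betw_def inj_on_image_eq_iff order_refl)
  moreover have "carrier S - h ` N \<subseteq> Units S"
  proof
    fix y assume y: "y \<in> carrier S - h ` N"
    then obtain a where a: "a \<in> carrier K" "y = h a" using bij by (auto simp: bij_betw_def)
    then have "a \<in> Units K" using y U by auto
    then obtain b where b: "b \<in> carrier K" "b \<otimes>\<^bsub>K\<^esub> a = \<one>\<^bsub>K\<^esub>" "a \<otimes>\<^bsub>K\<^esub> b = \<one>\<^bsub>K\<^esub>"
      by (auto simp: Units_def)
    have "h b \<otimes>\<^bsub>S\<^esub> h a = \<one>\<^bsub>S\<^esub>" "h a \<otimes>\<^bsub>S\<^esub> h b = \<one>\<^bsub>S\<^esub>"
      using a b ring_iso_memE(2,4)[OF h] by metis+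
    then show "y \<in> Units S"
      using a b ring_iso_memE(1)[OF h] by (auto simp: Units_def)
  qed
  ultimately show ?thesis using S by (auto simp: local_with_def)
qed

definition germ_at :: "('p, 's) ringed_space \<Rightarrow> 'p \<Rightarrow> 'p set \<Rightarrow> 's \<Rightarrow> bool" where
  "germ_at X x U s \<longleftrightarrow> openin (lrs_top X) U \<and> x \<in> U \<and> s \<in> carrier (lrs_sections X U)"

lemma germ_rel_iff:
  "((U, s), (V, t)) \<in> germ_rel X x \<longleftrightarrow> germ_at X x U s \<and> germ_at X x V t \<and>
    (\<exists>W. openin (lrs_top X) W \<and> x \<in> W \<and> W \<subseteq> U \<inter> V \<and> lrs_restr X U W s = lrs_restr X V W t)"
  by (simp add: germ_rel_def germ_at_def)

text \<open>\<open>v U s\<close> is the value in \<open>K\<close> of the germ at \<open>x\<close> of the section \<open>s\<close> over \<open>U\<close>; the axioms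
  identify the stalk at \<open>x\<close> with \<open>K\<close>.\<close>

locale stalk_model =
  fixes X :: "('p, 's) ringed_space" and x :: 'p and K :: "('k, 'm) ring_scheme"
    and v :: "'p set \<Rightarrow> 's \<Rightarrow> 'k"
  assumes v_closed: "germ_at X x U s \<Longrightarrow> v U s \<in> carrier K"
    and v_surj: "k \<in> carrier K \<Longrightarrow> \<exists>U s. germ_at X x U s \<and> v U s = k"
    and germ_iff: "germ_at X x U s \<Longrightarrow> germ_at X x V t \<Longrightarrow>
      (\<exists>W. openin (lrs_top X) W \<and> x \<in> W \<and> W \<subseteq> U \<inter> V \<and> lrs_restr X U W s = lrs_restr X V W t)
        \<longleftrightarrow> v U s = v V t"
    and v_mult: "germ_at X x U s \<Longrightarrow> germ_at X x V t \<Longrightarrow>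
      germ_at X x (U \<inter> V)
        (lrs_restr X U (U \<inter> V) s \<otimes>\<^bsub>lrs_sections X (U \<inter> V)\<^esub> lrs_restr X V (U \<inter> V) t) \<and>
      v (U \<inter> V) (lrs_restr X U (U \<inter> V) s \<otimes>\<^bsub>lrs_sections X (U \<inter> V)\<^esub> lrs_restr X V (U \<inter> V) t)
        = v U s \<otimes>\<^bsub>K\<^esub> v V t"
    and v_add: "germ_at X x U s \<Longrightarrow> germ_at X x V t \<Longrightarrow>
      germ_at X x (U \<inter> V)
        (lrs_restr X U (U \<inter> V) s \<oplus>\<^bsub>lrs_sections X (U \<inter> V)\<^esub> lrs_restr X V (U \<inter> V) t) \<and>
      v (U \<inter> V) (lrs_restr X U (U \<inter> V) s \<oplus>\<^bsub>lrs_sections X (U \<inter> V)\<^esub> lrs_restr X V (U \<inter> V) t)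
        = v U s \<oplus>\<^bsub>K\<^esub> v V t"
    and v_one: "germ_at X x (lrs_points X) \<one>\<^bsub>lrs_sections X (lrs_points X)\<^esub> \<and>
      v (lrs_points X) \<one>\<^bsub>lrs_sections X (lrs_points X)\<^esub> = \<one>\<^bsub>K\<^esub>"
    and v_zero: "germ_at X x (lrs_points X) \<zero>\<^bsub>lrs_sections X (lrs_points X)\<^esub> \<and>
      v (lrs_points X) \<zero>\<^bsub>lrs_sections X (lrs_points X)\<^esub> = \<zero>\<^bsub>K\<^esub>"
begin

text \<open>The germ with value \<open>k\<close>, as the set of its representatives; the axioms make
  these sets exactly the classes of \<open>germ_rel X x\<close>.\<close>

definition cls :: "'k \<Rightarrow> ('p set \<times> 's) set" where
  "cls k = {(U, s). germ_at X x U s \<and> v U s = k}"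

lemma germ_class:
  assumes "germ_at X x U s"
  shows "germ_rel X x `` {(U, s)} = cls (v U s)"
proof -
  have "((U, s), (V, t)) \<in> germ_rel X x \<longleftrightarrow> germ_at X x V t \<and> v V t = v U s" for V t
    unfolding germ_rel_iff using assms germ_iff[OF assms, of V t] by metis
  then show ?thesis by (auto simp: cls_def)
qed

lemma carrier_stalk: "carrier (stalk X x) = cls ` carrier K"
proof -
  have "carrier (stalk X x) = {germ_rel X x `` {(U, s)} | U s. germ_at X x U s}"
    by (auto simp: stalk_def quotient_def germ_at_def)
  also have "\<dots> = {cls (v U s) | U s. germ_at X x U s}"
    using germ_class by (intro Collect_cong) (metis (no_types, lifting))
  also have "\<dots> = cls ` carrier K"
    using v_closed v_surj by fastforce
  finally show ?thesis .
qed

lemma cls_nonempty: "k \<in> carrier K \<Longrightarrow> cls k \<noteq> {}"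
  using v_surj by (fastforce simp: cls_def)

lemma cls_inj: "inj_on cls (carrier K)"
proof (rule inj_onI)
  fix k l assume "k \<in> carrier K" "l \<in> carrier K" "cls k = cls l"
  with cls_nonempty[of k] show "k = l" by (auto simp: cls_def)
qed

text \<open>The operations of \<open>stalk\<close> and the map \<open>stalk_map\<close> are unions
  over all representatives of a class; such a union is a single value once it is constant on the
  nonempty class.\<close>

lemma UN_cls:
  assumes "k \<in> carrier K" and "\<And>U s. germ_at X x U s \<Longrightarrow> v U s = k \<Longrightarrow> f (U, s) = c"
  shows "(\<Union>z\<in>cls k. f z) = c"
proof -
  have "f z = c" if "z \<in> cls k" for z
    using that assms(2) by (auto simp: cls_def)
  then show ?thesis using cls_nonempty[OF assms(1)] by auto
qed

lemma stalk_mult: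
  assumes "k \<in> carrier K" "l \<in> carrier K"
  shows "cls k \<otimes>\<^bsub>stalk X x\<^esub> cls l = cls (k \<otimes>\<^bsub>K\<^esub> l)"
  unfolding stalk_def
  by (simp, rule UN_cls[OF assms(1)], simp, rule UN_cls[OF assms(2)]) (simp add: germ_class v_mult)

lemma stalk_add:
  assumes "k \<in> carrier K" "l \<in> carrier K"
  shows "cls k \<oplus>\<^bsub>stalk X x\<^esub> cls l = cls (k \<oplus>\<^bsub>K\<^esub> l)"
  unfolding stalk_def
  by (simp, rule UN_cls[OF assms(1)], simp, rule UN_cls[OF assms(2)]) (simp add: germ_class v_add)

lemma stalk_one: "\<one>\<^bsub>stalk X x\<^esub> = cls \<one>\<^bsub>K\<^esub>"
  using germ_class v_one by (simp add: stalk_def)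

lemma stalk_zero: "\<zero>\<^bsub>stalk X x\<^esub> = cls \<zero>\<^bsub>K\<^esub>"
  using germ_class v_zero by (simp add: stalk_def)

lemma cls_iso: "cls \<in> ring_iso K (stalk X x)"
  by (rule ring_iso_memI)
     (auto simp: carrier_stalk stalk_mult stalk_add stalk_one bij_betw_def cls_inj)

lemma stalk_maximal_ideal:
  assumes "local_with K N"
  shows "the_maximal_ideal (stalk X x) = cls ` N"
  using local_with_iso[OF assms cls_iso] by (intro the_maximal_ideal_eq) (simp add: stalk_zero)

lemma germ_in_maximal_ideal_iff:
  assumes "local_with K N" "germ_at X x U s"
  shows "germ_rel X x `` {(U, s)} \<in> the_maximal_ideal (stalk X x) \<longleftrightarrow> v U s \<in> N"
proof -
  have "N \<subseteq> carrier K" using local_with_subset[OF assms(1)] .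
  then show ?thesis
    using inj_onD[OF cls_inj] v_closed[OF assms(2)]
    by (auto simp: stalk_maximal_ideal[OF assms(1)] germ_class[OF assms(2)])
qed

end

text \<open>Replaces the stalk condition by one on a homomorphism \<open>\<theta>\<close> of models:
  compatibility with values of sections makes \<open>\<theta>\<close> the stalk map, and
  \<open>loc\<close> makes \<open>N'\<close> the preimage of \<open>N\<close>.\<close>

lemma stalk_map_local_ring_hom:
  assumes X: "stalk_model X x K v" and Y: "stalk_model Y (lrs_pt \<phi> x) K' v'"
    and lX: "local_with K N" and lY: "local_with K' N'"
    and \<theta>: "\<theta> \<in> ring_hom K' K"
    and loc: "\<And>k. k \<in> carrier K' \<Longrightarrow> \<theta> k \<in> N \<longleftrightarrow> k \<in> N'"
    and v: "\<And>U s. germ_at Y (lrs_pt \<phi> x) U s \<Longrightarrow>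
       germ_at X x (lrs_pre X \<phi> U) (lrs_comorph \<phi> U s) \<and>
       v (lrs_pre X \<phi> U) (lrs_comorph \<phi> U s) = \<theta> (v' U s)"
  shows "stalk_map X \<phi> x \<in> local_ring_hom (stalk Y (lrs_pt \<phi> x)) (stalk X x)"
proof -
  interpret X: stalk_model X x K v by fact
  interpret Y: stalk_model Y "lrs_pt \<phi> x" K' v' by fact
  interpret K': cring K' using lY by (simp add: local_with_def)
  have \<theta>c: "\<theta> k \<in> carrier K" if "k \<in> carrier K'" for k using \<theta> that ring_hom_memE by fastforce
  have map: "stalk_map X \<phi> x (Y.cls k) = X.cls (\<theta> k)" if "k \<in> carrier K'" for k
    unfolding stalk_map_def
    by (rule Y.UN_cls[OF that]) (use v X.germ_class in auto)
  have N': "N' \<subseteq> carrier K'" and N: "N \<subseteq> carrier K"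
    using local_with_subset lX lY by auto
  have "stalk_map X \<phi> x \<in> ring_hom (stalk Y (lrs_pt \<phi> x)) (stalk X x)"
  proof (rule ring_hom_memI; (unfold Y.carrier_stalk X.carrier_stalk)?)
    show "stalk_map X \<phi> x a \<in> X.cls ` carrier K" if "a \<in> Y.cls ` carrier K'" for a
      using that by (elim imageE) (simp add: map \<theta>c)
    show "stalk_map X \<phi> x (a \<otimes>\<^bsub>stalk Y (lrs_pt \<phi> x)\<^esub> b) =
        stalk_map X \<phi> x a \<otimes>\<^bsub>stalk X x\<^esub> stalk_map X \<phi> x b"
      if "a \<in> Y.cls ` carrier K'" "b \<in> Y.cls ` carrier K'" for a b
      using that
      by (elim imageE) (simp add: map \<theta>c X.stalk_mult Y.stalk_mult ring_hom_mult[OF \<theta>])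
    show "stalk_map X \<phi> x (a \<oplus>\<^bsub>stalk Y (lrs_pt \<phi> x)\<^esub> b) =
        stalk_map X \<phi> x a \<oplus>\<^bsub>stalk X x\<^esub> stalk_map X \<phi> x b"
      if "a \<in> Y.cls ` carrier K'" "b \<in> Y.cls ` carrier K'" for a b
      using that
      by (elim imageE) (simp add: map \<theta>c X.stalk_add Y.stalk_add ring_hom_add[OF \<theta>])
    show "stalk_map X \<phi> x \<one>\<^bsub>stalk Y (lrs_pt \<phi> x)\<^esub> = \<one>\<^bsub>stalk X x\<^esub>"
      by (simp add: X.stalk_one Y.stalk_one map ring_hom_one[OF \<theta>])
  qed
  moreover have mem: "X.cls (\<theta> k) \<in> X.cls ` N \<longleftrightarrow> k \<in> N'" if "k \<in> carrier K'" for k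
    using inj_on_image_mem_iff[OF X.cls_inj \<theta>c[OF that] N] loc[OF that] by simp
  have "{a \<in> Y.cls ` carrier K'. stalk_map X \<phi> x a \<in> X.cls ` N} = Y.cls ` N'"
  proof (rule Set.set_eqI)
    fix a
    show "a \<in> {a \<in> Y.cls ` carrier K'. stalk_map X \<phi> x a \<in> X.cls ` N} \<longleftrightarrow> a \<in> Y.cls ` N'"
    proof (cases "a \<in> Y.cls ` carrier K'")
      case True
      then obtain k where k: "k \<in> carrier K'" "a = Y.cls k" by blast
      then show ?thesis
        using mem inj_on_image_mem_iff[OF Y.cls_inj k(1) N'] by (simp add: map)
    qed (use N' in blast)
  qed
  then have "{a \<in> carrier (stalk Y (lrs_pt \<phi> x)). stalk_map X \<phi> x a \<in> the_maximal_ideal (stalk X x)}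
      = the_maximal_ideal (stalk Y (lrs_pt \<phi> x))"
    by (simp only: X.stalk_maximal_ideal[OF lX] Y.stalk_maximal_ideal[OF lY] Y.carrier_stalk)
  ultimately show ?thesis by (simp add: local_ring_hom_def)
qed

lemma lrs_morphism_pre:
  assumes "lrs_morphism X Y \<phi>" "openin (lrs_top Y) U"
  shows "openin (lrs_top X) (lrs_pre X \<phi> U)"
proof -
  have "continuous_map (lrs_top X) (lrs_top Y) (lrs_pt \<phi>)"
    using assms(1) by (simp only: lrs_morphism_def)
  then show ?thesis
    unfolding lrs_pre_def by (rule openin_continuous_map_preimage[OF _ assms(2)])
qed

lemma lrs_morphism_germ:
  assumes "lrs_morphism X Y \<phi>" "x \<in> lrs_points X" "germ_at Y (lrs_pt \<phi> x) U s"
  shows "germ_at X x (lrs_pre X \<phi> U) (lrs_comorph \<phi> U s)"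
proof -
  have "lrs_comorph \<phi> U \<in> ring_hom (lrs_sections Y U) (lrs_sections X (lrs_pre X \<phi> U))"
    using assms by (auto simp: lrs_morphism_def germ_at_def)
  then show ?thesis
    using assms(2,3) lrs_morphism_pre[OF assms(1), of U] ring_hom_closed[of "lrs_comorph \<phi> U"]
    by (auto simp: germ_at_def lrs_pre_def)
qed

text \<open>Locality of the stalk map read off on representatives. This is the form in which it is
  applied to morphisms that are given rather than constructed.\<close>

lemma lrs_morphism_local:
  assumes \<phi>: "lrs_morphism X Y \<phi>" and x: "x \<in> lrs_points X"
    and X: "stalk_model X x K v" and Y: "stalk_model Y (lrs_pt \<phi> x) K' v'"
    and lX: "local_with K N" and lY: "local_with K' N'"
    and g: "germ_at Y (lrs_pt \<phi> x) U s"
  shows "v (lrs_pre X \<phi> U) (lrs_comorph \<phi> U s) \<in> N \<longleftrightarrow> v' U s \<in> N'"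
proof -
  interpret X: stalk_model X x K v by fact
  interpret Y: stalk_model Y "lrs_pt \<phi> x" K' v' by fact
  note gX = lrs_morphism_germ[OF \<phi> x]
  have map: "stalk_map X \<phi> x (Y.cls (v' U s)) = X.cls (v (lrs_pre X \<phi> U) (lrs_comorph \<phi> U s))"
    unfolding stalk_map_def
  \<comment> \<open>\<open>stalk_map\<close> is well defined on germs by naturality: two
    representatives agree on some \<open>W\<close>, so their pullbacks agree on the preimage of
    \<open>W\<close>.\<close>
  proof (rule Y.UN_cls[OF Y.v_closed[OF g]])
    fix V t assume t: "germ_at Y (lrs_pt \<phi> x) V t" "v' V t = v' U s"
    then obtain W where W: "openin (lrs_top Y) W" "lrs_pt \<phi> x \<in> W" "W \<subseteq> V \<inter> U"
      "lrs_restr Y V W t = lrs_restr Y U W s" using Y.germ_iff[OF t(1) g] by auto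
    have nat: "lrs_comorph \<phi> W (lrs_restr Y V' W t') =
        lrs_restr X (lrs_pre X \<phi> V') (lrs_pre X \<phi> W) (lrs_comorph \<phi> V' t')"
      if "germ_at Y (lrs_pt \<phi> x) V' t'" "W \<subseteq> V'" for V' t'
      using \<phi> W(1) that unfolding lrs_morphism_def germ_at_def by blast
    have "v (lrs_pre X \<phi> V) (lrs_comorph \<phi> V t) = v (lrs_pre X \<phi> U) (lrs_comorph \<phi> U s)"
    proof (subst X.germ_iff[OF gX[OF t(1)] gX[OF g], symmetric], intro exI conjI)
      show "openin (lrs_top X) (lrs_pre X \<phi> W)" using lrs_morphism_pre[OF \<phi> W(1)] .
      show "x \<in> lrs_pre X \<phi> W" "lrs_pre X \<phi> W \<subseteq> lrs_pre X \<phi> V \<inter> lrs_pre X \<phi> U"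
        using x W by (auto simp: lrs_pre_def)
      show "lrs_restr X (lrs_pre X \<phi> V) (lrs_pre X \<phi> W) (lrs_comorph \<phi> V t) =
        lrs_restr X (lrs_pre X \<phi> U) (lrs_pre X \<phi> W) (lrs_comorph \<phi> U s)"
        using nat[OF t(1)] nat[OF g] W by simp
    qed
    then show "(case (V, t) of (U, s) \<Rightarrow> germ_rel X x `` {(lrs_pre X \<phi> U, lrs_comorph \<phi> U s)}) =
      X.cls (v (lrs_pre X \<phi> U) (lrs_comorph \<phi> U s))"
      using X.germ_class[OF gX[OF t(1)]] by simp
  qed
  have loc: "{a \<in> carrier (stalk Y (lrs_pt \<phi> x)). stalk_map X \<phi> x a \<in> the_maximal_ideal (stalk X x)}
      = the_maximal_ideal (stalk Y (lrs_pt \<phi> x))"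
    using \<phi> x by (simp add: lrs_morphism_def local_ring_hom_def)
  have "Y.cls (v' U s) \<in> carrier (stalk Y (lrs_pt \<phi> x))"
    by (simp add: Y.carrier_stalk Y.v_closed[OF g])
  then have "X.cls (v (lrs_pre X \<phi> U) (lrs_comorph \<phi> U s)) \<in> the_maximal_ideal (stalk X x) \<longleftrightarrow>
      Y.cls (v' U s) \<in> the_maximal_ideal (stalk Y (lrs_pt \<phi> x))"
    using loc map by (metis (no_types, lifting) mem_Collect_eq)
  then show ?thesis
    using X.germ_in_maximal_ideal_iff[OF lX gX[OF g]] Y.germ_in_maximal_ideal_iff[OF lY g]
      X.germ_class[OF gX[OF g]] Y.germ_class[OF g] by simp
qed

section \<open>Sheaves of fractions\<close>

lemma (in cring) idealI':
  assumes "I \<subseteq> carrier R" "\<zero> \<in> I"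
    and add: "\<And>x y. x \<in> I \<Longrightarrow> y \<in> I \<Longrightarrow> x \<oplus> y \<in> I"
    and mult: "\<And>x r. x \<in> I \<Longrightarrow> r \<in> carrier R \<Longrightarrow> r \<otimes> x \<in> I"
  shows "ideal I R"
proof (rule idealI)
  have "\<ominus> x \<in> I" if "x \<in> I" for x
    using mult[OF that, of "\<ominus> \<one>"] that assms(1) by (auto simp: l_minus)
  then show "subgroup I (add_monoid R)"
    using assms by (intro add.subgroupI) auto
  show "x \<otimes> r \<in> I" if "x \<in> I" "r \<in> carrier R" for x r
    using mult[OF that] that assms(1) m_comm[of x r] by auto
qed (use assms ring_axioms in auto)

text \<open>The axioms on \<open>G\<close> hold both for forms of degree \<open>n\<close> and for
  the constant family \<open>\<lambda>_. carrier R\<close>. With the latter,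
  \<open>homogeneous_fracs G p\<close> consists of all fractions with denominator outside
  \<open>p\<close>, so one development serves Proj and Spec.\<close>

locale frac_data = cring R for R (structure) +
  fixes G :: "nat \<Rightarrow> 'a set" and T :: "'a set topology"
  assumes G_sub: "G n \<subseteq> carrier R"
    and G_zero: "\<zero> \<in> G n"
    and G_one: "\<one> \<in> G 0"
    and G_add: "a \<in> G n \<Longrightarrow> b \<in> G n \<Longrightarrow> a \<oplus> b \<in> G n"
    and G_minus: "a \<in> G n \<Longrightarrow> \<ominus> a \<in> G n"
    and G_mult: "a \<in> G m \<Longrightarrow> b \<in> G n \<Longrightarrow> a \<otimes> b \<in> G (m + n)"
    and prime: "p \<in> topspace T \<Longrightarrow> primeideal p R"
    and basic_open: "f \<in> G n \<Longrightarrow> openin T {p \<in> topspace T. f \<notin> p}"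
begin

abbreviation Q where "Q \<equiv> homogeneous_fracs G"
abbreviation frac where "frac p a f \<equiv> frac_rel R (Q p) `` {(a, f)}"
abbreviation FR where "FR p \<equiv> frac_ring R (Q p)"
abbreviation OX where "OX \<equiv> frac_sections R T Q"
abbreviation XX where "XX \<equiv> frac_space R T Q"

definition den :: "'a set \<Rightarrow> 'a set" where "den p = {u. \<exists>n. u \<in> G n \<and> u \<notin> p}"

definition frac_max :: "'a set \<Rightarrow> ('a \<times> 'a) set set" where
  "frac_max p = {frac p a f | a f. (a, f) \<in> Q p \<and> a \<in> p}"

definition sec :: "'a set set \<Rightarrow> 'a \<Rightarrow> 'a \<Rightarrow> 'a set \<Rightarrow> ('a \<times> 'a) set" where
  "sec U a f = (\<lambda>p\<in>U. frac p a f)"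

lemma Q_iff: "(a, f) \<in> Q p \<longleftrightarrow> (\<exists>n. a \<in> G n \<and> f \<in> G n \<and> f \<notin> p)"
  by (auto simp: homogeneous_fracs_def)

lemma QD: "(a, f) \<in> Q p \<Longrightarrow> a \<in> carrier R" "(a, f) \<in> Q p \<Longrightarrow> f \<in> carrier R"
  "(a, f) \<in> Q p \<Longrightarrow> f \<notin> p"
  using G_sub by (auto simp: Q_iff)

text \<open>A homogeneous \<open>u\<close> outside \<open>p\<close> is the denominator of
  \<open>0/u\<close>, as zero has every degree; so the witnesses allowed in \<open>frac_rel\<close>
  are exactly \<open>den p\<close>.\<close>

lemma snd_Q: "snd ` Q p = den p"
proof -
  have "u \<in> snd ` Q p" if "u \<in> den p" for u
    using that G_zero by (intro image_eqI[of _ _ "(\<zero>, u)"]) (auto simp: Q_iff den_def)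
  then show ?thesis by (auto simp: Q_iff den_def)
qed

lemma den_carrier: "u \<in> den p \<Longrightarrow> u \<in> carrier R"
  using G_sub by (auto simp: den_def)

lemma Q_den: "(a, f) \<in> Q p \<Longrightarrow> f \<in> den p"
  by (auto simp: Q_iff den_def)

lemma not_in_prime_mult:
  assumes "p \<in> topspace T" "f \<in> carrier R" "g \<in> carrier R" "f \<notin> p" "g \<notin> p"
  shows "f \<otimes> g \<notin> p"
  using primeideal.I_prime[OF prime[OF assms(1)], of f g] assms by blast

lemma one_notin: "p \<in> topspace T \<Longrightarrow> \<one> \<notin> p"
  using prime[of p] primeideal.I_notcarr[of p R] ideal.one_imp_carrier[of p R]
  by (metis primeideal.axioms(1))

lemma den_mult: "p \<in> topspace T \<Longrightarrow> u \<in> den p \<Longrightarrow> w \<in> den p \<Longrightarrow> u \<otimes> w \<in> den p"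
  using G_mult not_in_prime_mult G_sub unfolding den_def by blast

lemma one_den: "p \<in> topspace T \<Longrightarrow> \<one> \<in> den p"
  using G_one one_notin by (auto simp: den_def)

lemma Q_mult:
  assumes "p \<in> topspace T" "(a, f) \<in> Q p" "(b, g) \<in> Q p"
  shows "(a \<otimes> b, f \<otimes> g) \<in> Q p"
proof -
  obtain m n where "a \<in> G m" "f \<in> G m" "b \<in> G n" "g \<in> G n" using assms by (auto simp: Q_iff)
  then show ?thesis
    using G_mult not_in_prime_mult[OF assms(1)] QD[OF assms(2)] QD[OF assms(3)] unfolding Q_iff
    by blast
qed

lemma Q_add:
  assumes "p \<in> topspace T" "(a, f) \<in> Q p" "(b, g) \<in> Q p"
  shows "(a \<otimes> g \<oplus> b \<otimes> f, f \<otimes> g) \<in> Q p"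
proof -
  obtain m n where *: "a \<in> G m" "f \<in> G m" "b \<in> G n" "g \<in> G n" using assms by (auto simp: Q_iff)
  have "b \<otimes> f \<in> G (m + n)" using G_mult[OF *(3,2)] by (simp add: add.commute)
  then show ?thesis
    using * G_mult G_add not_in_prime_mult[OF assms(1)] QD[OF assms(2)] QD[OF assms(3)]
    unfolding Q_iff by blast
qed

lemma Q_one: "p \<in> topspace T \<Longrightarrow> (\<one>, \<one>) \<in> Q p"
  using G_one one_notin by (auto simp: Q_iff)

lemma Q_zero: "p \<in> topspace T \<Longrightarrow> (\<zero>, \<one>) \<in> Q p"
  using G_one G_zero one_notin by (auto simp: Q_iff)

lemma Q_inv: "(a, f) \<in> Q p \<Longrightarrow> a \<notin> p \<Longrightarrow> (f, a) \<in> Q p"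
  by (auto simp: Q_iff)

lemma Q_minus: "(a, f) \<in> Q p \<Longrightarrow> (\<ominus> a, f) \<in> Q p"
  using G_minus by (auto simp: Q_iff)

lemma frac_rel_iff:
  "((a, f), (b, g)) \<in> frac_rel R (Q p) \<longleftrightarrow>
     (a, f) \<in> Q p \<and> (b, g) \<in> Q p \<and> (\<exists>u\<in>den p. u \<otimes> (a \<otimes> g) = u \<otimes> (b \<otimes> f))"
proof -
  have "u \<otimes> (a \<otimes> g \<ominus> b \<otimes> f) = \<zero> \<longleftrightarrow> u \<otimes> (a \<otimes> g) = u \<otimes> (b \<otimes> f)"
    if "(a, f) \<in> Q p" "(b, g) \<in> Q p" "u \<in> den p" for u
  proof -
    have "u \<otimes> (a \<otimes> g \<ominus> b \<otimes> f) = u \<otimes> (a \<otimes> g) \<ominus> u \<otimes> (b \<otimes> f)"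
      using QD[OF that(1)] QD[OF that(2)] den_carrier[OF that(3)]
      by (simp add: minus_eq r_distr r_minus)
    then show ?thesis
      using QD[OF that(1)] QD[OF that(2)] den_carrier[OF that(3)] by simp
  qed
  then show ?thesis
    by (auto simp: frac_rel_def snd_Q)
qed

lemma equiv_frac_rel:
  assumes p: "p \<in> topspace T"
  shows "equiv (Q p) (frac_rel R (Q p))"
proof (rule equivI)
  show "frac_rel R (Q p) \<subseteq> Q p \<times> Q p" by (auto simp: frac_rel_def)
  show "refl_on (Q p) (frac_rel R (Q p))"
    using one_den[OF p] by (auto simp: refl_on_def frac_rel_iff)
  show "sym (frac_rel R (Q p))"
    by (rule symI) (auto simp: frac_rel_iff, metis)
  show "trans (frac_rel R (Q p))"
  proof (rule transI, clarify)
    fix a f b g c h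
    assume 1: "((a, f), (b, g)) \<in> frac_rel R (Q p)" and 2: "((b, g), (c, h)) \<in> frac_rel R (Q p)"
    from 1 2 have q: "(a, f) \<in> Q p" "(b, g) \<in> Q p" "(c, h) \<in> Q p" by (auto simp: frac_rel_iff)
    note c = QD[OF q(1)] QD[OF q(2)] QD[OF q(3)]
    obtain u where u: "u \<in> den p" "u \<otimes> (a \<otimes> g) = u \<otimes> (b \<otimes> f)" using 1 by (auto simp: frac_rel_iff)
    obtain w where w: "w \<in> den p" "w \<otimes> (b \<otimes> h) = w \<otimes> (c \<otimes> g)" using 2 by (auto simp: frac_rel_iff)
    note uw = den_carrier[OF u(1)] den_carrier[OF w(1)]
    \<comment> \<open>The witness contains the middle denominator \<open>g\<close>, which is in
      \<open>den p\<close> too: it lets the first relation turn \<open>a g\<close> into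
      \<open>b f\<close>, and the second turn \<open>b h\<close> into \<open>c g\<close>.\<close>
    have "(u \<otimes> w \<otimes> g) \<otimes> (a \<otimes> h) = (w \<otimes> h) \<otimes> (u \<otimes> (a \<otimes> g))" using c uw by (simp add: m_ac)
    also have "\<dots> = (u \<otimes> f) \<otimes> (w \<otimes> (b \<otimes> h))" using c uw by (simp add: u(2) m_ac)
    also have "\<dots> = (u \<otimes> w \<otimes> g) \<otimes> (c \<otimes> f)" using c uw by (simp add: w(2) m_ac)
    finally have "(u \<otimes> w \<otimes> g) \<otimes> (a \<otimes> h) = (u \<otimes> w \<otimes> g) \<otimes> (c \<otimes> f)" .
    moreover have "u \<otimes> w \<otimes> g \<in> den p" using u w Q_den[OF q(2)] den_mult[OF p] by blast
    ultimately show "((a, f), (c, h)) \<in> frac_rel R (Q p)" using q by (auto simp: frac_rel_iff)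
  qed
qed

lemma frac_eq_iff:
  assumes "p \<in> topspace T" "(a, f) \<in> Q p" "(b, g) \<in> Q p"
  shows "frac p a f = frac p b g \<longleftrightarrow> (\<exists>u\<in>den p. u \<otimes> (a \<otimes> g) = u \<otimes> (b \<otimes> f))"
  using eq_equiv_class_iff[OF equiv_frac_rel[OF assms(1)] assms(2,3)] assms(2,3)
  by (simp add: frac_rel_iff)

lemma frac_eqI:
  assumes "p \<in> topspace T" "(a, f) \<in> Q p" "(b, g) \<in> Q p" "a \<otimes> g = b \<otimes> f"
  shows "frac p a f = frac p b g"
  using frac_eq_iff[OF assms(1-3)] one_den[OF assms(1)] assms(4) by auto

lemma frac_self: "p \<in> topspace T \<Longrightarrow> (a, f) \<in> Q p \<Longrightarrow> (a, f) \<in> frac p a f"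
  using equiv_class_self[OF equiv_frac_rel] by blast

lemma mem_frac:
  assumes "p \<in> topspace T" "(b, g) \<in> frac p a f"
  shows "(b, g) \<in> Q p" "frac p b g = frac p a f"
  using assms equiv_class_eq[OF equiv_frac_rel[OF assms(1)], of "(a, f)" "(b, g)"]
  by (auto simp: frac_rel_iff)

lemma carrier_FR: "carrier (FR p) = {frac p a f | a f. (a, f) \<in> Q p}"
  by (auto simp: frac_ring_def quotient_def)

lemma frac_closed: "(a, f) \<in> Q p \<Longrightarrow> frac p a f \<in> carrier (FR p)"
  by (auto simp: carrier_FR)

text \<open>The operations of \<open>frac_ring\<close> are unions over representatives, as for
  stalks; this reduces each computation to independence of the representative.\<close>

lemma UN_frac:
  assumes "p \<in> topspace T" "(a, f) \<in> Q p"
    and "\<And>b g. (b, g) \<in> Q p \<Longrightarrow> frac p b g = frac p a f \<Longrightarrow> h (b, g) = c"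
  shows "(\<Union>z\<in>frac p a f. h z) = c"
proof -
  have "h z = c" if "z \<in> frac p a f" for z
    using that mem_frac[OF assms(1), of "fst z" "snd z" a f] assms(3)[of "fst z" "snd z"] by simp
  then show ?thesis using frac_self[OF assms(1,2)] by auto
qed

lemma FR_mult:
  assumes p: "p \<in> topspace T" and q: "(a, f) \<in> Q p" "(b, g) \<in> Q p"
  shows "frac p a f \<otimes>\<^bsub>FR p\<^esub> frac p b g = frac p (a \<otimes> b) (f \<otimes> g)"
  unfolding frac_ring_def
proof (simp, rule UN_frac[OF p q(1)], simp, rule UN_frac[OF p q(2)], simp)
  fix a' f' b' g'
  assume q': "(a', f') \<in> Q p" "(b', g') \<in> Q p"
    and eq: "frac p a' f' = frac p a f" "frac p b' g' = frac p b g"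
  note c = QD[OF q(1)] QD[OF q(2)] QD[OF q'(1)] QD[OF q'(2)]
  obtain u where u: "u \<in> den p" "u \<otimes> (a' \<otimes> f) = u \<otimes> (a \<otimes> f')"
    using eq(1) frac_eq_iff[OF p q'(1) q(1)] by auto
  obtain w where w: "w \<in> den p" "w \<otimes> (b' \<otimes> g) = w \<otimes> (b \<otimes> g')"
    using eq(2) frac_eq_iff[OF p q'(2) q(2)] by auto
  note uw = den_carrier[OF u(1)] den_carrier[OF w(1)]
  have "(u \<otimes> w) \<otimes> (a' \<otimes> b' \<otimes> (f \<otimes> g)) = (u \<otimes> (a' \<otimes> f)) \<otimes> (w \<otimes> (b' \<otimes> g))"
    using c uw by (simp add: m_ac)
  also have "\<dots> = (u \<otimes> w) \<otimes> (a \<otimes> b \<otimes> (f' \<otimes> g'))"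
    using c uw unfolding u(2) w(2) by (simp add: m_ac)
  finally show "frac p (a' \<otimes> b') (f' \<otimes> g') = frac p (a \<otimes> b) (f \<otimes> g)"
    using frac_eq_iff[OF p Q_mult[OF p q'] Q_mult[OF p q]] den_mult[OF p u(1) w(1)] by auto
qed

lemma FR_add:
  assumes p: "p \<in> topspace T" and q: "(a, f) \<in> Q p" "(b, g) \<in> Q p"
  shows "frac p a f \<oplus>\<^bsub>FR p\<^esub> frac p b g = frac p (a \<otimes> g \<oplus> b \<otimes> f) (f \<otimes> g)"
  unfolding frac_ring_def
proof (simp, rule UN_frac[OF p q(1)], simp, rule UN_frac[OF p q(2)], simp)
  fix a' f' b' g'
  assume q': "(a', f') \<in> Q p" "(b', g') \<in> Q p"
    and eq: "frac p a' f' = frac p a f" "frac p b' g' = frac p b g"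
  note c = QD[OF q(1)] QD[OF q(2)] QD[OF q'(1)] QD[OF q'(2)]
  obtain u where u: "u \<in> den p" "u \<otimes> (a' \<otimes> f) = u \<otimes> (a \<otimes> f')"
    using eq(1) frac_eq_iff[OF p q'(1) q(1)] by auto
  obtain w where w: "w \<in> den p" "w \<otimes> (b' \<otimes> g) = w \<otimes> (b \<otimes> g')"
    using eq(2) frac_eq_iff[OF p q'(2) q(2)] by auto
  note uw = den_carrier[OF u(1)] den_carrier[OF w(1)]
  have "(u \<otimes> w) \<otimes> ((a' \<otimes> g' \<oplus> b' \<otimes> f') \<otimes> (f \<otimes> g)) =
      (w \<otimes> (g \<otimes> g')) \<otimes> (u \<otimes> (a' \<otimes> f)) \<oplus> (u \<otimes> (f \<otimes> f')) \<otimes> (w \<otimes> (b' \<otimes> g))"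
    using c uw by (simp add: m_ac l_distr r_distr)
  also have "\<dots> = (u \<otimes> w) \<otimes> ((a \<otimes> g \<oplus> b \<otimes> f) \<otimes> (f' \<otimes> g'))"
    using c uw unfolding u(2) w(2) by (simp add: m_ac l_distr r_distr)
  finally show "frac p (a' \<otimes> g' \<oplus> b' \<otimes> f') (f' \<otimes> g') = frac p (a \<otimes> g \<oplus> b \<otimes> f) (f \<otimes> g)"
    using frac_eq_iff[OF p Q_add[OF p q'] Q_add[OF p q]] den_mult[OF p u(1) w(1)] by auto
qed

lemma FR_one: "\<one>\<^bsub>FR p\<^esub> = frac p \<one> \<one>" and FR_zero: "\<zero>\<^bsub>FR p\<^esub> = frac p \<zero> \<one>"
  by (simp_all add: frac_ring_def)

lemma FR_cases:
  assumes "x \<in> carrier (FR p)"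
  obtains a f where "(a, f) \<in> Q p" "x = frac p a f"
  using assms by (auto simp: carrier_FR)

lemma FR_cring:
  assumes p: "p \<in> topspace T"
  shows "cring (FR p)"
proof (rule cringI)
  show "abelian_group (FR p)"
  proof (rule abelian_groupI)
    fix x y assume "x \<in> carrier (FR p)" "y \<in> carrier (FR p)"
    then obtain a f b g where q: "(a, f) \<in> Q p" "x = frac p a f" "(b, g) \<in> Q p" "y = frac p b g"
      by (metis FR_cases)
    note c = QD[OF q(1)] QD[OF q(3)]
    show "x \<oplus>\<^bsub>FR p\<^esub> y \<in> carrier (FR p)"
      using q p by (simp add: FR_add frac_closed Q_add)
    show "x \<oplus>\<^bsub>FR p\<^esub> y = y \<oplus>\<^bsub>FR p\<^esub> x"
      using q c p by (simp add: FR_add m_comm a_comm)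
  next
    show "\<zero>\<^bsub>FR p\<^esub> \<in> carrier (FR p)" using p by (simp add: FR_zero frac_closed Q_zero)
  next
    fix x y z assume "x \<in> carrier (FR p)" "y \<in> carrier (FR p)" "z \<in> carrier (FR p)"
    then obtain a f b g d h where q: "(a, f) \<in> Q p" "x = frac p a f" "(b, g) \<in> Q p" "y = frac p b g"
      "(d, h) \<in> Q p" "z = frac p d h"
      by (metis FR_cases)
    note c = QD[OF q(1)] QD[OF q(3)] QD[OF q(5)]
    show "x \<oplus>\<^bsub>FR p\<^esub> y \<oplus>\<^bsub>FR p\<^esub> z = x \<oplus>\<^bsub>FR p\<^esub> (y \<oplus>\<^bsub>FR p\<^esub> z)"
      using q c p by (simp add: FR_add Q_add m_ac a_ac l_distr r_distr)
  next
    fix x assume "x \<in> carrier (FR p)"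
    then obtain a f where q: "(a, f) \<in> Q p" "x = frac p a f" by (metis FR_cases)
    note c = QD[OF q(1)]
    show "\<zero>\<^bsub>FR p\<^esub> \<oplus>\<^bsub>FR p\<^esub> x = x"
      using q c p by (simp add: FR_add FR_zero Q_zero)
    have "frac p (\<ominus> a) f \<oplus>\<^bsub>FR p\<^esub> x = frac p ((\<ominus> a) \<otimes> f \<oplus> a \<otimes> f) (f \<otimes> f)"
      using q p by (simp add: FR_add Q_minus)
    also have "\<dots> = frac p \<zero> \<one>"
      using Q_add[OF p Q_minus[OF q(1)] q(1)] Q_zero[OF p] c
      by (intro frac_eqI[OF p]) (auto simp: l_minus l_neg)
    finally show "\<exists>y\<in>carrier (FR p). y \<oplus>\<^bsub>FR p\<^esub> x = \<zero>\<^bsub>FR p\<^esub>"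
      using frac_closed[OF Q_minus[OF q(1)]] by (auto simp: FR_zero)
  qed
  show "comm_monoid (FR p)"
  proof (rule comm_monoidI)
    fix x y assume "x \<in> carrier (FR p)" "y \<in> carrier (FR p)"
    then obtain a f b g where q: "(a, f) \<in> Q p" "x = frac p a f" "(b, g) \<in> Q p" "y = frac p b g"
      by (metis FR_cases)
    note c = QD[OF q(1)] QD[OF q(3)]
    show "x \<otimes>\<^bsub>FR p\<^esub> y \<in> carrier (FR p)"
      using q p by (simp add: FR_mult frac_closed Q_mult)
    show "x \<otimes>\<^bsub>FR p\<^esub> y = y \<otimes>\<^bsub>FR p\<^esub> x"
      using q c p by (simp add: FR_mult m_comm)
  next
    show "\<one>\<^bsub>FR p\<^esub> \<in> carrier (FR p)" using p by (simp add: FR_one frac_closed Q_one)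
  next
    fix x y z assume "x \<in> carrier (FR p)" "y \<in> carrier (FR p)" "z \<in> carrier (FR p)"
    then obtain a f b g d h where q: "(a, f) \<in> Q p" "x = frac p a f" "(b, g) \<in> Q p" "y = frac p b g"
      "(d, h) \<in> Q p" "z = frac p d h"
      by (metis FR_cases)
    note c = QD[OF q(1)] QD[OF q(3)] QD[OF q(5)]
    show "x \<otimes>\<^bsub>FR p\<^esub> y \<otimes>\<^bsub>FR p\<^esub> z = x \<otimes>\<^bsub>FR p\<^esub> (y \<otimes>\<^bsub>FR p\<^esub> z)"
      using q c p by (simp add: FR_mult Q_mult m_ac)
  next
    fix x assume "x \<in> carrier (FR p)"
    then obtain a f where q: "(a, f) \<in> Q p" "x = frac p a f" by (metis FR_cases)
    note c = QD[OF q(1)]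
    show "\<one>\<^bsub>FR p\<^esub> \<otimes>\<^bsub>FR p\<^esub> x = x"
      using q c p by (simp add: FR_mult FR_one Q_one)
  qed
  fix x y z assume "x \<in> carrier (FR p)" "y \<in> carrier (FR p)" "z \<in> carrier (FR p)"
  then obtain a f b g d h where q: "(a, f) \<in> Q p" "x = frac p a f" "(b, g) \<in> Q p" "y = frac p b g"
    "(d, h) \<in> Q p" "z = frac p d h"
    by (metis FR_cases)
  note c = QD[OF q(1)] QD[OF q(3)] QD[OF q(5)]
  \<comment> \<open>Unlike the earlier axioms this is no literal identity of numerators and
    denominators: the two sides differ by the factor \<open>h\<close>, hence the detour over
    \<open>frac_eqI\<close>.\<close>
  have "(x \<oplus>\<^bsub>FR p\<^esub> y) \<otimes>\<^bsub>FR p\<^esub> z = frac p ((a \<otimes> g \<oplus> b \<otimes> f) \<otimes> d) ((f \<otimes> g) \<otimes> h)"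
    using q p by (simp add: FR_add FR_mult Q_add)
  also have "\<dots> = frac p ((a \<otimes> d) \<otimes> (g \<otimes> h) \<oplus> (b \<otimes> d) \<otimes> (f \<otimes> h)) ((f \<otimes> h) \<otimes> (g \<otimes> h))"
    using q(1,3,5) p c
    by (intro frac_eqI Q_mult Q_add) (auto simp: m_ac a_ac l_distr r_distr)
  also have "\<dots> = (x \<otimes>\<^bsub>FR p\<^esub> z) \<oplus>\<^bsub>FR p\<^esub> (y \<otimes>\<^bsub>FR p\<^esub> z)"
    using q p by (simp add: FR_add FR_mult Q_mult)
  finally show "(x \<oplus>\<^bsub>FR p\<^esub> y) \<otimes>\<^bsub>FR p\<^esub> z = (x \<otimes>\<^bsub>FR p\<^esub> z) \<oplus>\<^bsub>FR p\<^esub> (y \<otimes>\<^bsub>FR p\<^esub> z)" .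
qed

text \<open>If \<open>a/f = b/g\<close> with \<open>b\<close> in \<open>p\<close>, then
  \<open>u a g = u b f\<close> lies in \<open>p\<close>, while \<open>u\<close> and \<open>g\<close>
  do not; so membership of the numerator is independent of the representative.\<close>

lemma frac_in_max_iff:
  assumes p: "p \<in> topspace T" and q: "(a, f) \<in> Q p"
  shows "frac p a f \<in> frac_max p \<longleftrightarrow> a \<in> p"
proof
  assume "frac p a f \<in> frac_max p"
  then obtain b g where b: "(b, g) \<in> Q p" "b \<in> p" "frac p a f = frac p b g"
    by (auto simp: frac_max_def)
  then obtain u where u: "u \<in> den p" "u \<otimes> (a \<otimes> g) = u \<otimes> (b \<otimes> f)"
    using frac_eq_iff[OF p q] by auto
  interpret P: primeideal p R by (rule prime[OF p])
  note c = QD[OF q] QD[OF b(1)] den_carrier[OF u(1)]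
  have "u \<otimes> (b \<otimes> f) \<in> p" using b c P.I_l_closed P.I_r_closed by simp
  then have "u \<otimes> (a \<otimes> g) \<in> p" using u by simp
  moreover have "u \<notin> p" using u by (auto simp: den_def)
  ultimately show "a \<in> p" using c P.I_prime by (metis m_closed)
qed (use q in \<open>auto simp: frac_max_def\<close>)

lemma FR_local:
  assumes p: "p \<in> topspace T"
  shows "local_with (FR p) (frac_max p)"
proof -
  interpret FR: cring "FR p" by (rule FR_cring[OF p])
  interpret P: primeideal p R by (rule prime[OF p])
  have "ideal (frac_max p) (FR p)"
  proof (rule FR.idealI')
    show "frac_max p \<subseteq> carrier (FR p)" by (auto simp: frac_max_def carrier_FR)
    show "\<zero>\<^bsub>FR p\<^esub> \<in> frac_max p"
      using frac_in_max_iff[OF p Q_zero[OF p]] by (simp add: FR_zero)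
    fix x assume "x \<in> frac_max p"
    then obtain a f where a: "(a, f) \<in> Q p" "a \<in> p" "x = frac p a f" by (auto simp: frac_max_def)
    note c = QD[OF a(1)]
    {
      fix y assume "y \<in> frac_max p"
      then obtain b g where b: "(b, g) \<in> Q p" "b \<in> p" "y = frac p b g" by (auto simp: frac_max_def)
      have "a \<otimes> g \<oplus> b \<otimes> f \<in> p"
        using a b c QD[OF b(1)] P.I_r_closed P.a_closed by simp
      then show "x \<oplus>\<^bsub>FR p\<^esub> y \<in> frac_max p"
        using frac_in_max_iff[OF p Q_add[OF p a(1) b(1)]] by (simp add: a b FR_add p)
    next
      fix y assume "y \<in> carrier (FR p)"
      then obtain b g where b: "(b, g) \<in> Q p" "y = frac p b g" by (metis FR_cases)
      have "b \<otimes> a \<in> p" using a c QD[OF b(1)] P.I_l_closed by simp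
      then show "y \<otimes>\<^bsub>FR p\<^esub> x \<in> frac_max p"
        using frac_in_max_iff[OF p Q_mult[OF p b(1) a(1)]] by (simp add: a b FR_mult p)
    }
  qed
  moreover have "frac p \<one> \<one> \<notin> frac_max p"
    using frac_in_max_iff[OF p Q_one[OF p]] one_notin[OF p] by simp
  then have "frac_max p \<noteq> carrier (FR p)" using frac_closed[OF Q_one[OF p]] by auto
  moreover have "x \<in> Units (FR p)" if x: "x \<in> carrier (FR p)" "x \<notin> frac_max p" for x
  proof -
    obtain a f where a: "(a, f) \<in> Q p" "x = frac p a f" using x by (metis FR_cases)
    then have "a \<notin> p" using x frac_in_max_iff[OF p] by auto
    then have i: "(f, a) \<in> Q p" by (rule Q_inv[OF a(1)])
    have "frac p f a \<otimes>\<^bsub>FR p\<^esub> x = \<one>\<^bsub>FR p\<^esub>"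
      using a i p QD[OF a(1)] Q_mult[OF p i a(1)] Q_one[OF p]
      by (simp add: FR_mult FR_one) (intro frac_eqI, auto simp: m_comm)
    then show ?thesis
      using x frac_closed[OF i] FR.m_comm[OF x(1) frac_closed[OF i]] unfolding Units_def by auto
  qed
  ultimately show ?thesis using FR.cring_axioms by (auto simp: local_with_def)
qed

lemma Q_open:
  assumes "(a, f) \<in> Q p" "p \<in> topspace T"
  obtains W where "openin T W" "p \<in> W" "\<And>q. q \<in> W \<Longrightarrow> (a, f) \<in> Q q"
proof -
  obtain n where n: "a \<in> G n" "f \<in> G n" "f \<notin> p" using assms by (auto simp: Q_iff)
  show ?thesis
    by (rule that[OF basic_open[OF n(2)]]) (use n assms in \<open>auto simp: Q_iff\<close>)
qed

lemma sec_closed: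
  assumes "openin T U" "\<And>q. q \<in> U \<Longrightarrow> (a, f) \<in> Q q"
  shows "sec U a f \<in> carrier (OX U)"
  using assms by (auto simp: frac_sections_def sec_def frac_closed)

lemma section_local:
  assumes "s \<in> carrier (OX U)" "p \<in> U"
  obtains W a f where "openin T W" "p \<in> W" "W \<subseteq> U" "\<And>q. q \<in> W \<Longrightarrow> (a, f) \<in> Q q"
    "\<And>q. q \<in> W \<Longrightarrow> s q = frac q a f" "restrict s W = sec W a f"
proof -
  obtain W a f where W: "openin T W" "p \<in> W" "W \<subseteq> U" "\<forall>q\<in>W. (a, f) \<in> Q q \<and> s q = frac q a f"
    using assms unfolding frac_sections_def by simp meson
  moreover have "restrict s W = sec W a f" using W(4) unfolding sec_def by (intro restrict_ext) auto
  ultimately show ?thesis using that by blast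
qed

lemma section_value_closed: "s \<in> carrier (OX U) \<Longrightarrow> p \<in> U \<Longrightarrow> s p \<in> carrier (FR p)"
  by (auto simp: frac_sections_def)

lemma section_extensional: "s \<in> carrier (OX U) \<Longrightarrow> s \<in> extensional U"
  by (simp add: frac_sections_def PiE_def)

lemma sectionI:
  assumes "s \<in> extensional U"
    and "\<And>p. p \<in> U \<Longrightarrow> \<exists>W a f. openin T W \<and> p \<in> W \<and> W \<subseteq> U \<and>
      (\<forall>q\<in>W. (a, f) \<in> Q q \<and> s q = frac q a f)"
  shows "s \<in> carrier (OX U)"
proof -
  have "s p \<in> carrier (FR p)" if "p \<in> U" for p
    using assms(2)[OF that] frac_closed by fastforce
  then show ?thesis using assms by (auto simp: frac_sections_def PiE_def)
qed

lemma restrict_closed: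
  assumes "openin T V" "V \<subseteq> U" "s \<in> carrier (OX U)"
  shows "restrict s V \<in> carrier (OX V)"
proof (rule sectionI)
  fix p assume p: "p \<in> V"
  then have pU: "p \<in> U" using assms(2) by auto
  obtain W a f where W: "openin T W" "p \<in> W" "W \<subseteq> U" "\<And>q. q \<in> W \<Longrightarrow> (a, f) \<in> Q q"
    "\<And>q. q \<in> W \<Longrightarrow> s q = frac q a f"
    using section_local[OF assms(3) pU] by metis
  then show "\<exists>W a f. openin T W \<and> p \<in> W \<and> W \<subseteq> V \<and>
      (\<forall>q\<in>W. (a, f) \<in> Q q \<and> restrict s V q = frac q a f)"
    using p assms(1) by (intro exI[of _ "W \<inter> V"] exI[of _ a] exI[of _ f]) auto
qed auto

lemma OX_mult: "s \<otimes>\<^bsub>OX U\<^esub> t = (\<lambda>p\<in>U. s p \<otimes>\<^bsub>FR p\<^esub> t p)"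
  and OX_add: "s \<oplus>\<^bsub>OX U\<^esub> t = (\<lambda>p\<in>U. s p \<oplus>\<^bsub>FR p\<^esub> t p)"
  and OX_one: "\<one>\<^bsub>OX U\<^esub> = sec U \<one> \<one>"
  and OX_zero: "\<zero>\<^bsub>OX U\<^esub> = sec U \<zero> \<one>"
  by (simp_all add: frac_sections_def sec_def frac_ring_def)

lemma OX_mult_closed:
  assumes "s \<in> carrier (OX U)" "t \<in> carrier (OX U)"
  shows "s \<otimes>\<^bsub>OX U\<^esub> t \<in> carrier (OX U)"
proof (rule sectionI)
  fix p assume p: "p \<in> U"
  obtain W a f where W: "openin T W" "p \<in> W" "W \<subseteq> U" "\<And>q. q \<in> W \<Longrightarrow> (a, f) \<in> Q q"
    "\<And>q. q \<in> W \<Longrightarrow> s q = frac q a f"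
    using section_local[OF assms(1) p] by metis
  obtain W' b g where W': "openin T W'" "p \<in> W'" "W' \<subseteq> U" "\<And>q. q \<in> W' \<Longrightarrow> (b, g) \<in> Q q"
    "\<And>q. q \<in> W' \<Longrightarrow> t q = frac q b g"
    using section_local[OF assms(2) p] by metis
  have "q \<in> topspace T" if "q \<in> W" for q using that W(1) openin_subset by blast
  then show "\<exists>W a f. openin T W \<and> p \<in> W \<and> W \<subseteq> U \<and>
      (\<forall>q\<in>W. (a, f) \<in> Q q \<and> (s \<otimes>\<^bsub>OX U\<^esub> t) q = frac q a f)"
    using W W' by (intro exI[of _ "W \<inter> W'"] exI[of _ "a \<otimes> b"] exI[of _ "f \<otimes> g"])
      (auto simp: OX_mult FR_mult Q_mult)
qed (simp add: OX_mult)

lemma OX_add_closed: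
  assumes "s \<in> carrier (OX U)" "t \<in> carrier (OX U)"
  shows "s \<oplus>\<^bsub>OX U\<^esub> t \<in> carrier (OX U)"
proof (rule sectionI)
  fix p assume p: "p \<in> U"
  obtain W a f where W: "openin T W" "p \<in> W" "W \<subseteq> U" "\<And>q. q \<in> W \<Longrightarrow> (a, f) \<in> Q q"
    "\<And>q. q \<in> W \<Longrightarrow> s q = frac q a f"
    using section_local[OF assms(1) p] by metis
  obtain W' b g where W': "openin T W'" "p \<in> W'" "W' \<subseteq> U" "\<And>q. q \<in> W' \<Longrightarrow> (b, g) \<in> Q q"
    "\<And>q. q \<in> W' \<Longrightarrow> t q = frac q b g"
    using section_local[OF assms(2) p] by metis
  have "q \<in> topspace T" if "q \<in> W" for q using that W(1) openin_subset by blast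
  then show "\<exists>W a f. openin T W \<and> p \<in> W \<and> W \<subseteq> U \<and>
      (\<forall>q\<in>W. (a, f) \<in> Q q \<and> (s \<oplus>\<^bsub>OX U\<^esub> t) q = frac q a f)"
    using W W' by (intro exI[of _ "W \<inter> W'"] exI[of _ "a \<otimes> g \<oplus> b \<otimes> f"] exI[of _ "f \<otimes> g"])
      (auto simp: OX_add FR_add Q_add)
qed (simp add: OX_add)

lemma sec_apply [simp]: "p \<in> U \<Longrightarrow> sec U a f p = frac p a f"
  by (simp add: sec_def)

lemma restrict_sec [simp]: "V \<subseteq> U \<Longrightarrow> restrict (sec U a f) V = sec V a f"
  by (simp add: sec_def inf.absorb2)

lemma sec_mult:
  assumes "U \<subseteq> topspace T" "\<And>q. q \<in> U \<Longrightarrow> (a, f) \<in> Q q" "\<And>q. q \<in> U \<Longrightarrow> (b, g) \<in> Q q"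
  shows "sec U a f \<otimes>\<^bsub>OX U\<^esub> sec U b g = sec U (a \<otimes> b) (f \<otimes> g)"
  unfolding OX_mult sec_def
proof (rule restrict_ext)
  fix q assume "q \<in> U"
  then show "restrict (\<lambda>p. frac p a f) U q \<otimes>\<^bsub>FR q\<^esub> restrict (\<lambda>p. frac p b g) U q = frac q (a \<otimes> b) (f \<otimes> g)"
    using assms by (auto simp: FR_mult subset_iff)
qed

lemma sec_add:
  assumes "U \<subseteq> topspace T" "\<And>q. q \<in> U \<Longrightarrow> (a, f) \<in> Q q" "\<And>q. q \<in> U \<Longrightarrow> (b, g) \<in> Q q"
  shows "sec U a f \<oplus>\<^bsub>OX U\<^esub> sec U b g = sec U (a \<otimes> g \<oplus> b \<otimes> f) (f \<otimes> g)"
  unfolding OX_add sec_def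
proof (rule restrict_ext)
  fix q assume "q \<in> U"
  then show "restrict (\<lambda>p. frac p a f) U q \<oplus>\<^bsub>FR q\<^esub> restrict (\<lambda>p. frac p b g) U q = frac q (a \<otimes> g \<oplus> b \<otimes> f) (f \<otimes> g)"
    using assms by (auto simp: FR_add subset_iff)
qed

lemma sec_eqI:
  assumes "U \<subseteq> topspace T" "\<And>q. q \<in> U \<Longrightarrow> (a, f) \<in> Q q" "\<And>q. q \<in> U \<Longrightarrow> (b, g) \<in> Q q"
    and "a \<otimes> g = b \<otimes> f"
  shows "sec U a f = sec U b g"
  unfolding sec_def
proof (rule restrict_ext)
  fix q assume "q \<in> U"
  then show "frac q a f = frac q b g" using assms by (intro frac_eqI) auto
qed

lemma germ_at_XX: "germ_at XX p U s \<longleftrightarrow> openin T U \<and> p \<in> U \<and> s \<in> carrier (OX U)"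
  by (simp add: germ_at_def frac_space_def)

lemma XX_simps [simp]: "lrs_top XX = T" "lrs_sections XX = OX" "lrs_restr XX U V s = restrict s V"
  by (simp_all add: frac_space_def)

text \<open>A germ is recorded by its value at \<open>p\<close>: every fraction at \<open>p\<close>
  is defined near \<open>p\<close>, and sections with equal values at \<open>p\<close> agree near
  \<open>p\<close>.\<close>

lemma stalk_model_XX:
  assumes p: "p \<in> topspace T"
  shows "stalk_model XX p (FR p) (\<lambda>U s. s p)"
proof
  show "s p \<in> carrier (FR p)" if "germ_at XX p U s" for U s
    using that section_value_closed by (auto simp: germ_at_XX)
  show "\<exists>U s. germ_at XX p U s \<and> s p = k" if "k \<in> carrier (FR p)" for k
  proof -
    obtain a f where a: "(a, f) \<in> Q p" "k = frac p a f" using \<open>k \<in> carrier (FR p)\<close> by (metis FR_cases)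
    obtain W where W: "openin T W" "p \<in> W" "\<And>q. q \<in> W \<Longrightarrow> (a, f) \<in> Q q"
      using Q_open[OF a(1) p] by metis
    then show ?thesis
      using a sec_closed[OF W(1,3)] by (intro exI[of _ W] exI[of _ "sec W a f"]) (simp add: germ_at_XX)
  qed
next
  fix U s V t assume "germ_at XX p U s" "germ_at XX p V t"
  then have s: "openin T U" "p \<in> U" "s \<in> carrier (OX U)" and t: "openin T V" "p \<in> V" "t \<in> carrier (OX V)"
    by (auto simp: germ_at_XX)
  let ?P = "\<lambda>W. openin T W \<and> p \<in> W \<and> W \<subseteq> U \<inter> V \<and> restrict s W = restrict t W"
  have UV: "openin T (U \<inter> V)" "p \<in> U \<inter> V" using s t by auto
  have r: "restrict s (U \<inter> V) \<in> carrier (OX (U \<inter> V))" "restrict t (U \<inter> V) \<in> carrier (OX (U \<inter> V))"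
    using restrict_closed[OF UV(1)] s(3) t(3) by auto
  have "(\<exists>W. ?P W) \<longleftrightarrow> s p = t p"
  proof
    assume "\<exists>W. ?P W"
    then obtain W where W: "p \<in> W" "restrict s W = restrict t W" by blast
    from W(2) have "restrict s W p = restrict t W p" by simp
    then show "s p = t p" using W(1) by simp
  next
    assume eq: "s p = t p"
    obtain W a f where W: "openin T W" "p \<in> W" "W \<subseteq> U" "\<And>q. q \<in> W \<Longrightarrow> (a, f) \<in> Q q"
      "\<And>q. q \<in> W \<Longrightarrow> s q = frac q a f"
      using section_local[OF s(3,2)] by metis
    obtain W' b g where W': "openin T W'" "p \<in> W'" "W' \<subseteq> V" "\<And>q. q \<in> W' \<Longrightarrow> (b, g) \<in> Q q"
      "\<And>q. q \<in> W' \<Longrightarrow> t q = frac q b g"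
      using section_local[OF t(3,2)] by metis
    have "frac p a f = frac p b g" using eq W W' by simp
    then obtain u where u: "u \<in> den p" "u \<otimes> (a \<otimes> g) = u \<otimes> (b \<otimes> f)"
      using frac_eq_iff[OF p W(4)[OF W(2)] W'(4)[OF W'(2)]] by auto
    then obtain n where n: "u \<in> G n" "u \<notin> p" by (auto simp: den_def)
    \<comment> \<open>A witness \<open>u\<close> for equality at \<open>p\<close> works at every
      point where \<open>u\<close> does not vanish.\<close>
    let ?W = "W \<inter> W' \<inter> {q \<in> topspace T. u \<notin> q}"
    have "frac q a f = frac q b g" if "q \<in> ?W" for q
      using that frac_eq_iff[OF _ W(4) W'(4), of q] u(2) n by (auto simp: den_def)
    then have "restrict s ?W = restrict t ?W" using W(5) W'(5) by (intro restrict_ext) auto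
    then have "?P ?W" using W W' basic_open[OF n(1)] n p by auto
    then show "\<exists>W. ?P W" by blast
  qed
  then show "(\<exists>W. openin (lrs_top XX) W \<and> p \<in> W \<and> W \<subseteq> U \<inter> V \<and> lrs_restr XX U W s = lrs_restr XX V W t)
      \<longleftrightarrow> s p = t p" by simp
  show "germ_at XX p (U \<inter> V)
        (lrs_restr XX U (U \<inter> V) s \<otimes>\<^bsub>lrs_sections XX (U \<inter> V)\<^esub> lrs_restr XX V (U \<inter> V) t) \<and>
      (lrs_restr XX U (U \<inter> V) s \<otimes>\<^bsub>lrs_sections XX (U \<inter> V)\<^esub> lrs_restr XX V (U \<inter> V) t) p
        = s p \<otimes>\<^bsub>FR p\<^esub> t p"
    using OX_mult_closed[OF r] UV by (simp add: germ_at_XX) (simp add: OX_mult)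
  show "germ_at XX p (U \<inter> V)
        (lrs_restr XX U (U \<inter> V) s \<oplus>\<^bsub>lrs_sections XX (U \<inter> V)\<^esub> lrs_restr XX V (U \<inter> V) t) \<and>
      (lrs_restr XX U (U \<inter> V) s \<oplus>\<^bsub>lrs_sections XX (U \<inter> V)\<^esub> lrs_restr XX V (U \<inter> V) t) p
        = s p \<oplus>\<^bsub>FR p\<^esub> t p"
    using OX_add_closed[OF r] UV by (simp add: germ_at_XX) (simp add: OX_add)
next
  show "germ_at XX p (lrs_points XX) \<one>\<^bsub>lrs_sections XX (lrs_points XX)\<^esub> \<and>
      \<one>\<^bsub>lrs_sections XX (lrs_points XX)\<^esub> p = \<one>\<^bsub>FR p\<^esub>"
    using p Q_one by (simp add: germ_at_XX OX_one FR_one sec_closed)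
  show "germ_at XX p (lrs_points XX) \<zero>\<^bsub>lrs_sections XX (lrs_points XX)\<^esub> \<and>
      \<zero>\<^bsub>lrs_sections XX (lrs_points XX)\<^esub> p = \<zero>\<^bsub>FR p\<^esub>"
    using p Q_zero by (simp add: germ_at_XX OX_zero FR_zero sec_closed)
qed

end

section \<open>The Zariski topology, and the spectrum as a space of fractions\<close>

lemma topspace_zariski: "cring R \<Longrightarrow> topspace (zariski_topology R) = {p. primeideal p R}"
proof -
  assume "cring R"
  then interpret cring R .
  have "\<one>\<^bsub>R\<^esub> \<notin> p" if "primeideal p R" for p
    using that primeideal.I_notcarr ideal.one_imp_carrier primeideal.axioms(1) by metis
  then show ?thesis
    unfolding zariski_topology_def topology_generated_by_topspace by auto
qed

lemma openin_zariski_basic: "f \<in> carrier R \<Longrightarrow> openin (zariski_topology R) {p. primeideal p R \<and> f \<notin> p}"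
  unfolding zariski_topology_def by (rule topology_generated_by_Basis) auto

text \<open>Stability under passing to smaller primes holds for the basic sets and survives
  intersections and unions, so induction over the generated topology applies.\<close>

lemma zariski_generization:
  assumes "openin (zariski_topology R) W" "p \<in> W" "primeideal q R" "q \<subseteq> p"
  shows "q \<in> W"
proof -
  have "generate_topology_on ((\<lambda>f. {p. primeideal p R \<and> f \<notin> p}) ` carrier R) W"
    using assms(1) by (simp add: zariski_topology_def openin_topology_generated_by_iff)
  then show ?thesis using assms(2)
  proof induction
    case (Basis s)
    then show ?case using assms(3,4) by auto
  qed auto
qed

lemma Spec_eq: "Spec R = frac_space R (zariski_topology R) (homogeneous_fracs (\<lambda>_. carrier R))"
proof -
  have "homogeneous_fracs (\<lambda>_. carrier R) = (\<lambda>p. carrier R \<times> (carrier R - p))"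
    by (auto simp: homogeneous_fracs_def)
  then show ?thesis by (simp add: Spec_def)
qed

lemma frac_data_Spec:
  assumes "cring R"
  shows "frac_data R (\<lambda>_. carrier R) (zariski_topology R)"
proof -
  interpret cring R by fact
  show ?thesis
  proof (rule frac_data.intro[OF assms], rule frac_data_axioms.intro)
    show "openin (zariski_topology R) {p \<in> topspace (zariski_topology R). f \<notin> p}"
      if "f \<in> carrier R" for f
      using openin_zariski_basic[OF that] topspace_zariski[OF assms] by simp
    show "primeideal p R" if "p \<in> topspace (zariski_topology R)" for p
      using that topspace_zariski[OF assms] by simp
  qed auto
qed

section \<open>Ringed spaces with a function field\<close>

context field
begin

lemma inv_closed [simp]: "x \<in> carrier R \<Longrightarrow> x \<noteq> \<zero> \<Longrightarrow> inv x \<in> carrier R"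
  using field_Units by auto

lemma inv_mult_left [simp]: "x \<in> carrier R \<Longrightarrow> x \<noteq> \<zero> \<Longrightarrow> inv x \<otimes> x = \<one>"
  using field_Units by auto

lemma inv_mult_right [simp]: "x \<in> carrier R \<Longrightarrow> x \<noteq> \<zero> \<Longrightarrow> x \<otimes> inv x = \<one>"
  using field_Units by auto

lemma mult_eq_zero_iff:
  "x \<in> carrier R \<Longrightarrow> y \<in> carrier R \<Longrightarrow> x \<otimes> y = \<zero> \<longleftrightarrow> x = \<zero> \<or> y = \<zero>"
  using integral by fastforce

lemma inv_nonzero [simp]: "x \<in> carrier R \<Longrightarrow> x \<noteq> \<zero> \<Longrightarrow> inv x \<noteq> \<zero>"
  using inv_mult_left[of x] by force

lemma inv_eqI:
  assumes "x \<in> carrier R" "y \<in> carrier R" "x \<otimes> y = \<one>"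
  shows "inv x = y"
proof -
  have "x \<noteq> \<zero>" using assms by force
  then have "inv x \<otimes> (x \<otimes> y) = y" using assms(1,2) by (simp add: m_assoc[symmetric])
  then show ?thesis using assms \<open>x \<noteq> \<zero>\<close> by simp
qed

lemma inv_inv_eq [simp]: "x \<in> carrier R \<Longrightarrow> x \<noteq> \<zero> \<Longrightarrow> inv (inv x) = x"
  by (rule inv_eqI) auto

lemma inv_mult:
  assumes "x \<in> carrier R" "x \<noteq> \<zero>" "y \<in> carrier R" "y \<noteq> \<zero>"
  shows "inv (x \<otimes> y) = inv x \<otimes> inv y"
proof (rule inv_eqI)
  have "x \<otimes> y \<otimes> (inv x \<otimes> inv y) = (x \<otimes> inv x) \<otimes> (y \<otimes> inv y)"
    using assms by (simp add: m_ac del: inv_mult_right)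
  then show "x \<otimes> y \<otimes> (inv x \<otimes> inv y) = \<one>" using assms by simp
qed (use assms in auto)

lemma eq_divide_iff:
  assumes "x \<in> carrier R" "y \<in> carrier R" "z \<in> carrier R" "y \<noteq> \<zero>"
  shows "z = x \<otimes> inv y \<longleftrightarrow> z \<otimes> y = x"
proof
  assume "z = x \<otimes> inv y"
  then show "z \<otimes> y = x" using assms by (simp add: m_assoc)
next
  assume "z \<otimes> y = x"
  then have "x \<otimes> inv y = z \<otimes> (y \<otimes> inv y)" using assms by (simp add: m_assoc[symmetric] del: inv_mult_right)
  then show "z = x \<otimes> inv y" using assms by simp
qed

lemma divide_eq_divide_iff:
  assumes "a \<in> carrier R" "b \<in> carrier R" "c \<in> carrier R" "d \<in> carrier R" "b \<noteq> \<zero>" "d \<noteq> \<zero>"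
  shows "a \<otimes> inv b = c \<otimes> inv d \<longleftrightarrow> a \<otimes> d = c \<otimes> b"
proof -
  have "a \<otimes> inv b = c \<otimes> inv d \<longleftrightarrow> a \<otimes> inv b \<otimes> d = c"
    using assms by (intro eq_divide_iff) auto
  also have "a \<otimes> inv b \<otimes> d = (a \<otimes> d) \<otimes> inv b" using assms by (simp add: m_ac)
  also have "\<dots> = c \<longleftrightarrow> c = (a \<otimes> d) \<otimes> inv b" by auto
  also have "\<dots> \<longleftrightarrow> c \<otimes> b = a \<otimes> d" using assms by (intro eq_divide_iff) auto
  finally show ?thesis by auto
qed

end

text \<open>The inverse of zero is an unspecified value, so zero is listed separately. For a local
  subring of \<open>F\<close> this set is the maximal ideal; for \<open>F\<close> itself it is the
  zero ideal.\<close>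

definition nonunits :: "('f, 'm) ring_scheme \<Rightarrow> 'f set \<Rightarrow> 'f set" where
  "nonunits F L = {y \<in> L. y = \<zero>\<^bsub>F\<^esub> \<or> inv\<^bsub>F\<^esub> y \<notin> L}"

text \<open>Closure under addition is the ideal axiom that can fail; \<open>nonunits_mult\<close>
  gives closure under multiples for every subring.\<close>

definition local_subring :: "('f, 'm) ring_scheme \<Rightarrow> 'f set \<Rightarrow> bool" where
  "local_subring F L \<longleftrightarrow> subring L F \<and> (\<forall>a\<in>nonunits F L. \<forall>b\<in>nonunits F L. a \<oplus>\<^bsub>F\<^esub> b \<in> nonunits F L)"

context field
begin

lemma nonunits_mult:
  assumes "subring L R" "y \<in> nonunits R L" "r \<in> L"
  shows "r \<otimes> y \<in> nonunits R L"
proof -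
  note L = subringE[OF assms(1)]
  have y: "y \<in> L" using assms by (auto simp: nonunits_def)
  then have c: "y \<in> carrier R" "r \<in> carrier R" using L(1) assms by auto
  have "inv (r \<otimes> y) \<notin> L" if "r \<otimes> y \<noteq> \<zero>"
  proof
    assume i: "inv (r \<otimes> y) \<in> L"
    have nz: "r \<noteq> \<zero>" "y \<noteq> \<zero>" using that c by auto
    have "inv y = r \<otimes> inv (r \<otimes> y)"
      using c nz inv_mult[of r y] by (simp add: m_assoc[symmetric])
    then have "inv y \<in> L" using i assms(3) L(6) by simp
    then show False using assms(2) nz by (auto simp: nonunits_def)
  qed
  then show ?thesis using L(6) assms(3) y by (auto simp: nonunits_def)
qed

lemma nonunits_prime:
  assumes "subring L R" "a \<in> L" "b \<in> L" "a \<otimes> b \<in> nonunits R L"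
  shows "a \<in> nonunits R L \<or> b \<in> nonunits R L"
proof (rule ccontr)
  note L = subringE[OF assms(1)]
  assume "\<not> (a \<in> nonunits R L \<or> b \<in> nonunits R L)"
  then have *: "a \<noteq> \<zero>" "b \<noteq> \<zero>" "inv a \<in> L" "inv b \<in> L" using assms by (auto simp: nonunits_def)
  have c: "a \<in> carrier R" "b \<in> carrier R" using L(1) assms by auto
  then have "inv (a \<otimes> b) \<in> L" using * L(6) by (simp add: inv_mult)
  then show False using assms(4) * c by (auto simp: nonunits_def mult_eq_zero_iff)
qed

text \<open>Division by a unit of \<open>L\<close> stays in \<open>L\<close> and does not change
  membership in the nonunits. It serves to pass from values of numerator and denominator to the
  value of a fraction.\<close>

lemma nonunits_divide:
  assumes "subring L R" "a \<in> L" "b \<in> L" "b \<notin> nonunits R L"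
  shows "b \<noteq> \<zero>" "inv b \<in> L" "a \<otimes> inv b \<in> L" "a \<otimes> inv b \<in> nonunits R L \<longleftrightarrow> a \<in> nonunits R L"
proof -
  note L = subringE[OF assms(1)]
  show b: "b \<noteq> \<zero>" "inv b \<in> L" using assms(3,4) by (auto simp: nonunits_def)
  show "a \<otimes> inv b \<in> L" by (rule L(6)[OF assms(2) b(2)])
  have c: "a \<in> carrier R" "b \<in> carrier R" using L(1) assms(2,3) by auto
  then have "b \<otimes> (a \<otimes> inv b) = a" "inv b \<otimes> a = a \<otimes> inv b" using b by (simp_all add: m_lcomm m_comm)
  then show "a \<otimes> inv b \<in> nonunits R L \<longleftrightarrow> a \<in> nonunits R L"
    using nonunits_mult[OF assms(1) _ assms(3)] nonunits_mult[OF assms(1) _ b(2)] by metis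
qed

lemma one_not_nonunit: "subring L R \<Longrightarrow> \<one> \<notin> nonunits R L"
  using subringE(3)[of L R] inv_eqI[of \<one> \<one>] by (auto simp: nonunits_def)

lemma zero_nonunit: "subring L R \<Longrightarrow> \<zero> \<in> nonunits R L"
  using subringE(2)[of L R] by (auto simp: nonunits_def)

lemma local_subringD:
  assumes "local_subring R L"
  shows "subring L R" and "a \<in> nonunits R L \<Longrightarrow> b \<in> nonunits R L \<Longrightarrow> a \<oplus> b \<in> nonunits R L"
  using assms by (auto simp: local_subring_def)

lemma subring_cring: "subring L R \<Longrightarrow> cring (R\<lparr>carrier := L\<rparr>)"
  using subcring_iff subcringI' subringE(1) by blast

lemma local_subring_local_with:
  assumes "local_subring R L"
  shows "local_with (R\<lparr>carrier := L\<rparr>) (nonunits R L)"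
proof -
  note s = local_subringD(1)[OF assms]
  note L = subringE[OF s]
  interpret L: cring "R\<lparr>carrier := L\<rparr>" by (rule subring_cring[OF s])
  have "ideal (nonunits R L) (R\<lparr>carrier := L\<rparr>)"
    by (rule L.idealI')
      (use local_subringD[OF assms] nonunits_mult[OF s] zero_nonunit[OF s] in \<open>auto simp: nonunits_def\<close>)
  moreover have "nonunits R L \<noteq> L" using one_not_nonunit[OF s] L(3) by auto
  moreover have "x \<in> Units (R\<lparr>carrier := L\<rparr>)" if "x \<in> L" "x \<notin> nonunits R L" for x
  proof -
    have "x \<noteq> \<zero>" "inv x \<in> L" "x \<in> carrier R" using that L(1) by (auto simp: nonunits_def)
    then have "inv x \<otimes> x = \<one>" "x \<otimes> inv x = \<one>" by auto
    then show ?thesis using that \<open>inv x \<in> L\<close> by (auto simp: Units_def)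
  qed
  ultimately show ?thesis using L.cring_axioms by (auto simp: local_with_def)
qed

text \<open>One of \<open>a/b\<close> and \<open>b/a\<close> lies in \<open>V\<close>, say the
  first; then \<open>a + b = (a/b + 1) b\<close> is a multiple of the nonunit \<open>b\<close>. Zero
  summands are treated apart.\<close>

lemma valuation_local_subring:
  assumes "valuation_ring_of R V"
  shows "local_subring R V"
proof -
  have s: "subring V R" and v: "\<And>x. x \<in> carrier R \<Longrightarrow> x \<noteq> \<zero> \<Longrightarrow> x \<in> V \<or> inv x \<in> V"
    using assms by (auto simp: valuation_ring_of_def)
  note V = subringE[OF s]
  have aux: "a \<oplus> b \<in> nonunits R V"
    if "a \<in> nonunits R V" "b \<in> nonunits R V" "b \<noteq> \<zero>" "a \<otimes> inv b \<in> V" for a b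
  proof -
    have c: "a \<in> carrier R" "b \<in> carrier R" using that V(1) by (auto simp: nonunits_def)
    have "a \<oplus> b = (a \<otimes> inv b \<oplus> \<one>) \<otimes> b" using c that by (simp add: l_distr m_assoc)
    then show ?thesis using nonunits_mult[OF s that(2)] V that(4) by simp
  qed
  have "a \<oplus> b \<in> nonunits R V" if a: "a \<in> nonunits R V" and b: "b \<in> nonunits R V" for a b
  proof (cases "a = \<zero> \<or> b = \<zero>")
    case True
    have c: "a \<in> carrier R" "b \<in> carrier R" using a b V(1) by (auto simp: nonunits_def)
    show ?thesis using True a b c by auto
  next
    case False
    have c: "a \<in> carrier R" "b \<in> carrier R" using a b V(1) by (auto simp: nonunits_def)
    have "a \<otimes> inv b \<noteq> \<zero>" using False c by (simp add: mult_eq_zero_iff)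
    moreover have "inv (a \<otimes> inv b) = b \<otimes> inv a" using False c by (simp add: inv_mult m_comm)
    ultimately have "a \<otimes> inv b \<in> V \<or> b \<otimes> inv a \<in> V" using v[of "a \<otimes> inv b"] c False by auto
    then show ?thesis using aux[OF a b] aux[OF b a] False a_comm[OF c] by auto
  qed
  then show ?thesis using s by (auto simp: local_subring_def)
qed

end

text \<open>
  Ringed spaces whose sections over a nonempty open set \<open>U\<close> are identified by \<open>val U\<close> with the
  elements of \<open>F\<close> that lie in the local ring \<open>L x\<close> for every \<open>x \<in> U\<close>; \<open>\<eta>\<close> is a generic point.
\<close>

locale ffs = field F for F (structure) +
  fixes X :: "('p, 's) ringed_space" and L :: "'p \<Rightarrow> 'a set" and val :: "'p set \<Rightarrow> 's \<Rightarrow> 'a"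
    and \<eta> :: 'p
  assumes local_L: "x \<in> lrs_points X \<Longrightarrow> local_subring F (L x)"
    and generic_point: "\<eta> \<in> lrs_points X"
    and generic: "openin (lrs_top X) U \<Longrightarrow> U \<noteq> {} \<Longrightarrow> \<eta> \<in> U"
    and L_open: "y \<in> carrier F \<Longrightarrow> openin (lrs_top X) {x \<in> lrs_points X. y \<in> L x}"
    and val_bij: "openin (lrs_top X) U \<Longrightarrow> U \<noteq> {} \<Longrightarrow>
      bij_betw (val U) (carrier (lrs_sections X U)) (\<Inter>x\<in>U. L x)"
    and val_mult: "openin (lrs_top X) U \<Longrightarrow> U \<noteq> {} \<Longrightarrow>
      s \<in> carrier (lrs_sections X U) \<Longrightarrow> t \<in> carrier (lrs_sections X U) \<Longrightarrow>
      s \<otimes>\<^bsub>lrs_sections X U\<^esub> t \<in> carrier (lrs_sections X U) \<and>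
      val U (s \<otimes>\<^bsub>lrs_sections X U\<^esub> t) = val U s \<otimes> val U t"
    and val_add: "openin (lrs_top X) U \<Longrightarrow> U \<noteq> {} \<Longrightarrow>
      s \<in> carrier (lrs_sections X U) \<Longrightarrow> t \<in> carrier (lrs_sections X U) \<Longrightarrow>
      s \<oplus>\<^bsub>lrs_sections X U\<^esub> t \<in> carrier (lrs_sections X U) \<and>
      val U (s \<oplus>\<^bsub>lrs_sections X U\<^esub> t) = val U s \<oplus> val U t"
    and val_one: "openin (lrs_top X) U \<Longrightarrow> U \<noteq> {} \<Longrightarrow>
      \<one>\<^bsub>lrs_sections X U\<^esub> \<in> carrier (lrs_sections X U) \<and> val U \<one>\<^bsub>lrs_sections X U\<^esub> = \<one>"
    and val_zero: "openin (lrs_top X) U \<Longrightarrow> U \<noteq> {} \<Longrightarrow>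
      \<zero>\<^bsub>lrs_sections X U\<^esub> \<in> carrier (lrs_sections X U) \<and> val U \<zero>\<^bsub>lrs_sections X U\<^esub> = \<zero>"
    and val_restr: "openin (lrs_top X) U \<Longrightarrow> openin (lrs_top X) V \<Longrightarrow> V \<subseteq> U \<Longrightarrow> V \<noteq> {} \<Longrightarrow>
      s \<in> carrier (lrs_sections X U) \<Longrightarrow>
      lrs_restr X U V s \<in> carrier (lrs_sections X V) \<and> val V (lrs_restr X U V s) = val U s"
    and empty_sections: "\<exists>z. carrier (lrs_sections X {}) = {z} \<and> \<one>\<^bsub>lrs_sections X {}\<^esub> = z \<and>
      z \<otimes>\<^bsub>lrs_sections X {}\<^esub> z = z \<and> z \<oplus>\<^bsub>lrs_sections X {}\<^esub> z = z"
    and restr_empty: "openin (lrs_top X) U \<Longrightarrow> s \<in> carrier (lrs_sections X U) \<Longrightarrow>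
      lrs_restr X U {} s \<in> carrier (lrs_sections X {})"
begin

lemma subring_L: "x \<in> lrs_points X \<Longrightarrow> subring (L x) F"
  using local_L local_subringD(1) by blast

lemma L_carrier: "x \<in> lrs_points X \<Longrightarrow> y \<in> L x \<Longrightarrow> y \<in> carrier F"
  using subring_L subringE(1) by blast

lemma val_in_L:
  assumes "openin (lrs_top X) U" "x \<in> U" "s \<in> carrier (lrs_sections X U)"
  shows "val U s \<in> L x"
proof -
  have "U \<noteq> {}" using assms(2) by auto
  then show ?thesis using bij_betwE[OF val_bij[OF assms(1)]] assms(2,3) by blast
qed

lemma val_inj:
  assumes "openin (lrs_top X) U" "U \<noteq> {}" "s \<in> carrier (lrs_sections X U)"
    "t \<in> carrier (lrs_sections X U)" "val U s = val U t"
  shows "s = t"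
  using val_bij[OF assms(1,2)] assms(3-5) by (auto simp: bij_betw_def dest: inj_onD)

text \<open>An element \<open>k\<close> of \<open>L x\<close> is a section over the open set of
  points whose local ring contains \<open>k\<close>, so the stalk is all of \<open>L x\<close>.
  Germs of equal value already agree on \<open>U \<inter> V\<close>, where \<open>val\<close> is
  injective.\<close>

lemma stalk_model_ffs:
  assumes x: "x \<in> lrs_points X"
  shows "stalk_model X x (F\<lparr>carrier := L x\<rparr>) val"
proof
  show "val U s \<in> carrier (F\<lparr>carrier := L x\<rparr>)" if "germ_at X x U s" for U s
    using that val_in_L by (auto simp: germ_at_def)
  show "\<exists>U s. germ_at X x U s \<and> val U s = k" if "k \<in> carrier (F\<lparr>carrier := L x\<rparr>)" for k
  proof -
    have k: "k \<in> L x" using that by simp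
    let ?U = "{y \<in> lrs_points X. k \<in> L y}"
    have U: "openin (lrs_top X) ?U" "x \<in> ?U" using L_open L_carrier[OF x k] x k by auto
    then have "val ?U ` carrier (lrs_sections X ?U) = (\<Inter>x\<in>?U. L x)"
      using val_bij[OF U(1)] by (auto simp: bij_betw_def)
    moreover have "k \<in> (\<Inter>x\<in>?U. L x)" by simp
    ultimately have "k \<in> val ?U ` carrier (lrs_sections X ?U)" by simp
    then obtain s where "s \<in> carrier (lrs_sections X ?U)" "val ?U s = k" by (elim imageE) simp
    then have "germ_at X x ?U s \<and> val ?U s = k" using U by (simp add: germ_at_def)
    then show ?thesis by (intro exI)
  qed
next
  fix U s V t assume "germ_at X x U s" "germ_at X x V t"
  then have s: "openin (lrs_top X) U" "x \<in> U" "s \<in> carrier (lrs_sections X U)"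
    and t: "openin (lrs_top X) V" "x \<in> V" "t \<in> carrier (lrs_sections X V)"
    by (auto simp: germ_at_def)
  have UV: "openin (lrs_top X) (U \<inter> V)" "x \<in> U \<inter> V" "U \<inter> V \<noteq> {}" using s t by auto
  note rs = val_restr[OF s(1) UV(1) _ UV(3) s(3), simplified]
  note rt = val_restr[OF t(1) UV(1) _ UV(3) t(3), simplified]
  show "(\<exists>W. openin (lrs_top X) W \<and> x \<in> W \<and> W \<subseteq> U \<inter> V \<and> lrs_restr X U W s = lrs_restr X V W t)
      \<longleftrightarrow> val U s = val V t"
  proof
    assume "\<exists>W. openin (lrs_top X) W \<and> x \<in> W \<and> W \<subseteq> U \<inter> V \<and> lrs_restr X U W s = lrs_restr X V W t"
    then obtain W where W: "openin (lrs_top X) W" "x \<in> W" "W \<subseteq> U" "W \<subseteq> V"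
      "lrs_restr X U W s = lrs_restr X V W t" by auto
    then have "W \<noteq> {}" by auto
    then show "val U s = val V t"
      using val_restr[OF s(1) W(1,3) _ s(3)] val_restr[OF t(1) W(1,4) _ t(3)] W(5) by metis
  next
    assume "val U s = val V t"
    then have "lrs_restr X U (U \<inter> V) s = lrs_restr X V (U \<inter> V) t"
      using rs rt by (intro val_inj[OF UV(1,3)]) auto
    then show "\<exists>W. openin (lrs_top X) W \<and> x \<in> W \<and> W \<subseteq> U \<inter> V \<and> lrs_restr X U W s = lrs_restr X V W t"
      using UV by blast
  qed
  show "germ_at X x (U \<inter> V)
        (lrs_restr X U (U \<inter> V) s \<otimes>\<^bsub>lrs_sections X (U \<inter> V)\<^esub> lrs_restr X V (U \<inter> V) t) \<and>
      val (U \<inter> V) (lrs_restr X U (U \<inter> V) s \<otimes>\<^bsub>lrs_sections X (U \<inter> V)\<^esub> lrs_restr X V (U \<inter> V) t)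
        = val U s \<otimes>\<^bsub>F\<lparr>carrier := L x\<rparr>\<^esub> val V t"
    using val_mult[OF UV(1,3), of "lrs_restr X U (U \<inter> V) s" "lrs_restr X V (U \<inter> V) t"] rs rt UV
    by (simp add: germ_at_def)
  show "germ_at X x (U \<inter> V)
        (lrs_restr X U (U \<inter> V) s \<oplus>\<^bsub>lrs_sections X (U \<inter> V)\<^esub> lrs_restr X V (U \<inter> V) t) \<and>
      val (U \<inter> V) (lrs_restr X U (U \<inter> V) s \<oplus>\<^bsub>lrs_sections X (U \<inter> V)\<^esub> lrs_restr X V (U \<inter> V) t)
        = val U s \<oplus>\<^bsub>F\<lparr>carrier := L x\<rparr>\<^esub> val V t"
    using val_add[OF UV(1,3), of "lrs_restr X U (U \<inter> V) s" "lrs_restr X V (U \<inter> V) t"] rs rt UV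
    by (simp add: germ_at_def)
next
  have P: "openin (lrs_top X) (lrs_points X)" "lrs_points X \<noteq> {}" using x by auto
  show "germ_at X x (lrs_points X) \<one>\<^bsub>lrs_sections X (lrs_points X)\<^esub> \<and>
      val (lrs_points X) \<one>\<^bsub>lrs_sections X (lrs_points X)\<^esub> = \<one>\<^bsub>F\<lparr>carrier := L x\<rparr>\<^esub>"
    using val_one[OF P] P x by (simp add: germ_at_def)
  show "germ_at X x (lrs_points X) \<zero>\<^bsub>lrs_sections X (lrs_points X)\<^esub> \<and>
      val (lrs_points X) \<zero>\<^bsub>lrs_sections X (lrs_points X)\<^esub> = \<zero>\<^bsub>F\<lparr>carrier := L x\<rparr>\<^esub>"
    using val_zero[OF P] P x by (simp add: germ_at_def)
qed

lemma ffs_local: "x \<in> lrs_points X \<Longrightarrow> local_with (F\<lparr>carrier := L x\<rparr>) (nonunits F (L x))"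
  using local_L local_subring_local_with by blast

end

text \<open>All representatives give the same quotient where \<open>e\<close> is nonzero on
  denominators; only there (\<open>frac_val_frac\<close>) is the definite description
  evaluated.\<close>

definition frac_val :: "('f, 'm) ring_scheme \<Rightarrow> ('a \<Rightarrow> 'f) \<Rightarrow> ('a \<times> 'a) set \<Rightarrow> 'f" where
  "frac_val F e c = (THE y. \<exists>(a, f)\<in>c. y = e a \<otimes>\<^bsub>F\<^esub> inv\<^bsub>F\<^esub> e f)"

section \<open>Morphisms given by a homomorphism to the function field\<close>

locale frac_hom = F: field F + frac_data R G T
  for F :: "('f, 'k) ring_scheme" and R :: "('a, 'm) ring_scheme" (structure) and G T +
  fixes e :: "'a \<Rightarrow> 'f"
  assumes e: "e \<in> ring_hom R F"
begin

lemma e_closed: "a \<in> carrier R \<Longrightarrow> e a \<in> carrier F"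
  using ring_hom_closed[OF e] .

lemma frac_val_frac:
  assumes p: "p \<in> topspace T" and nz: "\<And>u. u \<in> den p \<Longrightarrow> e u \<noteq> \<zero>\<^bsub>F\<^esub>" and q: "(a, f) \<in> Q p"
  shows "frac_val F e (frac p a f) = e a \<otimes>\<^bsub>F\<^esub> inv\<^bsub>F\<^esub> e f"
  unfolding frac_val_def
proof (rule the_equality)
  show "\<exists>(b, h)\<in>frac p a f. e a \<otimes>\<^bsub>F\<^esub> inv\<^bsub>F\<^esub> e f = e b \<otimes>\<^bsub>F\<^esub> inv\<^bsub>F\<^esub> e h"
    using frac_self[OF p q] by blast
  fix y assume "\<exists>(b, h)\<in>frac p a f. y = e b \<otimes>\<^bsub>F\<^esub> inv\<^bsub>F\<^esub> e h"
  then obtain b h where b: "(b, h) \<in> frac p a f" "y = e b \<otimes>\<^bsub>F\<^esub> inv\<^bsub>F\<^esub> e h" by blast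
  note q' = mem_frac[OF p b(1)]
  note c = QD[OF q] QD[OF q'(1)]
  obtain u where u: "u \<in> den p" "u \<otimes> (b \<otimes> f) = u \<otimes> (a \<otimes> h)"
    using q'(2) frac_eq_iff[OF p q'(1) q] by auto
  have nz': "e f \<noteq> \<zero>\<^bsub>F\<^esub>" "e h \<noteq> \<zero>\<^bsub>F\<^esub>" "e u \<noteq> \<zero>\<^bsub>F\<^esub>"
    using nz u(1) Q_den[OF q] Q_den[OF q'(1)] by auto
  note uc = den_carrier[OF u(1)]
  \<comment> \<open>The witness \<open>u\<close> is itself a denominator, so \<open>e u\<close> is
    nonzero and can be cancelled in the field.\<close>
  have "e u \<otimes>\<^bsub>F\<^esub> (e b \<otimes>\<^bsub>F\<^esub> e f) = e u \<otimes>\<^bsub>F\<^esub> (e a \<otimes>\<^bsub>F\<^esub> e h)"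
    using arg_cong[OF u(2), of e] c uc by (simp add: ring_hom_mult[OF e])
  then have "e b \<otimes>\<^bsub>F\<^esub> e f = e a \<otimes>\<^bsub>F\<^esub> e h"
    using F.m_lcancel[OF nz'(3)] c uc by (simp add: e_closed)
  then show "y = e a \<otimes>\<^bsub>F\<^esub> inv\<^bsub>F\<^esub> e f"
    unfolding b(2) using F.divide_eq_divide_iff nz' c by (simp add: e_closed)
qed

lemma frac_val_ring_hom:
  assumes p: "p \<in> topspace T" and nz: "\<And>u. u \<in> den p \<Longrightarrow> e u \<noteq> \<zero>\<^bsub>F\<^esub>"
  shows "frac_val F e \<in> ring_hom (FR p) F"
proof (rule ring_hom_memI)
  note val = frac_val_frac[OF p nz]
  fix c assume "c \<in> carrier (FR p)"
  then obtain a f where a: "(a, f) \<in> Q p" "c = frac p a f" by (metis FR_cases)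
  have nf: "e f \<noteq> \<zero>\<^bsub>F\<^esub>" using nz Q_den[OF a(1)] .
  show "frac_val F e c \<in> carrier F"
    using a nf QD[OF a(1)] by (simp add: val e_closed)
  fix d assume "d \<in> carrier (FR p)"
  then obtain b h where b: "(b, h) \<in> Q p" "d = frac p b h" by (metis FR_cases)
  have nh: "e h \<noteq> \<zero>\<^bsub>F\<^esub>" using nz Q_den[OF b(1)] .
  note c = QD[OF a(1)] QD[OF b(1)]
  have ec: "e a \<in> carrier F" "e f \<in> carrier F" "e b \<in> carrier F" "e h \<in> carrier F"
    using c by (auto intro: e_closed)
  have nz': "e f \<otimes>\<^bsub>F\<^esub> e h \<noteq> \<zero>\<^bsub>F\<^esub>" using nf nh ec by (simp add: F.mult_eq_zero_iff)
  have "frac_val F e (c \<otimes>\<^bsub>FR p\<^esub> d) = (e a \<otimes>\<^bsub>F\<^esub> e b) \<otimes>\<^bsub>F\<^esub> inv\<^bsub>F\<^esub> (e f \<otimes>\<^bsub>F\<^esub> e h)"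
    using a b c by (simp add: FR_mult[OF p] val Q_mult[OF p] ring_hom_mult[OF e])
  also have "\<dots> = (e a \<otimes>\<^bsub>F\<^esub> inv\<^bsub>F\<^esub> e f) \<otimes>\<^bsub>F\<^esub> (e b \<otimes>\<^bsub>F\<^esub> inv\<^bsub>F\<^esub> e h)"
    using ec nf nh by (simp add: F.inv_mult F.m_ac)
  finally show "frac_val F e (c \<otimes>\<^bsub>FR p\<^esub> d) = frac_val F e c \<otimes>\<^bsub>F\<^esub> frac_val F e d"
    using a b by (simp add: val)
  have "frac_val F e (c \<oplus>\<^bsub>FR p\<^esub> d) =
      (e a \<otimes>\<^bsub>F\<^esub> e h \<oplus>\<^bsub>F\<^esub> e b \<otimes>\<^bsub>F\<^esub> e f) \<otimes>\<^bsub>F\<^esub> inv\<^bsub>F\<^esub> (e f \<otimes>\<^bsub>F\<^esub> e h)"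
    using a b c by (simp add: FR_add[OF p] val Q_add[OF p] ring_hom_mult[OF e] ring_hom_add[OF e])
  also have "\<dots> = e a \<otimes>\<^bsub>F\<^esub> inv\<^bsub>F\<^esub> e f \<oplus>\<^bsub>F\<^esub> e b \<otimes>\<^bsub>F\<^esub> inv\<^bsub>F\<^esub> e h"
  proof -
    have "(e a \<otimes>\<^bsub>F\<^esub> inv\<^bsub>F\<^esub> e f \<oplus>\<^bsub>F\<^esub> e b \<otimes>\<^bsub>F\<^esub> inv\<^bsub>F\<^esub> e h) \<otimes>\<^bsub>F\<^esub> (e f \<otimes>\<^bsub>F\<^esub> e h) =
        e a \<otimes>\<^bsub>F\<^esub> e h \<otimes>\<^bsub>F\<^esub> (inv\<^bsub>F\<^esub> e f \<otimes>\<^bsub>F\<^esub> e f) \<oplus>\<^bsub>F\<^esub> e b \<otimes>\<^bsub>F\<^esub> e f \<otimes>\<^bsub>F\<^esub> (inv\<^bsub>F\<^esub> e h \<otimes>\<^bsub>F\<^esub> e h)"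
      using ec nf nh by (simp add: F.l_distr F.r_distr F.m_ac del: F.inv_mult_left F.inv_mult_right)
    also have "\<dots> = e a \<otimes>\<^bsub>F\<^esub> e h \<oplus>\<^bsub>F\<^esub> e b \<otimes>\<^bsub>F\<^esub> e f" using ec nf nh by simp
    finally show ?thesis
      using F.eq_divide_iff[of "e a \<otimes>\<^bsub>F\<^esub> e h \<oplus>\<^bsub>F\<^esub> e b \<otimes>\<^bsub>F\<^esub> e f" "e f \<otimes>\<^bsub>F\<^esub> e h"
          "e a \<otimes>\<^bsub>F\<^esub> inv\<^bsub>F\<^esub> e f \<oplus>\<^bsub>F\<^esub> e b \<otimes>\<^bsub>F\<^esub> inv\<^bsub>F\<^esub> e h"]
        ec nf nh nz' by simp
  qed
  finally show "frac_val F e (c \<oplus>\<^bsub>FR p\<^esub> d) = frac_val F e c \<oplus>\<^bsub>F\<^esub> frac_val F e d"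
    using a b by (simp add: val)
next
  show "frac_val F e \<one>\<^bsub>FR p\<^esub> = \<one>\<^bsub>F\<^esub>"
    using Q_one[OF p] ring_hom_one[OF e] F.inv_eqI[of "\<one>\<^bsub>F\<^esub>" "\<one>\<^bsub>F\<^esub>"]
    by (simp add: FR_one frac_val_frac[OF p nz])
qed

end

text \<open>\<open>adapted\<close> is what makes taking values of fractions a local homomorphism
  from the localization at \<open>g x\<close> to \<open>L x\<close>; it ties the point map
  \<open>g\<close> to the single homomorphism \<open>e\<close>.\<close>

locale ffs_frac =
  X: ffs F X L val \<eta> + Y: frac_hom F R G T e
  for F :: "('a, 'm) ring_scheme" (structure) and X :: "('p, 's) ringed_space" and L val \<eta>
    and R :: "('b, 'n) ring_scheme" and G T and e :: "'b \<Rightarrow> 'a" +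
  fixes g :: "'p \<Rightarrow> 'b set"
  assumes g_in: "x \<in> lrs_points X \<Longrightarrow> g x \<in> topspace T"
    and adapted: "x \<in> lrs_points X \<Longrightarrow> (a, f) \<in> Y.Q (g x) \<Longrightarrow>
      e f \<noteq> \<zero> \<and> e a \<otimes> inv e f \<in> L x \<and> (e a \<otimes> inv e f \<in> nonunits F (L x) \<longleftrightarrow> a \<in> g x)"
begin

lemma den_nonzero:
  assumes "x \<in> lrs_points X" "u \<in> Y.den (g x)"
  shows "e u \<noteq> \<zero>"
proof -
  have "(\<zero>\<^bsub>R\<^esub>, u) \<in> Y.Q (g x)" using assms(2) Y.G_zero by (auto simp: Y.Q_iff Y.den_def)
  then show ?thesis using adapted[OF assms(1)] by blast
qed

lemma frac_val_frac:
  assumes x: "x \<in> lrs_points X" and q: "(a, f) \<in> Y.Q (g x)"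
  shows "frac_val F e (Y.frac (g x) a f) = e a \<otimes> inv e f"
  by (rule Y.frac_val_frac[OF g_in[OF x] den_nonzero[OF x] q])

lemma frac_val_hom:
  assumes x: "x \<in> lrs_points X"
  shows "frac_val F e \<in> ring_hom (Y.FR (g x)) (F\<lparr>carrier := L x\<rparr>)"
proof -
  note hom = Y.frac_val_ring_hom[OF g_in[OF x] den_nonzero[OF x]]
  have "frac_val F e c \<in> L x" if c: "c \<in> carrier (Y.FR (g x))" for c
  proof -
    obtain a f where "(a, f) \<in> Y.Q (g x)" "c = Y.frac (g x) a f" using c by (metis Y.FR_cases)
    then show ?thesis using adapted[OF x] frac_val_frac[OF x] by simp
  qed
  then show ?thesis
    using ring_hom_mult[OF hom] ring_hom_add[OF hom] ring_hom_one[OF hom]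
    by (intro ring_hom_memI) simp_all
qed

lemma frac_val_local:
  assumes x: "x \<in> lrs_points X" and "c \<in> carrier (Y.FR (g x))"
  shows "frac_val F e c \<in> nonunits F (L x) \<longleftrightarrow> c \<in> Y.frac_max (g x)"
proof -
  obtain a f where a: "(a, f) \<in> Y.Q (g x)" "c = Y.frac (g x) a f" using assms by (metis Y.FR_cases)
  then show ?thesis
    using Y.frac_in_max_iff[OF g_in[OF x] a(1)] adapted[OF x a(1)] by (simp add: frac_val_frac[OF x])
qed

definition gpre :: "'b set set \<Rightarrow> 'p set" where
  "gpre U = {x \<in> lrs_points X. g x \<in> U}"

text \<open>Describes a morphism by the point map \<open>g\<close> and the values of sections at the
  generic point. As a predicate it can be checked separately for a given morphism, for
  \<open>mor\<close> and for a composite, and then compared through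
  \<open>realizes_unique\<close>.\<close>

definition realizes :: "('p, 's, 'b set, 'b set \<Rightarrow> ('b \<times> 'b) set) lrs_map \<Rightarrow> bool" where
  "realizes \<phi> \<longleftrightarrow> (\<forall>x\<in>lrs_points X. lrs_pt \<phi> x = g x) \<and>
     (\<forall>U. openin T U \<longrightarrow> (\<forall>s\<in>carrier (Y.OX U). lrs_comorph \<phi> U s \<in> carrier (lrs_sections X (gpre U)) \<and>
        (gpre U \<noteq> {} \<longrightarrow> val (gpre U) (lrs_comorph \<phi> U s) = frac_val F e (s (g \<eta>)))))"

lemma realizesD:
  assumes "realizes \<phi>" "openin T U" "s \<in> carrier (Y.OX U)"
  shows "lrs_comorph \<phi> U s \<in> carrier (lrs_sections X (gpre U))"
    and "gpre U \<noteq> {} \<Longrightarrow> val (gpre U) (lrs_comorph \<phi> U s) = frac_val F e (s (g \<eta>))"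
  using assms by (simp_all add: realizes_def)

text \<open>Over a nonempty preimage the sections are determined by their value, as
  \<open>val\<close> is injective; over an empty one the ring of sections has a single
  element.\<close>

lemma realizes_unique:
  assumes cont: "\<And>U. openin T U \<Longrightarrow> openin (lrs_top X) (gpre U)"
    and "realizes \<phi>" "realizes \<psi>"
  shows "lrs_map_eq X Y.XX \<phi> \<psi>"
  unfolding lrs_map_eq_def
proof (intro conjI ballI allI impI)
  show "lrs_pt \<phi> x = lrs_pt \<psi> x" if "x \<in> lrs_points X" for x
    using assms(2,3) that by (simp add: realizes_def)
  fix U s assume "openin (lrs_top Y.XX) U" "s \<in> carrier (lrs_sections Y.XX U)"
  then have U: "openin T U" "s \<in> carrier (Y.OX U)" by auto
  have *: "lrs_comorph \<phi> U s \<in> carrier (lrs_sections X (gpre U))"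
    "lrs_comorph \<psi> U s \<in> carrier (lrs_sections X (gpre U))"
    using assms(2,3) U by (auto simp: realizes_def)
  show "lrs_comorph \<phi> U s = lrs_comorph \<psi> U s"
  proof (cases "gpre U = {}")
    case True
    then show ?thesis using * X.empty_sections by auto
  next
    case False
    then show ?thesis
      using X.val_inj[OF cont[OF U(1)] False *] assms(2,3) U by (simp add: realizes_def)
  qed
qed

text \<open>The value is turned back into a section by inverting \<open>val\<close>; over an empty
  preimage the sole section is taken.\<close>

definition mor :: "('p, 's, 'b set, 'b set \<Rightarrow> ('b \<times> 'b) set) lrs_map" where
  "mor = \<lparr>lrs_pt = g,
     lrs_comorph = (\<lambda>U s. if gpre U = {} then the_elem (carrier (lrs_sections X {}))
       else inv_into (carrier (lrs_sections X (gpre U))) (val (gpre U)) (frac_val F e (s (g \<eta>))))\<rparr>"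

end

locale ffs_frac_cont = ffs_frac +
  assumes continuous: "continuous_map (lrs_top X) T g"
begin

lemma gpre_open: "openin T U \<Longrightarrow> openin (lrs_top X) (gpre U)"
  unfolding gpre_def by (rule openin_continuous_map_preimage[OF continuous])

text \<open>Near \<open>g x\<close> the section is one fraction \<open>a/f\<close>. The preimage of
  that neighbourhood is open and nonempty, so it contains \<open>\<eta>\<close>, and both values
  equal \<open>e a / e f\<close>.\<close>

lemma frac_val_constant:
  assumes U: "openin T U" and s: "s \<in> carrier (Y.OX U)" and x: "x \<in> gpre U"
  shows "frac_val F e (s (g x)) = frac_val F e (s (g \<eta>))"
proof -
  have x': "x \<in> lrs_points X" "g x \<in> U" using x by (auto simp: gpre_def)
  obtain W a f where W: "openin T W" "g x \<in> W" "W \<subseteq> U" "\<And>q. q \<in> W \<Longrightarrow> (a, f) \<in> Y.Q q"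
    "\<And>q. q \<in> W \<Longrightarrow> s q = Y.frac q a f"
    using Y.section_local[OF s x'(2)] by metis
  have "x \<in> gpre W" using W x' by (auto simp: gpre_def)
  then have "\<eta> \<in> gpre W" using X.generic[OF gpre_open[OF W(1)]] by blast
  then have \<eta>: "g \<eta> \<in> W" by (auto simp: gpre_def)
  show ?thesis
    using frac_val_frac[OF x'(1) W(4)[OF W(2)]] frac_val_frac[OF X.generic_point W(4)[OF \<eta>]]
      W(5)[OF W(2)] W(5)[OF \<eta>] by simp
qed

lemma frac_val_in:
  assumes U: "openin T U" and s: "s \<in> carrier (Y.OX U)"
  shows "frac_val F e (s (g \<eta>)) \<in> (\<Inter>x\<in>gpre U. L x)"
proof
  fix x assume x: "x \<in> gpre U"
  then have x': "x \<in> lrs_points X" "g x \<in> U" by (auto simp: gpre_def)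
  show "frac_val F e (s (g \<eta>)) \<in> L x"
    using ring_hom_closed[OF frac_val_hom[OF x'(1)] Y.section_value_closed[OF s x'(2)]]
      frac_val_constant[OF U s x] by simp
qed

lemma mor_realizes: "realizes mor"
  unfolding realizes_def
proof (intro conjI ballI allI impI)
  show "lrs_pt mor x = g x" for x by (simp add: mor_def)
  fix U s assume U: "openin T U" "s \<in> carrier (Y.OX U)"
  have *: "lrs_comorph mor U s \<in> carrier (lrs_sections X (gpre U)) \<and>
     val (gpre U) (lrs_comorph mor U s) = frac_val F e (s (g \<eta>))" if ne: "gpre U \<noteq> {}"
    using frac_val_in[OF U] X.val_bij[OF gpre_open[OF U(1)] ne] ne
    by (auto simp: mor_def bij_betw_def inv_into_into f_inv_into_f)
  then show "lrs_comorph mor U s \<in> carrier (lrs_sections X (gpre U))"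
    using X.empty_sections by (cases "gpre U = {}") (auto simp: mor_def)
  show "val (gpre U) (lrs_comorph mor U s) = frac_val F e (s (g \<eta>))" if "gpre U \<noteq> {}"
    using * that by blast
qed

text \<open>Identities between sections over nonempty preimages are checked after applying
  \<open>val\<close>, where they become the homomorphism property of \<open>frac_val F e\<close> at
  the generic point.\<close>

lemma mor_morphism: "lrs_morphism X Y.XX mor"
proof -
  have pt: "lrs_pt mor = g" by (simp add: mor_def)
  have pre: "lrs_pre X mor U = gpre U" for U by (simp add: lrs_pre_def gpre_def pt)
  have cl: "lrs_comorph mor U s \<in> carrier (lrs_sections X (gpre U))"
    if "openin T U" "s \<in> carrier (Y.OX U)" for U s
    using mor_realizes that by (simp add: realizes_def)
  have v: "val (gpre U) (lrs_comorph mor U s) = frac_val F e (s (g \<eta>))"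
    if "openin T U" "s \<in> carrier (Y.OX U)" "gpre U \<noteq> {}" for U s
    using mor_realizes that by (simp add: realizes_def)
  have \<eta>: "g \<eta> \<in> U" if "openin T U" "gpre U \<noteq> {}" for U
    using X.generic[OF gpre_open[OF that(1)] that(2)] by (auto simp: gpre_def)
  note hom = frac_val_hom[OF X.generic_point]
  have empty: "s = t" if "s \<in> carrier (lrs_sections X {})" "t \<in> carrier (lrs_sections X {})" for s t
    using X.empty_sections that by auto
  show ?thesis
    unfolding lrs_morphism_def Y.XX_simps pre pt
  proof (intro conjI allI impI ballI)
    show "continuous_map (lrs_top X) T g" by (rule continuous)
    fix U assume U: "openin T U"
    show "lrs_comorph mor U \<in> ring_hom (Y.OX U) (lrs_sections X (gpre U))"
    proof (cases "gpre U = {}")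
      case True
      have const: "lrs_comorph mor U s = the_elem (carrier (lrs_sections X {}))" for s
        using True by (simp add: mor_def)
      show ?thesis
        by (rule ring_hom_memI) (use X.empty_sections in \<open>auto simp: const True\<close>)
    next
      case False
      note o = gpre_open[OF U] False
      have U1: "\<one>\<^bsub>Y.OX U\<^esub> \<in> carrier (Y.OX U)"
        unfolding Y.OX_one using U openin_subset[OF U] by (intro Y.sec_closed) (auto intro: Y.Q_one)
      show ?thesis
      proof (rule ring_hom_memI)
        fix s assume s: "s \<in> carrier (Y.OX U)"
        show "lrs_comorph mor U s \<in> carrier (lrs_sections X (gpre U))" by (rule cl[OF U s])
        fix t assume t: "t \<in> carrier (Y.OX U)"
        note sv = Y.section_value_closed[OF s \<eta>[OF U False]] Y.section_value_closed[OF t \<eta>[OF U False]]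
        have "val (gpre U) (lrs_comorph mor U (s \<otimes>\<^bsub>Y.OX U\<^esub> t)) =
          val (gpre U) (lrs_comorph mor U s \<otimes>\<^bsub>lrs_sections X (gpre U)\<^esub> lrs_comorph mor U t)"
          using X.val_mult[OF o cl[OF U s] cl[OF U t]] ring_hom_mult[OF hom sv] \<eta>[OF U False]
          by (simp add: v[OF U s False] v[OF U t False] v[OF U Y.OX_mult_closed[OF s t] False])
             (simp add: Y.OX_mult)
        then show "lrs_comorph mor U (s \<otimes>\<^bsub>Y.OX U\<^esub> t) =
          lrs_comorph mor U s \<otimes>\<^bsub>lrs_sections X (gpre U)\<^esub> lrs_comorph mor U t"
          using X.val_mult[OF o cl[OF U s] cl[OF U t]]
          by (intro X.val_inj[OF o cl[OF U Y.OX_mult_closed[OF s t]]]) auto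
        have "val (gpre U) (lrs_comorph mor U (s \<oplus>\<^bsub>Y.OX U\<^esub> t)) =
          val (gpre U) (lrs_comorph mor U s \<oplus>\<^bsub>lrs_sections X (gpre U)\<^esub> lrs_comorph mor U t)"
          using X.val_add[OF o cl[OF U s] cl[OF U t]] ring_hom_add[OF hom sv] \<eta>[OF U False]
          by (simp add: v[OF U s False] v[OF U t False] v[OF U Y.OX_add_closed[OF s t] False])
             (simp add: Y.OX_add)
        then show "lrs_comorph mor U (s \<oplus>\<^bsub>Y.OX U\<^esub> t) =
          lrs_comorph mor U s \<oplus>\<^bsub>lrs_sections X (gpre U)\<^esub> lrs_comorph mor U t"
          using X.val_add[OF o cl[OF U s] cl[OF U t]]
          by (intro X.val_inj[OF o cl[OF U Y.OX_add_closed[OF s t]]]) auto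
      next
        have "val (gpre U) (lrs_comorph mor U \<one>\<^bsub>Y.OX U\<^esub>) = val (gpre U) \<one>\<^bsub>lrs_sections X (gpre U)\<^esub>"
          using X.val_one[OF o] ring_hom_one[OF hom] \<eta>[OF U False]
          by (simp add: v[OF U U1 False]) (simp add: Y.OX_one Y.FR_one)
        then show "lrs_comorph mor U \<one>\<^bsub>Y.OX U\<^esub> = \<one>\<^bsub>lrs_sections X (gpre U)\<^esub>"
          using X.val_one[OF o] by (intro X.val_inj[OF o cl[OF U U1]]) auto
      qed
    qed
  next
    fix U V s
    assume "openin T U \<and> openin T V \<and> V \<subseteq> U" and s: "s \<in> carrier (Y.OX U)"
    then have UV: "openin T U" "openin T V" "V \<subseteq> U" by auto
    note sV = Y.restrict_closed[OF UV(2,3) s]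
    note c = cl[OF UV(1) s] cl[OF UV(2) sV]
    have sub: "gpre V \<subseteq> gpre U" using UV by (auto simp: gpre_def)
    show "lrs_comorph mor V (restrict s V) = lrs_restr X (gpre U) (gpre V) (lrs_comorph mor U s)"
    proof (cases "gpre V = {}")
      case True
      then show ?thesis using X.restr_empty[OF gpre_open[OF UV(1)] c(1)] c(2) empty by auto
    next
      case False
      then have F': "gpre U \<noteq> {}" using sub by auto
      note r = X.val_restr[OF gpre_open[OF UV(1)] gpre_open[OF UV(2)] sub False c(1)]
      have "val (gpre V) (lrs_comorph mor V (restrict s V)) =
          val (gpre V) (lrs_restr X (gpre U) (gpre V) (lrs_comorph mor U s))"
        using r \<eta>[OF UV(2) False] by (simp add: v[OF UV(1) s F'] v[OF UV(2) sV False])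
      then show ?thesis
        using r by (intro X.val_inj[OF gpre_open[OF UV(2)] False c(2)]) auto
    qed
  next
    fix x assume x: "x \<in> lrs_points X"
    have "stalk_map X mor x \<in> local_ring_hom (stalk Y.XX (lrs_pt mor x)) (stalk X x)"
    proof (rule stalk_map_local_ring_hom[OF X.stalk_model_ffs[OF x] _ X.ffs_local[OF x]])
      show "stalk_model Y.XX (lrs_pt mor x) (Y.FR (g x)) (\<lambda>U s. s (g x))"
        unfolding pt by (rule Y.stalk_model_XX[OF g_in[OF x]])
      show "local_with (Y.FR (g x)) (Y.frac_max (g x))" by (rule Y.FR_local[OF g_in[OF x]])
      show "frac_val F e \<in> ring_hom (Y.FR (g x)) (F\<lparr>carrier := L x\<rparr>)" by (rule frac_val_hom[OF x])
      show "frac_val F e k \<in> nonunits F (L x) \<longleftrightarrow> k \<in> Y.frac_max (g x)" if "k \<in> carrier (Y.FR (g x))" for k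
        using frac_val_local[OF x that] .
      fix U s assume "germ_at Y.XX (lrs_pt mor x) U s"
      then have s: "openin T U" "g x \<in> U" "s \<in> carrier (Y.OX U)" by (auto simp: Y.germ_at_XX pt)
      have x': "x \<in> gpre U" using s x by (auto simp: gpre_def)
      then have ne: "gpre U \<noteq> {}" by auto
      show "germ_at X x (lrs_pre X mor U) (lrs_comorph mor U s) \<and>
        val (lrs_pre X mor U) (lrs_comorph mor U s) = frac_val F e (s (g x))"
        using x' gpre_open[OF s(1)] cl[OF s(1,3)] v[OF s(1,3) ne] frac_val_constant[OF s(1,3) x']
        by (simp add: germ_at_def pre)
    qed
    then show "stalk_map X mor x \<in> local_ring_hom (stalk Y.XX (g x)) (stalk X x)" by (simp add: pt)
  qed
qed

end

section \<open>Homogeneous polynomials in two variables\<close>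

text \<open>\<open>False\<close> stands for the inner variable \<open>T\<^sub>0\<close>,
  \<open>True\<close> for the outer variable \<open>T\<^sub>1\<close>; with Boolean indices the
  other variable is \<open>\<not> k\<close>, so both charts are treated by one argument.\<close>

definition pvar :: "('a, 'm) ring_scheme \<Rightarrow> bool \<Rightarrow> (nat \<Rightarrow> nat \<Rightarrow> 'a)" where
  "pvar R k = (if k then monom (UP (UP R)) \<one>\<^bsub>UP R\<^esub> 1 else monom (UP (UP R)) (monom (UP R) \<one>\<^bsub>R\<^esub> 1) 0)"

text \<open>Forms generated from constants by multiplying with variables and adding forms of equal
  degree. The resulting induction keeps evaluation arguments free of coefficients.\<close>

inductive homgen :: "('a, 'm) ring_scheme \<Rightarrow> nat \<Rightarrow> (nat \<Rightarrow> nat \<Rightarrow> 'a) \<Rightarrow> bool" for R where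
  const: "a \<in> carrier R \<Longrightarrow> homgen R 0 (const_poly2 R a)"
| var: "homgen R n f \<Longrightarrow> homgen R (Suc n) (f \<otimes>\<^bsub>UP (UP R)\<^esub> pvar R k)"
| add: "homgen R n f \<Longrightarrow> homgen R n g \<Longrightarrow> homgen R n (f \<oplus>\<^bsub>UP (UP R)\<^esub> g)"

lemma (in abelian_monoid) finsum_closed_induct:
  assumes "finite A" "\<And>x. x \<in> A \<Longrightarrow> Q (h x)" "\<And>x. x \<in> A \<Longrightarrow> h x \<in> carrier G"
    and "Q \<zero>"
    and "\<And>f g. f \<in> carrier G \<Longrightarrow> g \<in> carrier G \<Longrightarrow> Q f \<Longrightarrow> Q g \<Longrightarrow> Q (f \<oplus> g)"
  shows "Q (finsum G h A)"
  using assms(1-3)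
proof (induction A rule: finite_induct)
  case empty
  then show ?case using assms(4) by simp
next
  case (insert x A)
  have "finsum G h (insert x A) = h x \<oplus> finsum G h A"
    using insert by (intro finsum_insert) auto
  moreover have "finsum G h A \<in> carrier G" using insert by (intro finsum_closed) auto
  ultimately show ?case using insert assms(5) by simp
qed

locale poly2 = R0: cring R for R (structure)
begin

abbreviation "P \<equiv> UP R"
abbreviation "S \<equiv> UP (UP R)"
abbreviation "G \<equiv> homogeneous_poly2 R"
abbreviation "cf f i j \<equiv> coeff P (coeff S f j) i"

sublocale P: UP_cring R "UP R"
  by (simp add: UP_cring_def R0.cring_axioms)

sublocale S: UP_cring "UP R" "UP (UP R)"
  by (simp add: UP_cring_def P.UP_cring)

lemma G_iff: "f \<in> G n \<longleftrightarrow> f \<in> carrier S \<and> (\<forall>i j. i + j \<noteq> n \<longrightarrow> cf f i j = \<zero>)"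
  by (auto simp: homogeneous_poly2_def)

lemma G_carrier: "f \<in> G n \<Longrightarrow> f \<in> carrier S"
  by (simp add: G_iff)

lemma G_coeff: "f \<in> G n \<Longrightarrow> i + j \<noteq> n \<Longrightarrow> cf f i j = \<zero>"
  by (simp add: G_iff)

lemma const_closed: "a \<in> carrier R \<Longrightarrow> const_poly2 R a \<in> carrier S"
  by (simp add: const_poly2_def)

lemma pvar_closed [simp]: "pvar R k \<in> carrier S"
  by (simp add: pvar_def)

lemma const_hom: "const_poly2 R \<in> ring_hom R S"
proof -
  have "(\<lambda>b. monom S b 0) \<circ> (\<lambda>a. monom P a 0) \<in> ring_hom R S"
    by (rule ring_hom_trans[OF P.const_ring_hom S.const_ring_hom])
  then show ?thesis by (simp add: const_poly2_def[abs_def] comp_def)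
qed

lemma G_zero: "\<zero>\<^bsub>S\<^esub> \<in> G n" by (simp add: G_iff)

lemma G_const: "a \<in> carrier R \<Longrightarrow> const_poly2 R a \<in> G 0"
  by (auto simp: G_iff const_poly2_def)

lemma G_one: "\<one>\<^bsub>S\<^esub> \<in> G 0" by (auto simp: G_iff)

lemma G_pvar: "pvar R k \<in> G 1"
  by (auto simp: G_iff pvar_def)

lemma G_add: "f \<in> G n \<Longrightarrow> g \<in> G n \<Longrightarrow> f \<oplus>\<^bsub>S\<^esub> g \<in> G n"
  by (simp add: G_iff)

lemma G_minus: "f \<in> G n \<Longrightarrow> \<ominus>\<^bsub>S\<^esub> f \<in> G n"
  by (simp add: G_iff)

lemma cf_mult:
  assumes "f \<in> carrier S" "g \<in> carrier S"
  shows "cf (f \<otimes>\<^bsub>S\<^esub> g) i j = (\<Oplus>k\<in>{..j}. \<Oplus>l\<in>{..i}. cf f l k \<otimes> cf g (i - l) (j - k))"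
proof -
  have "cf (f \<otimes>\<^bsub>S\<^esub> g) i j = coeff P (\<Oplus>\<^bsub>P\<^esub>k\<in>{..j}. coeff S f k \<otimes>\<^bsub>P\<^esub> coeff S g (j - k)) i"
    using assms by simp
  also have "\<dots> = (\<Oplus>k\<in>{..j}. coeff P (coeff S f k \<otimes>\<^bsub>P\<^esub> coeff S g (j - k)) i)"
    using assms by (intro P.coeff_finsum) (auto simp: Pi_def)
  also have "\<dots> = (\<Oplus>k\<in>{..j}. \<Oplus>l\<in>{..i}. cf f l k \<otimes> cf g (i - l) (j - k))"
    using assms by (intro R0.finsum_cong') (auto simp: Pi_def)
  finally show ?thesis .
qed

lemma G_mult:
  assumes f: "f \<in> G m" and g: "g \<in> G n"
  shows "f \<otimes>\<^bsub>S\<^esub> g \<in> G (m + n)"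
  unfolding G_iff
proof (intro conjI allI impI)
  note c = G_carrier[OF f] G_carrier[OF g]
  show "f \<otimes>\<^bsub>S\<^esub> g \<in> carrier S" using c by simp
  fix i j assume ne: "i + j \<noteq> m + n"
  have "cf f l k \<otimes> cf g (i - l) (j - k) = \<zero>" if "l \<le> i" "k \<le> j" for k l
  \<comment> \<open>The degrees of the two factors add up to \<open>i + j\<close>, which is not
    \<open>m + n\<close>, so one factor is a coefficient in the wrong degree.\<close>
  proof (cases "l + k = m")
    case True
    then have "cf g (i - l) (j - k) = \<zero>" using ne that by (intro G_coeff[OF g]) auto
    then show ?thesis using c by simp
  next
    case False
    then show ?thesis using G_coeff[OF f] c by simp
  qed
  then have "(\<Oplus>k\<in>{..j}. \<Oplus>l\<in>{..i}. cf f l k \<otimes> cf g (i - l) (j - k)) = (\<Oplus>k\<in>{..j}. \<zero>)"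
    by (intro R0.finsum_cong') (auto intro!: R0.add.finprod_one_eqI)
  then show "cf (f \<otimes>\<^bsub>S\<^esub> g) i j = \<zero>"
    using c by (simp only: cf_mult) simp
qed

lemma homgen_G: "homgen R n f \<Longrightarrow> f \<in> G n"
proof (induction rule: homgen.induct)
  case (var n f k)
  then show ?case using G_mult[OF var.IH G_pvar] by simp
qed (auto simp: G_const G_add)

lemma homgen_zero: "homgen R n \<zero>\<^bsub>S\<^esub>"
proof (induction n)
  case 0
  have "const_poly2 R \<zero> = \<zero>\<^bsub>S\<^esub>" by (simp add: const_poly2_def)
  then show ?case using homgen.const[of \<zero> R] by simp
next
  case (Suc n)
  then show ?case using homgen.var[OF Suc, of True] by simp
qed

lemma homgen_monom:
  assumes "a \<in> carrier R"
  shows "homgen R (i + j) (monom S (monom P a i) j)"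
proof (induction j)
  case 0
  show ?case
  proof (induction i)
    case 0
    then show ?case using homgen.const[OF assms] by (simp add: const_poly2_def)
  next
    case (Suc i)
    have "monom S (monom P a i) 0 \<otimes>\<^bsub>S\<^esub> pvar R False = monom S (monom P a i \<otimes>\<^bsub>P\<^esub> monom P \<one> 1) (0 + 0)"
      unfolding pvar_def using assms by (subst S.monom_mult) auto
    also have "monom P a i \<otimes>\<^bsub>P\<^esub> monom P \<one> 1 = monom P (a \<otimes> \<one>) (i + 1)"
      using assms by (subst P.monom_mult) auto
    finally have "monom S (monom P a i) 0 \<otimes>\<^bsub>S\<^esub> pvar R False = monom S (monom P a (Suc i)) 0"
      using assms by simp
    then show ?case using homgen.var[OF Suc, of False] by simp
  qed
next
  case (Suc j)
  have "monom S (monom P a i) j \<otimes>\<^bsub>S\<^esub> pvar R True = monom S (monom P a i \<otimes>\<^bsub>P\<^esub> \<one>\<^bsub>P\<^esub>) (j + 1)"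
    unfolding pvar_def using assms by (subst S.monom_mult) auto
  then have "monom S (monom P a i) j \<otimes>\<^bsub>S\<^esub> pvar R True = monom S (monom P a i) (Suc j)"
    using assms by simp
  then show ?case using homgen.var[OF Suc, of True] by simp
qed

text \<open>In a form of degree \<open>n\<close>, the coefficient of the \<open>j\<close>-th power
  of the outer variable is a single monomial of degree \<open>n - j\<close>, and zero for
  \<open>j > n\<close>.\<close>

lemma G_homgen:
  assumes f: "f \<in> G n"
  shows "homgen R n f"
proof -
  note c = G_carrier[OF f]
  have "homgen R n (\<Oplus>\<^bsub>S\<^esub>j\<in>{..deg P f}. monom S (coeff S f j) j)"
  proof (rule S.P.finsum_closed_induct)
    fix j
    show "homgen R n (monom S (coeff S f j) j)"
    proof (cases "j \<le> n")
      case True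
      have "coeff S f j = monom P (cf f (n - j) j) (n - j)"
      proof (rule P.up_eqI)
        fix i
        show "coeff P (coeff S f j) i = coeff P (monom P (cf f (n - j) j) (n - j)) i"
          using G_coeff[OF f, of i j] c True by (cases "i = n - j") auto
      qed (use c in auto)
      then show ?thesis
        using homgen_monom[of "cf f (n - j) j" "n - j" j] True c by simp
    next
      case False
      have "coeff S f j = \<zero>\<^bsub>P\<^esub>"
        by (rule P.up_eqI) (use G_coeff[OF f] c False in auto)
      then show ?thesis using homgen_zero by simp
    qed
  qed (use c homgen_zero homgen.add in auto)
  then show ?thesis using S.up_repr[OF c] by simp
qed

lemma G_induct [consumes 1, case_names const var add]:
  assumes "f \<in> G n"
    and "\<And>a. a \<in> carrier R \<Longrightarrow> Q 0 (const_poly2 R a)"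
    and "\<And>n f k. f \<in> G n \<Longrightarrow> Q n f \<Longrightarrow> Q (Suc n) (f \<otimes>\<^bsub>S\<^esub> pvar R k)"
    and "\<And>n f g. f \<in> G n \<Longrightarrow> g \<in> G n \<Longrightarrow> Q n f \<Longrightarrow> Q n g \<Longrightarrow> Q n (f \<oplus>\<^bsub>S\<^esub> g)"
  shows "Q n f"
  using G_homgen[OF assms(1)] by induction (use assms homgen_G in auto)

text \<open>\<open>N\<close> is just some bound on the degrees; requiring zero beyond it lets two
  decompositions be brought to a common bound before they are added.\<close>

definition decomposition :: "(nat \<Rightarrow> nat \<Rightarrow> nat \<Rightarrow> 'a) \<Rightarrow> nat \<Rightarrow> (nat \<Rightarrow> nat \<Rightarrow> 'a) \<Rightarrow> bool" where
  "decomposition h N f \<longleftrightarrow> (\<forall>n. h n \<in> G n) \<and> (\<forall>n>N. h n = \<zero>\<^bsub>S\<^esub>) \<and> f = (\<Oplus>\<^bsub>S\<^esub>n\<in>{..N}. h n)"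

lemma decomposition_extend:
  assumes "decomposition h N f" "N \<le> M"
  shows "decomposition h M f"
proof -
  have "(\<Oplus>\<^bsub>S\<^esub>n\<in>{..M}. h n) = (\<Oplus>\<^bsub>S\<^esub>n\<in>{..N}. h n)"
    using assms G_carrier
    by (intro S.P.add.finprod_mono_neutral_cong_left[symmetric]) (auto simp: decomposition_def)
  then show ?thesis using assms by (auto simp: decomposition_def)
qed

text \<open>Decomposable polynomials are closed under addition and include the monomials; expanding
  in the outer and then in the inner variable reduces to these.\<close>

lemma decomposition_exists:
  assumes f: "f \<in> carrier S"
  obtains h N where "decomposition h N f"
proof -
  have zero: "decomposition (\<lambda>n. \<zero>\<^bsub>S\<^esub>) 0 \<zero>\<^bsub>S\<^esub>" by (simp add: decomposition_def G_zero)
  have add: "\<exists>h N. decomposition h N (f \<oplus>\<^bsub>S\<^esub> g)"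
    if fg: "\<exists>h N. decomposition h N f" "\<exists>h N. decomposition h N g" for f g
  proof -
    obtain h N h' N' where "decomposition h N f" "decomposition h' N' g"
      using fg by blast
    then have d: "decomposition h (max N N') f" "decomposition h' (max N N') g"
      using decomposition_extend by auto
    then have sum: "(\<Oplus>\<^bsub>S\<^esub>n\<in>{..max N N'}. h n \<oplus>\<^bsub>S\<^esub> h' n) =
        (\<Oplus>\<^bsub>S\<^esub>n\<in>{..max N N'}. h n) \<oplus>\<^bsub>S\<^esub> (\<Oplus>\<^bsub>S\<^esub>n\<in>{..max N N'}. h' n)"
      using G_carrier by (intro S.P.finsum_addf) (auto simp: decomposition_def)
    from d have "decomposition (\<lambda>n. h n \<oplus>\<^bsub>S\<^esub> h' n) (max N N') (f \<oplus>\<^bsub>S\<^esub> g)"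
      using G_add sum by (simp add: decomposition_def)
    then show ?thesis by blast
  qed
  have single: "\<exists>h N. decomposition h N (monom S (monom P a i) j)" if "a \<in> carrier R" for a i j
  proof -
    let ?m = "monom S (monom P a i) j"
    let ?h = "\<lambda>n. if i + j = n then ?m else \<zero>\<^bsub>S\<^esub>"
    have "(\<Oplus>\<^bsub>S\<^esub>n\<in>{..i + j}. ?h n) = ?m"
      using S.P.finsum_singleton[of "i + j" "{..i + j}" "\<lambda>_. ?m"] that by simp
    then have "decomposition ?h (i + j) ?m"
      using homgen_G[OF homgen_monom[OF that]] G_zero by (auto simp: decomposition_def)
    then show ?thesis by blast
  qed
  have monom: "\<exists>h N. decomposition h N (monom S q j)" if q: "q \<in> carrier P" for q j
  proof -
    have "\<exists>h N. decomposition h N (monom S (\<Oplus>\<^bsub>P\<^esub>i\<in>{..deg R q}. monom P (coeff P q i) i) j)"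
      by (rule P.P.finsum_closed_induct[where Q = "\<lambda>q. \<exists>h N. decomposition h N (monom S q j)"])
        (use q single zero add in auto)
    then show ?thesis using P.up_repr[OF q] by simp
  qed
  have "\<exists>h N. decomposition h N (\<Oplus>\<^bsub>S\<^esub>j\<in>{..deg P f}. monom S (coeff S f j) j)"
    by (rule S.P.finsum_closed_induct) (use f monom zero add in auto)
  then show ?thesis using that S.up_repr[OF f] by auto
qed

text \<open>The inner evaluation substitutes for \<open>T\<^sub>0\<close> in the coefficients, the
  outer one for \<open>T\<^sub>1\<close>. The target is a parameter because values are taken both in
  \<open>F\<close> and in \<open>UP F\<close>.\<close>

definition ev :: "('k, 'n) ring_scheme \<Rightarrow> ('a \<Rightarrow> 'k) \<Rightarrow> (bool \<Rightarrow> 'k) \<Rightarrow> (nat \<Rightarrow> nat \<Rightarrow> 'a) \<Rightarrow> 'k" where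
  "ev K c t = eval P K (eval R K c (t False)) (t True)"

lemma ev_props:
  assumes K: "cring K" and c: "c \<in> ring_hom R K" and t: "\<And>k. t k \<in> carrier K"
  shows ev_hom: "ev K c t \<in> ring_hom S K"
    and ev_const: "a \<in> carrier R \<Longrightarrow> ev K c t (const_poly2 R a) = c a"
    and ev_pvar: "ev K c t (pvar R k) = t k"
proof -
  interpret K: cring K by fact
  interpret c: ring_hom_cring R K c using c by unfold_locales
  interpret E1: UP_pre_univ_prop R K c "UP R" by unfold_locales
  let ?E1 = "eval R K c (t False)"
  have E1: "?E1 \<in> ring_hom P K" by (rule E1.eval_ring_hom[OF t])
  interpret e1: ring_hom_cring P K ?E1 using E1 by unfold_locales
  interpret E2: UP_pre_univ_prop "UP R" K ?E1 "UP (UP R)" by unfold_locales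
  show "ev K c t \<in> ring_hom S K" unfolding ev_def by (rule E2.eval_ring_hom[OF t])
  show "ev K c t (const_poly2 R a) = c a" if "a \<in> carrier R"
    unfolding ev_def const_poly2_def using that t by (simp add: E2.eval_const E1.eval_const)
  show "ev K c t (pvar R k) = t k"
  proof (cases k)
    case True
    then show ?thesis unfolding ev_def pvar_def using E2.eval_monom1[OF t] by simp
  next
    case False
    then show ?thesis unfolding ev_def pvar_def using t E1.eval_monom1[OF t] by (simp add: E2.eval_const)
  qed
qed

text \<open>Evaluation at \<open>(t\<^sub>0 Y, t\<^sub>1 Y)\<close> turns the degree of a form into the degree in \<open>Y\<close>.\<close>

lemma ev_monom:
  assumes K: "cring K" and c: "c \<in> ring_hom R K" and t: "\<And>k. t k \<in> carrier K" and f: "f \<in> G n"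
  shows "ev (UP K) (\<lambda>a. monom (UP K) (c a) 0) (\<lambda>k. monom (UP K) (t k) 1) f
    = monom (UP K) (ev K c t f) n"
proof -
  interpret K: UP_cring K "UP K" using K by (simp add: UP_cring_def)
  let ?c = "\<lambda>a. monom (UP K) (c a) 0" and ?t = "\<lambda>k. monom (UP K) (t k) 1"
  have c': "?c \<in> ring_hom R (UP K)"
    using ring_hom_trans[OF c K.const_ring_hom] by (simp add: comp_def)
  have t': "?t k \<in> carrier (UP K)" for k using t by simp
  note hom = ev_hom[OF K c t] and hom' = ev_hom[OF K.UP_cring c' t']
  have cl: "ev K c t f \<in> carrier K" if "f \<in> G n" for f n
    using ring_hom_closed[OF hom G_carrier[OF that]] .
  show ?thesis using f
  proof (induction rule: G_induct)
    case (const a)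
    then show ?case by (simp only: ev_const[OF K c t] ev_const[OF K.UP_cring c' t'])
  next
    case (var n f k)
    have "ev (UP K) ?c ?t (f \<otimes>\<^bsub>S\<^esub> pvar R k) = monom (UP K) (ev K c t f) n \<otimes>\<^bsub>UP K\<^esub> monom (UP K) (t k) 1"
      using var G_carrier[OF var(1)]
      by (simp only: ring_hom_mult[OF hom'] pvar_closed ev_pvar[OF K.UP_cring c' t'])
    also have "\<dots> = monom (UP K) (ev K c t f \<otimes>\<^bsub>K\<^esub> t k) (n + 1)"
      by (rule K.monom_mult[OF cl[OF var(1)] t, symmetric])
    also have "ev K c t f \<otimes>\<^bsub>K\<^esub> t k = ev K c t (f \<otimes>\<^bsub>S\<^esub> pvar R k)"
      using G_carrier[OF var(1)] by (simp only: ring_hom_mult[OF hom] pvar_closed ev_pvar[OF K c t])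
    finally show ?case by simp
  next
    case (add n f g)
    have "ev (UP K) ?c ?t (f \<oplus>\<^bsub>S\<^esub> g) = monom (UP K) (ev K c t f) n \<oplus>\<^bsub>UP K\<^esub> monom (UP K) (ev K c t g) n"
      using add G_carrier by (simp only: ring_hom_add[OF hom'])
    also have "\<dots> = monom (UP K) (ev K c t f \<oplus>\<^bsub>K\<^esub> ev K c t g) n"
      using cl add by (intro K.monom_add[symmetric]) auto
    also have "ev K c t f \<oplus>\<^bsub>K\<^esub> ev K c t g = ev K c t (f \<oplus>\<^bsub>S\<^esub> g)"
      using add G_carrier by (simp only: ring_hom_add[OF hom])
    finally show ?case .
  qed
qed

text \<open>Each variable contributes one factor \<open>z\<close>. This governs the passage between
  homogeneous coordinates and the normalized coordinates of a chart.\<close>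

lemma ev_scale:
  assumes K: "cring K" and c: "c \<in> ring_hom R K" and u: "\<And>k. u k \<in> carrier K" and z: "z \<in> carrier K"
    and t: "\<And>k. t k = z \<otimes>\<^bsub>K\<^esub> u k" and f: "f \<in> G n"
  shows "ev K c t f = z [^]\<^bsub>K\<^esub> n \<otimes>\<^bsub>K\<^esub> ev K c u f"
proof -
  interpret K: cring K by fact
  have tc: "t k \<in> carrier K" for k using u z t by simp
  note hom = ev_hom[OF K c tc] and hom' = ev_hom[OF K c u]
  have cl: "ev K c u f \<in> carrier K" if "f \<in> G n" for f n
    using ring_hom_closed[OF hom' G_carrier[OF that]] .
  show ?thesis using f
  proof (induction rule: G_induct)
    case (const a)
    then show ?case using c ring_hom_closed by (fastforce simp: ev_const[OF K c tc] ev_const[OF K c u])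
  next
    case (var n f k)
    have "ev K c t (f \<otimes>\<^bsub>S\<^esub> pvar R k) = z [^]\<^bsub>K\<^esub> n \<otimes>\<^bsub>K\<^esub> ev K c u f \<otimes>\<^bsub>K\<^esub> (z \<otimes>\<^bsub>K\<^esub> u k)"
      using G_carrier[OF var(1)]
      by (simp only: ring_hom_mult[OF hom] pvar_closed ev_pvar[OF K c tc] var(2) t[of k])
    also have "\<dots> = z [^]\<^bsub>K\<^esub> Suc n \<otimes>\<^bsub>K\<^esub> (ev K c u f \<otimes>\<^bsub>K\<^esub> u k)"
      using cl[OF var(1)] u z by (simp add: K.m_ac)
    also have "ev K c u f \<otimes>\<^bsub>K\<^esub> u k = ev K c u (f \<otimes>\<^bsub>S\<^esub> pvar R k)"
      using G_carrier[OF var(1)] by (simp only: ring_hom_mult[OF hom'] pvar_closed ev_pvar[OF K c u])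
    finally show ?case .
  next
    case (add n f g)
    then show ?case
      using G_carrier cl[OF add(1)] cl[OF add(2)] z
      by (simp add: ring_hom_add[OF hom] ring_hom_add[OF hom'] K.r_distr)
  qed
qed

section \<open>The irrelevant ideal, the points of Proj and their topology\<close>

lemma irrelevant_pvar:
  assumes p: "ideal p S" and "pvar R False \<in> p" "pvar R True \<in> p"
  shows "irrelevant_ideal S G \<subseteq> p"
proof -
  interpret p: ideal p S by fact
  have k: "pvar R k \<in> p" for k using assms(2,3) by (cases k) auto
  \<comment> \<open>The premise on the degree is part of the induction: constants then claim
    nothing, and a product with a variable lies in \<open>p\<close> in any case.\<close>
  have "n \<noteq> 0 \<longrightarrow> f \<in> p" if "f \<in> G n" for f n
    using that
  proof (induction rule: G_induct)
    case (var n f k)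
    then show ?case using p.I_l_closed[OF k] G_carrier by blast
  next
    case (add n f g)
    then show ?case using p.a_closed by blast
  qed auto
  then have "(\<Union>n\<in>{1..}. G n) \<subseteq> p" by fastforce
  then show ?thesis unfolding irrelevant_ideal_def by (rule S.P.genideal_minimal[OF p])
qed

lemma pvar_irrelevant: "pvar R k \<in> irrelevant_ideal S G"
proof -
  have "(\<Union>n\<in>{1..}. G n) \<subseteq> carrier S" using G_carrier by blast
  then have "(\<Union>n\<in>{1..}. G n) \<subseteq> irrelevant_ideal S G"
    unfolding irrelevant_ideal_def by (rule S.P.genideal_self)
  moreover have "pvar R k \<in> (\<Union>n\<in>{1..}. G n)" using G_pvar[of k] by (intro UN_I[of 1]) auto
  ultimately show ?thesis by blast
qed

text \<open>A prime containing both variables contains the irrelevant ideal, so the two standard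
  charts cover.\<close>

lemma Proj_points_pvar:
  assumes "p \<in> Proj_points S G"
  obtains k where "pvar R k \<notin> p"
proof -
  have "ideal p S" "\<not> irrelevant_ideal S G \<subseteq> p"
    using assms by (auto simp: Proj_points_def homogeneous_ideal_def)
  then show ?thesis using irrelevant_pvar that by blast
qed

text \<open>Homogeneous ideals are generated by the forms they contain.\<close>

lemma Proj_points_eqI:
  assumes "p \<in> Proj_points S G" "q \<in> Proj_points S G"
    and "\<And>n f. f \<in> G n \<Longrightarrow> f \<in> p \<longleftrightarrow> f \<in> q"
  shows "p = q"
proof -
  have "p \<inter> (\<Union>n. G n) = q \<inter> (\<Union>n. G n)" using assms(3) by auto
  then show ?thesis using assms(1,2) by (metis (no_types, lifting) Proj_points_def homogeneous_ideal_def mem_Collect_eq)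
qed

definition proj_top :: "(nat \<Rightarrow> nat \<Rightarrow> 'a) set topology" where
  "proj_top = subtopology (zariski_topology S) (Proj_points S G)"

lemma topspace_proj [simp]: "topspace proj_top = Proj_points S G"
  using topspace_zariski[OF S.P.cring_axioms] by (auto simp: proj_top_def Proj_points_def)

lemma Proj_line_eq: "Proj_line R = frac_space S proj_top (homogeneous_fracs G)"
  by (simp add: Proj_line_def Proj_def proj_top_def)

lemma openin_proj_basic:
  assumes "f \<in> carrier S"
  shows "openin proj_top {p \<in> Proj_points S G. f \<notin> p}"
proof -
  have "{p \<in> Proj_points S G. f \<notin> p} = {p. primeideal p S \<and> f \<notin> p} \<inter> Proj_points S G"
    by (auto simp: Proj_points_def)
  then show ?thesis
    unfolding proj_top_def openin_subtopology using openin_zariski_basic[OF assms] by blast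
qed

sublocale proj: frac_data S G proj_top
proof (rule frac_data.intro[OF S.P.cring_axioms], rule frac_data_axioms.intro)
  show "primeideal p S" if "p \<in> topspace proj_top" for p
    using that by (simp add: Proj_points_def)
  show "openin proj_top {p \<in> topspace proj_top. f \<notin> p}" if "f \<in> G n" for f n
    using openin_proj_basic[OF G_carrier[OF that]] by simp
qed (auto simp: G_zero G_one G_add G_minus G_mult G_carrier)

lemma continuous_proj:
  assumes pts: "\<And>x. x \<in> topspace X \<Longrightarrow> g x \<in> Proj_points S G"
    and op: "\<And>f. f \<in> carrier S \<Longrightarrow> openin X {x \<in> topspace X. f \<notin> g x}"
  shows "continuous_map X proj_top g"
  unfolding proj_top_def continuous_map_in_subtopology
proof
  show "continuous_map X (zariski_topology S) g"
    unfolding zariski_topology_def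
  proof (rule continuous_on_generated_topo)
    show "g ` topspace X \<subseteq> \<Union> ((\<lambda>f. {p. primeideal p S \<and> f \<notin> p}) ` carrier S)"
      using pts proj.one_notin by (fastforce simp: Proj_points_def)
    fix U assume "U \<in> (\<lambda>f. {p. primeideal p S \<and> f \<notin> p}) ` carrier S"
    then obtain f where f: "f \<in> carrier S" "U = {p. primeideal p S \<and> f \<notin> p}" by blast
    have "g -` U \<inter> topspace X = {x \<in> topspace X. f \<notin> g x}"
      using pts f(2) by (auto simp: Proj_points_def)
    then show "openin X (g -` U \<inter> topspace X)" using op[OF f(1)] by simp
  qed
qed (use pts in auto)

end

section \<open>Morphisms to the projective line\<close>

locale proj_field = field F for F :: "('f, 'm) ring_scheme" (structure) +
  fixes D :: "'f set"
  assumes D: "subring D F"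
begin

sublocale pl: poly2 "F\<lparr>carrier := D\<rparr>"
  by (rule poly2.intro[OF subring_cring[OF D]])

abbreviation "S \<equiv> UP (UP (F\<lparr>carrier := D\<rparr>))"
abbreviation "G \<equiv> homogeneous_poly2 (F\<lparr>carrier := D\<rparr>)"
abbreviation "var \<equiv> pvar (F\<lparr>carrier := D\<rparr>)"
abbreviation "const \<equiv> const_poly2 (F\<lparr>carrier := D\<rparr>)"

lemma D_carrier: "a \<in> D \<Longrightarrow> a \<in> carrier F"
  using subringE(1)[OF D] by auto

lemma incl_hom: "(\<lambda>a. a) \<in> ring_hom (F\<lparr>carrier := D\<rparr>) F"
  by (rule ring_hom_memI) (auto simp: D_carrier)

definition e :: "(bool \<Rightarrow> 'f) \<Rightarrow> (nat \<Rightarrow> nat \<Rightarrow> 'f) \<Rightarrow> 'f" where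
  "e t = pl.ev F (\<lambda>a. a) t"

text \<open>A substitution with values in \<open>F[Y]\<close>: the coefficient at \<open>n\<close>
  is the value of the component of degree \<open>n\<close> (\<open>\<Phi>_coeff\<close>), so one
  ring homomorphism carries all components.\<close>

definition \<Phi> :: "(bool \<Rightarrow> 'f) \<Rightarrow> (nat \<Rightarrow> nat \<Rightarrow> 'f) \<Rightarrow> (nat \<Rightarrow> 'f)" where
  "\<Phi> t = pl.ev (UP F) (\<lambda>a. monom (UP F) a 0) (\<lambda>k. monom (UP F) (t k) 1)"

text \<open>For \<open>D\<close> and the coordinates inside \<open>L\<close>,
  \<open>\<Phi> u\<close> takes values in \<open>L[Y]\<close>, and this is the preimage of
  \<open>N[Y]\<close> with \<open>N = nonunits F L\<close>. In this form inhomogeneous polynomials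
  are covered and primality becomes that of \<open>N[Y]\<close>.\<close>

definition hpoint :: "'f set \<Rightarrow> (bool \<Rightarrow> 'f) \<Rightarrow> (nat \<Rightarrow> nat \<Rightarrow> 'f) set" where
  "hpoint L u = {f \<in> carrier S. \<forall>n. coeff (UP F) (\<Phi> u f) n \<in> nonunits F L}"

sublocale UF: UP_cring F "UP F"
  by (simp add: UP_cring_def cring_axioms)

context
  fixes t :: "bool \<Rightarrow> 'f"
  assumes t: "\<And>k. t k \<in> carrier F"
begin

lemma e_hom: "e t \<in> ring_hom S F"
  unfolding e_def by (rule pl.ev_hom[OF cring_axioms incl_hom t])

lemma e_const: "a \<in> D \<Longrightarrow> e t (const a) = a"
  unfolding e_def using pl.ev_const[OF cring_axioms incl_hom t, of a] by simp

lemma e_var: "e t (var k) = t k"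
  unfolding e_def by (rule pl.ev_pvar[OF cring_axioms incl_hom t])

lemma e_closed: "f \<in> carrier S \<Longrightarrow> e t f \<in> carrier F"
  using ring_hom_closed[OF e_hom] .

lemma \<Phi>_hom: "\<Phi> t \<in> ring_hom S (UP F)"
  unfolding \<Phi>_def
proof (rule pl.ev_hom[OF UF.UP_cring])
  show "(\<lambda>a. monom (UP F) a 0) \<in> ring_hom (F\<lparr>carrier := D\<rparr>) (UP F)"
    using ring_hom_trans[OF incl_hom UF.const_ring_hom] by (simp add: comp_def)
qed (use t in simp)

lemma \<Phi>_G: "f \<in> G n \<Longrightarrow> \<Phi> t f = monom (UP F) (e t f) n"
  unfolding \<Phi>_def e_def by (rule pl.ev_monom[OF cring_axioms incl_hom t])

lemma \<Phi>_coeff: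
  assumes "pl.decomposition h N f"
  shows "coeff (UP F) (\<Phi> t f) n = e t (h n)"
proof -
  have h: "h n \<in> G n" "h n \<in> carrier S" for n
    using assms pl.G_carrier by (auto simp: pl.decomposition_def)
  have f: "f = (\<Oplus>\<^bsub>S\<^esub>n\<in>{..N}. h n)" using assms by (simp add: pl.decomposition_def)
  interpret hom: ring_hom_cring S "UP F" "\<Phi> t"
    using \<Phi>_hom by unfold_locales
  have "\<Phi> t f = (\<Oplus>\<^bsub>UP F\<^esub>m\<in>{..N}. \<Phi> t (h m))"
    unfolding f using h by (subst hom.hom_finsum) (auto simp: comp_def)
  then have "coeff (UP F) (\<Phi> t f) n = (\<Oplus>m\<in>{..N}. coeff (UP F) (\<Phi> t (h m)) n)"
    using h by (simp add: UF.coeff_finsum Pi_def)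
  also have "\<dots> = (\<Oplus>m\<in>{..N}. if n = m then e t (h m) else \<zero>)"
  proof (rule finsum_cong'[OF refl])
    fix m assume "m \<in> {..N}"
    show "coeff (UP F) (\<Phi> t (h m)) n = (if n = m then e t (h m) else \<zero>)"
      using \<Phi>_G[OF h(1)[of m]] e_closed[OF h(2)[of m]] by auto
  qed (use h e_closed in auto)
  also have "\<dots> = e t (h n)"
  proof (cases "n \<le> N")
    case True
    then show ?thesis using h e_closed by (subst add.finprod_singleton) auto
  next
    case False
    then have "h n = \<zero>\<^bsub>S\<^esub>" using assms by (simp add: pl.decomposition_def)
    moreover have "e t \<zero>\<^bsub>S\<^esub> = \<zero>"
      using ring_hom_cring.hom_zero[of S F "e t"] e_hom
      by (simp add: ring_hom_cring_def ring_hom_cring_axioms_def pl.S.UP_cring cring_axioms)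
    moreover have "(\<Oplus>m\<in>{..N}. if n = m then e t (h m) else \<zero>) = (\<Oplus>m\<in>{..N}. \<zero>)"
      using False by (intro finsum_cong') auto
    ultimately show ?thesis by simp
  qed
  finally show ?thesis .
qed

end

lemma e_scale:
  assumes "\<And>k. u k \<in> carrier F" "z \<in> carrier F" "\<And>k. t k = z \<otimes> u k" "f \<in> G n"
  shows "e t f = z [^] n \<otimes> e u f"
  unfolding e_def by (rule pl.ev_scale[OF cring_axioms incl_hom assms])

lemma pow_subring: "subring L F \<Longrightarrow> z \<in> L \<Longrightarrow> z [^] (n :: nat) \<in> L"
  using subringE[of L F] by (induction n) auto

section \<open>The homogeneous prime attached to a local ring and coordinates in it\<close>

context
  fixes L :: "'f set" and u :: "bool \<Rightarrow> 'f"
  assumes L: "local_subring F L" and DL: "D \<subseteq> L" and u: "\<And>k. u k \<in> L"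
begin

lemma L_sub: "subring L F" and L_car: "y \<in> L \<Longrightarrow> y \<in> carrier F"
  using local_subringD(1)[OF L] subringE(1) by blast+

lemma u_car: "u k \<in> carrier F"
  using L_car u by blast

lemma e_in_L: "f \<in> G n \<Longrightarrow> e u f \<in> L"
proof (induction rule: pl.G_induct)
  case (const a)
  then show ?case using DL e_const[OF u_car] by auto
next
  case (var n f k)
  then show ?case
    using pl.G_carrier[OF var(1)] ring_hom_mult[OF e_hom[OF u_car]] e_var[OF u_car] subringE(6)[OF L_sub] u
    by simp
next
  case (add n f g)
  then show ?case
    using pl.G_carrier ring_hom_add[OF e_hom[OF u_car]] subringE(7)[OF L_sub] by simp
qed

lemma hpoint_iff:
  assumes "f \<in> carrier S" "pl.decomposition h N f"
  shows "f \<in> hpoint L u \<longleftrightarrow> (\<forall>n. e u (h n) \<in> nonunits F L)"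
  using assms by (simp add: hpoint_def \<Phi>_coeff[OF u_car])

lemma hpoint_G:
  assumes "f \<in> G n"
  shows "f \<in> hpoint L u \<longleftrightarrow> e u f \<in> nonunits F L"
  using pl.G_carrier[OF assms] e_closed[OF u_car] zero_nonunit[OF L_sub]
  by (auto simp: hpoint_def \<Phi>_G[OF u_car assms])

text \<open>Reduces membership to forms; both the homogeneity of this prime and the continuity of
  the point map rest on it.\<close>

lemma hpoint_components:
  assumes "f \<in> carrier S" "pl.decomposition h N f"
  shows "f \<in> hpoint L u \<longleftrightarrow> (\<forall>n\<le>N. h n \<in> hpoint L u)"
proof -
  have "h n \<in> G n" for n using assms by (simp add: pl.decomposition_def)
  then have "f \<in> hpoint L u \<longleftrightarrow> (\<forall>n. h n \<in> hpoint L u)"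
    using hpoint_iff[OF assms] hpoint_G by blast
  moreover have "h n \<in> hpoint L u" if "n > N" for n
  proof -
    have "h n = \<zero>\<^bsub>S\<^esub>" using assms that by (simp add: pl.decomposition_def)
    moreover have "\<Phi> u \<zero>\<^bsub>S\<^esub> = \<zero>\<^bsub>UP F\<^esub>"
      using ring_hom_cring.hom_zero[of S "UP F" "\<Phi> u"] \<Phi>_hom[OF u_car]
      by (simp add: ring_hom_cring_def ring_hom_cring_axioms_def pl.S.UP_cring UF.UP_cring)
    ultimately show ?thesis using zero_nonunit[OF L_sub] by (simp add: hpoint_def)
  qed
  ultimately show ?thesis by (metis not_le)
qed

lemma \<Phi>_coeff_L: "f \<in> carrier S \<Longrightarrow> coeff (UP F) (\<Phi> u f) n \<in> L"
proof -
  assume f: "f \<in> carrier S"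
  obtain h N where h: "pl.decomposition h N f" using pl.decomposition_exists[OF f] .
  then have "h n \<in> G n" by (simp add: pl.decomposition_def)
  then show ?thesis using \<Phi>_coeff[OF u_car h] e_in_L by simp
qed

lemma finsum_nonunits:
  assumes "finite A" "\<And>i. i \<in> A \<Longrightarrow> h i \<in> nonunits F L"
  shows "(\<Oplus>i\<in>A. h i) \<in> nonunits F L"
proof (rule finsum_closed_induct[where Q = "\<lambda>y. y \<in> nonunits F L", OF assms(1)])
  show "h i \<in> carrier F" if "i \<in> A" for i
    using assms(2)[OF that] L_car by (simp add: nonunits_def)
qed (use assms(2) zero_nonunit[OF L_sub] local_subringD(2)[OF L] in simp_all)

lemma ideal_hpoint: "ideal (hpoint L u) S"
proof (rule pl.S.P.idealI')
  note hom = \<Phi>_hom[OF u_car]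
  have cl: "\<Phi> u f \<in> carrier (UP F)" if "f \<in> carrier S" for f using ring_hom_closed[OF hom that] .
  show "hpoint L u \<subseteq> carrier S" by (auto simp: hpoint_def)
  show "\<zero>\<^bsub>S\<^esub> \<in> hpoint L u"
    using hpoint_G[OF pl.G_zero] ring_hom_cring.hom_zero[of S F "e u"] e_hom[OF u_car] zero_nonunit[OF L_sub]
    by (simp add: ring_hom_cring_def ring_hom_cring_axioms_def pl.S.UP_cring cring_axioms)
  show "f \<oplus>\<^bsub>S\<^esub> g \<in> hpoint L u" if "f \<in> hpoint L u" "g \<in> hpoint L u" for f g
    using that cl local_subringD(2)[OF L] by (simp add: hpoint_def ring_hom_add[OF hom])
  show "r \<otimes>\<^bsub>S\<^esub> f \<in> hpoint L u" if f: "f \<in> hpoint L u" and r: "r \<in> carrier S" for f r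
  proof -
    have f': "f \<in> carrier S" using f by (simp add: hpoint_def)
    have "coeff (UP F) (\<Phi> u r) i \<otimes> coeff (UP F) (\<Phi> u f) j \<in> nonunits F L" for i j
      using nonunits_mult[OF L_sub _ \<Phi>_coeff_L[OF r]] f by (simp add: hpoint_def)
    then show ?thesis
      using f' r cl by (simp add: hpoint_def ring_hom_mult[OF hom] finsum_nonunits)
  qed
qed

lemma hpoint_carrier: "f \<in> hpoint L u \<Longrightarrow> f \<in> carrier S"
  by (simp add: hpoint_def)

text \<open>Gauss's argument: for the least indices \<open>i\<close> and \<open>j\<close> of
  coefficients outside the nonunits, the coefficient of the product at \<open>i + j\<close> is
  \<open>f\<^sub>i g\<^sub>j\<close> plus nonunits. The ideal is proper because the variable
  \<open>k\<close> takes the value one.\<close>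

lemma prime_hpoint:
  assumes "u k = \<one>"
  shows "primeideal (hpoint L u) S"
proof (rule primeidealI[OF ideal_hpoint pl.S.UP_cring])
  note hom = \<Phi>_hom[OF u_car]
  have cl: "\<Phi> u f \<in> carrier (UP F)" if "f \<in> carrier S" for f using ring_hom_closed[OF hom that] .
  have "var k \<notin> hpoint L u"
    using hpoint_G[OF pl.G_pvar] e_var[OF u_car] assms one_not_nonunit[OF L_sub] by simp
  then show "carrier S \<noteq> hpoint L u" using pl.pvar_closed[of k] by metis
  fix f g assume f: "f \<in> carrier S" and g: "g \<in> carrier S" and fg: "f \<otimes>\<^bsub>S\<^esub> g \<in> hpoint L u"
  let ?N = "nonunits F L"
  let ?f = "\<lambda>i. coeff (UP F) (\<Phi> u f) i" and ?g = "\<lambda>i. coeff (UP F) (\<Phi> u g) i"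
  have cf: "?f i \<in> L" "?f i \<in> carrier F" and cg: "?g i \<in> L" "?g i \<in> carrier F" for i
    using \<Phi>_coeff_L f g L_car by auto
  show "f \<in> hpoint L u \<or> g \<in> hpoint L u"
  proof (rule ccontr)
    assume "\<not> (f \<in> hpoint L u \<or> g \<in> hpoint L u)"
    then have ex: "\<exists>i. ?f i \<notin> ?N" "\<exists>i. ?g i \<notin> ?N" using f g by (auto simp: hpoint_def)
    define i where "i = (LEAST i. ?f i \<notin> ?N)"
    define j where "j = (LEAST j. ?g j \<notin> ?N)"
    have i: "?f i \<notin> ?N" "\<And>l. l < i \<Longrightarrow> ?f l \<in> ?N"
      unfolding i_def using LeastI_ex[OF ex(1)] not_less_Least by blast+
    have j: "?g j \<notin> ?N" "\<And>l. l < j \<Longrightarrow> ?g l \<in> ?N"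
      unfolding j_def using LeastI_ex[OF ex(2)] not_less_Least by blast+
    let ?h = "\<lambda>l. ?f l \<otimes> ?g (i + j - l)"
    have "?h l \<in> ?N" if "l \<le> i + j" "l \<noteq> i" for l
    proof (cases "l < i")
      case True
      then show ?thesis using nonunits_mult[OF L_sub i(2) cg(1)] m_comm cf(2) cg(2) by simp
    next
      case False
      then have "i + j - l < j" using that by auto
      then show ?thesis using nonunits_mult[OF L_sub j(2) cf(1)] by simp
    qed
    then have rest: "(\<Oplus>l\<in>{..i + j} - {i}. ?h l) \<in> ?N" by (intro finsum_nonunits) auto
    have hc: "?h l \<in> carrier F" for l using cf cg by simp
    have rc: "(\<Oplus>l\<in>{..i + j} - {i}. ?h l) \<in> carrier F" using hc by (intro finsum_closed) auto
    have mem: "coeff (UP F) (\<Phi> u (f \<otimes>\<^bsub>S\<^esub> g)) (i + j) \<in> ?N" using fg by (simp add: hpoint_def)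
    have "coeff (UP F) (\<Phi> u (f \<otimes>\<^bsub>S\<^esub> g)) (i + j) = (\<Oplus>l\<in>{..i + j}. ?h l)"
      using f g cl by (simp add: ring_hom_mult[OF hom])
    also have "{..i + j} = insert i ({..i + j} - {i})" by auto
    also have "(\<Oplus>l\<in>insert i ({..i + j} - {i}). ?h l) = ?h i \<oplus> (\<Oplus>l\<in>{..i + j} - {i}. ?h l)"
      using hc cf(2)[of i] cg(2)[of j] by (intro finsum_insert) auto
    finally have tot: "?h i \<oplus> (\<Oplus>l\<in>{..i + j} - {i}. ?h l) \<in> ?N" using mem by (simp only:)
    \<comment> \<open>The negative of the remaining terms is a multiple of a nonunit; adding it
      isolates the product of the two lowest coefficients outside the nonunits.\<close>
    have "\<ominus> \<one> \<otimes> (\<Oplus>l\<in>{..i + j} - {i}. ?h l) \<in> ?N"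
      using nonunits_mult[OF L_sub rest] subringE(3,5)[OF L_sub] by blast
    then have "(?h i \<oplus> (\<Oplus>l\<in>{..i + j} - {i}. ?h l)) \<oplus> \<ominus> \<one> \<otimes> (\<Oplus>l\<in>{..i + j} - {i}. ?h l) \<in> ?N"
      using local_subringD(2)[OF L tot] by blast
    also have "(?h i \<oplus> (\<Oplus>l\<in>{..i + j} - {i}. ?h l)) \<oplus> \<ominus> \<one> \<otimes> (\<Oplus>l\<in>{..i + j} - {i}. ?h l) = ?h i"
      using hc[of i] rc by (simp add: l_minus a_assoc r_neg)
    finally have "?f i \<otimes> ?g j \<in> ?N" by simp
    then show False using nonunits_prime[OF L_sub cf(1)[of i] cg(1)[of j]] i(1) j(1) by blast
  qed
qed

lemma hpoint_Proj:
  assumes k: "u k = \<one>"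
  shows "hpoint L u \<in> Proj_points S G"
proof -
  let ?J = "hpoint L u \<inter> (\<Union>n. G n)"
  have sub: "?J \<subseteq> carrier S" using pl.G_carrier by auto
  have J: "ideal (Idl\<^bsub>S\<^esub> ?J) S" by (rule pl.S.P.genideal_ideal[OF sub])
  have "Idl\<^bsub>S\<^esub> ?J \<subseteq> hpoint L u" by (rule pl.S.P.genideal_minimal[OF ideal_hpoint]) simp
  moreover have "hpoint L u \<subseteq> Idl\<^bsub>S\<^esub> ?J"
  proof
    fix f assume f: "f \<in> hpoint L u"
    then have fc: "f \<in> carrier S" by (rule hpoint_carrier)
    obtain h N where h: "pl.decomposition h N f" using pl.decomposition_exists[OF fc] .
    have "h n \<in> Idl\<^bsub>S\<^esub> ?J" if "n \<in> {..N}" for n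
    proof -
      have "h n \<in> G n" using h by (simp add: pl.decomposition_def)
      moreover have "h n \<in> hpoint L u" using hpoint_components[OF fc h] f that by simp
      ultimately have "h n \<in> ?J" by blast
      then show ?thesis using pl.S.P.genideal_self[OF sub] by blast
    qed
    then have "(\<Oplus>\<^bsub>S\<^esub>n\<in>{..N}. h n) \<in> Idl\<^bsub>S\<^esub> ?J"
    proof (intro pl.S.P.finsum_closed_induct[where Q = "\<lambda>f. f \<in> Idl\<^bsub>S\<^esub> ?J"])
      show "h n \<in> carrier S" for n using h pl.G_carrier by (auto simp: pl.decomposition_def)
      show "\<zero>\<^bsub>S\<^esub> \<in> Idl\<^bsub>S\<^esub> ?J"
        by (rule additive_subgroup.zero_closed[OF ideal.axioms(1)[OF J]])
      show "f \<oplus>\<^bsub>S\<^esub> g \<in> Idl\<^bsub>S\<^esub> ?J" if "f \<in> Idl\<^bsub>S\<^esub> ?J" "g \<in> Idl\<^bsub>S\<^esub> ?J" for f g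
        by (rule additive_subgroup.a_closed[OF ideal.axioms(1)[OF J] that])
    qed auto
    then show "f \<in> Idl\<^bsub>S\<^esub> ?J" using h by (simp add: pl.decomposition_def)
  qed
  ultimately have "homogeneous_ideal S G (hpoint L u)"
    using ideal_hpoint by (auto simp: homogeneous_ideal_def)
  moreover have "var k \<notin> hpoint L u"
    using hpoint_G[OF pl.G_pvar] e_var[OF u_car] k one_not_nonunit[OF L_sub] by simp
  then have "\<not> irrelevant_ideal S G \<subseteq> hpoint L u" using pl.pvar_irrelevant by blast
  ultimately show ?thesis using prime_hpoint[OF k] by (simp add: Proj_points_def)
qed

end

end

text \<open>The family \<open>t\<close> gives homogeneous coordinates of a point of the projective line over \<open>F\<close>.\<close>

locale proj_mor = proj_field F D + X: ffs F X L val \<eta>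
  for F :: "('f, 'm) ring_scheme" (structure) and D and X :: "('p, 's) ringed_space" and L val \<eta> +
  fixes t :: "bool \<Rightarrow> 'f"
  assumes DL: "x \<in> lrs_points X \<Longrightarrow> D \<subseteq> L x"
    and t_carrier: "t k \<in> carrier F"
    and ratio: "x \<in> lrs_points X \<Longrightarrow> \<exists>k. t k \<noteq> \<zero> \<and> (\<forall>j. t j \<otimes> inv t k \<in> L x)"
begin

definition adm :: "'p \<Rightarrow> bool \<Rightarrow> bool" where
  "adm x k \<longleftrightarrow> t k \<noteq> \<zero> \<and> (\<forall>j. t j \<otimes> inv t k \<in> L x)"

definition quot :: "bool \<Rightarrow> bool \<Rightarrow> 'f" where
  "quot k j = t j \<otimes> inv t k"

text \<open>An arbitrary admissible choice; \<open>mem_pt\<close> shows that any other one decides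
  membership of forms in the same way.\<close>

definition chart :: "'p \<Rightarrow> bool" where
  "chart x = (SOME k. adm x k)"

definition pt :: "'p \<Rightarrow> (nat \<Rightarrow> nat \<Rightarrow> 'f) set" where
  "pt x = hpoint (L x) (quot (chart x))"

lemma adm_chart: "x \<in> lrs_points X \<Longrightarrow> adm x (chart x)"
proof -
  assume "x \<in> lrs_points X"
  then have "\<exists>k. adm x k" using ratio by (simp add: adm_def)
  then show ?thesis unfolding chart_def by (rule someI_ex)
qed

lemma adm_quot: "adm x k \<Longrightarrow> quot k j \<in> L x"
  by (auto simp: adm_def quot_def)

lemma adm_nz: "adm x k \<Longrightarrow> t k \<noteq> \<zero>"
  by (simp add: adm_def)

lemma quot_closed: "t k \<noteq> \<zero> \<Longrightarrow> quot k j \<in> carrier F"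
  by (simp add: quot_def t_carrier)

lemma quot_self: "t k \<noteq> \<zero> \<Longrightarrow> quot k k = \<one>"
  by (simp add: quot_def t_carrier)

lemma e_quot:
  assumes "t k \<noteq> \<zero>" "f \<in> G n"
  shows "e t f = t k [^] n \<otimes> e (quot k) f"
proof (rule e_scale[OF quot_closed[OF assms(1)] t_carrier _ assms(2)])
  fix j
  show "t j = t k \<otimes> quot k j"
    using t_carrier[of k] t_carrier[of j] assms(1) by (simp add: quot_def m_lcomm)
qed

lemma e_quot_change:
  assumes "t k \<noteq> \<zero>" "t l \<noteq> \<zero>" "f \<in> G n"
  shows "e (quot k) f = quot k l [^] n \<otimes> e (quot l) f"
proof (rule e_scale[OF quot_closed[OF assms(2)] quot_closed[OF assms(1)] _ assms(3)])
  fix j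
  have "quot k l \<otimes> quot l j = (t l \<otimes> inv t l) \<otimes> (t j \<otimes> inv t k)"
    using t_carrier assms(1,2) by (simp add: quot_def m_ac del: inv_mult_right)
  then show "quot k j = quot k l \<otimes> quot l j"
    using t_carrier assms(1,2) by (simp add: quot_def)
qed

text \<open>A change of chart multiplies the value of a form by a power of \<open>quot k l\<close>,
  which lies in \<open>L x\<close>; multiples of nonunits are nonunits, and the argument is
  symmetric in the two charts.\<close>

lemma mem_pt:
  assumes x: "x \<in> lrs_points X" and k: "adm x k" and f: "f \<in> G n"
  shows "f \<in> pt x \<longleftrightarrow> e (quot k) f \<in> nonunits F (L x)"
proof -
  note s = X.subring_L[OF x]
  note c = adm_chart[OF x]
  have *: "e (quot k) f \<in> nonunits F (L x)" if "adm x k" "adm x l" "e (quot l) f \<in> nonunits F (L x)" for k l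
    using e_quot_change[OF adm_nz[OF that(1)] adm_nz[OF that(2)] f]
      nonunits_mult[OF s that(3) pow_subring[OF s adm_quot[OF that(1)]]] by simp
  have "f \<in> pt x \<longleftrightarrow> e (quot (chart x)) f \<in> nonunits F (L x)"
    unfolding pt_def by (rule hpoint_G[OF X.local_L[OF x] DL[OF x] adm_quot[OF c] f])
  then show ?thesis using *[OF k c] *[OF c k] by blast
qed

lemma pt_Proj:
  assumes x: "x \<in> lrs_points X"
  shows "pt x \<in> Proj_points S G"
proof -
  note k = adm_chart[OF x]
  show ?thesis
    unfolding pt_def
    by (rule hpoint_Proj[of "L x" "quot (chart x)" "chart x", OF X.local_L[OF x] DL[OF x] adm_quot[OF k]
          quot_self[OF adm_nz[OF k]]])
qed

lemma unit_L: "x \<in> lrs_points X \<Longrightarrow> y \<in> L x \<Longrightarrow> y \<notin> nonunits F (L x) \<longleftrightarrow> y \<noteq> \<zero> \<and> inv y \<in> L x"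
  by (auto simp: nonunits_def)

lemma eq_in_L: "x \<in> lrs_points X \<Longrightarrow> adm x k \<Longrightarrow> f \<in> G n \<Longrightarrow> e (quot k) f \<in> L x"
  using e_in_L[of "L x" "quot k", OF X.local_L DL adm_quot] by blast

text \<open>Nearby it suffices that three fixed elements stay in the local ring: the two ratios of
  the chart \<open>k\<close>, and the inverse of the value of \<open>f\<close>. Each of these is an
  open condition.\<close>

lemma open_not_pt:
  assumes f: "f \<in> G n"
  shows "openin (lrs_top X) {x \<in> lrs_points X. f \<notin> pt x}"
proof (subst openin_subopen, intro ballI)
  fix x assume "x \<in> {x \<in> lrs_points X. f \<notin> pt x}"
  then have x: "x \<in> lrs_points X" "f \<notin> pt x" by auto
  obtain k where k: "adm x k" using adm_chart[OF x(1)] by blast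
  let ?y = "e (quot k) f"
  have y: "?y \<in> carrier F" "?y \<noteq> \<zero>" "inv ?y \<in> L x"
    using mem_pt[OF x(1) k f] x(2) unit_L[OF x(1) eq_in_L[OF x(1) k f]]
      X.L_carrier[OF x(1) eq_in_L[OF x(1) k f]] by auto
  let ?U = "\<lambda>z. {x \<in> lrs_points X. z \<in> L x}"
  let ?W = "?U (quot k False) \<inter> ?U (quot k True) \<inter> ?U (inv ?y)"
  have "openin (lrs_top X) ?W"
    using X.L_open quot_closed[OF adm_nz[OF k]] y by (intro openin_Int) auto
  moreover have "x \<in> ?W" using x adm_quot[OF k] y by auto
  moreover have "?W \<subseteq> {x \<in> lrs_points X. f \<notin> pt x}"
  proof
    fix z assume z: "z \<in> ?W"
    have "quot k j \<in> L z" for j using z by (cases j) auto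
    then have kz: "adm z k" using adm_nz[OF k] by (simp add: adm_def quot_def)
    have zX: "z \<in> lrs_points X" using z by simp
    have "?y \<notin> nonunits F (L z)" using unit_L[OF zX eq_in_L[OF zX kz f]] y z by simp
    then show "z \<in> {x \<in> lrs_points X. f \<notin> pt x}" using mem_pt[OF zX kz f] zX by simp
  qed
  ultimately show "\<exists>W. openin (lrs_top X) W \<and> x \<in> W \<and> W \<subseteq> {x \<in> lrs_points X. f \<notin> pt x}" by blast
qed

lemma continuous_pt: "continuous_map (lrs_top X) pl.proj_top pt"
proof (rule pl.continuous_proj)
  show "pt x \<in> Proj_points S G" if "x \<in> lrs_points X" for x by (rule pt_Proj[OF that])
  fix f assume f: "f \<in> carrier S"
  obtain h N where h: "pl.decomposition h N f" using pl.decomposition_exists[OF f] .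
  have hG: "h n \<in> G n" for n using h by (simp add: pl.decomposition_def)
  have "{x \<in> lrs_points X. f \<notin> pt x} = (\<Union>n\<in>{..N}. {x \<in> lrs_points X. h n \<notin> pt x})"
  proof -
    have "f \<in> pt x \<longleftrightarrow> (\<forall>n\<le>N. h n \<in> pt x)" if "x \<in> lrs_points X" for x
      unfolding pt_def
      by (rule hpoint_components[OF X.local_L[OF that] DL[OF that] adm_quot[OF adm_chart[OF that]] f h])
    then show ?thesis by auto
  qed
  then show "openin (lrs_top X) {x \<in> lrs_points X. f \<notin> pt x}"
    using open_not_pt[OF hG] by auto
qed

text \<open>In a fraction of forms of degree \<open>n\<close> the factor \<open>t k\<close> to the
  power \<open>n\<close> cancels, so its value at \<open>t\<close> is its value at the normalized
  coordinates, which lie in \<open>L x\<close>.\<close>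

sublocale M: ffs_frac_cont F X L val \<eta> S G pl.proj_top "e t" pt
proof (unfold_locales)
  show "e t \<in> ring_hom S F" by (rule e_hom[OF t_carrier])
  show "pt x \<in> topspace pl.proj_top" if "x \<in> lrs_points X" for x using pt_Proj[OF that] by simp
  show "continuous_map (lrs_top X) pl.proj_top pt" by (rule continuous_pt)
  fix x a f assume x: "x \<in> lrs_points X" and q: "(a, f) \<in> homogeneous_fracs G (pt x)"
  then obtain n where n: "a \<in> G n" "f \<in> G n" "f \<notin> pt x" by (auto simp: pl.proj.Q_iff)
  note k = adm_chart[OF x]
  let ?k = "chart x"
  let ?a = "e (quot ?k) a" and ?f = "e (quot ?k) f" and ?z = "t ?k [^] n"
  have L: "?a \<in> L x" "?f \<in> L x" using eq_in_L[OF x k] n by auto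
  then have c: "?a \<in> carrier F" "?f \<in> carrier F" using X.L_carrier[OF x] by auto
  have "?f \<notin> nonunits F (L x)" using mem_pt[OF x k n(2)] n(3) by blast
  note f = nonunits_divide[OF X.subring_L[OF x] L this]
  have "?z \<noteq> \<zero>" using adm_nz[OF k] t_carrier
    by (induction n) (auto simp: mult_eq_zero_iff)
  then have z: "?z \<noteq> \<zero>" "?z \<in> carrier F" using t_carrier by auto
  have eq: "e t a = ?z \<otimes> ?a" "e t f = ?z \<otimes> ?f" using e_quot[OF adm_nz[OF k]] n by auto
  have nz: "e t f \<noteq> \<zero>" using eq z f(1) c by (simp add: mult_eq_zero_iff)
  have "e t a \<otimes> inv e t f = ?a \<otimes> inv ?f"
    using divide_eq_divide_iff[of "e t a" "e t f" ?a ?f] nz f(1) c z eq by (simp add: m_ac)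
  then show "e t f \<noteq> \<zero> \<and> e t a \<otimes> inv e t f \<in> L x \<and>
      (e t a \<otimes> inv e t f \<in> nonunits F (L x) \<longleftrightarrow> a \<in> pt x)"
    using nz f(3,4) mem_pt[OF x k n(1)] by simp
qed

end

section \<open>Subspaces of the Zariski-Riemann space\<close>

locale zr_space = field F for F :: "'f ring" (structure) +
  fixes D :: "'f set" and Z :: "'f set set"
  assumes D: "subring D F" and Z: "Z \<subseteq> ZR F D" and FZ: "carrier F \<in> Z"
begin

abbreviation "ZZ \<equiv> ZR_space F D Z"

lemma valuation_Z: "V \<in> Z \<Longrightarrow> valuation_ring_of F V"
  and D_sub_Z: "V \<in> Z \<Longrightarrow> D \<subseteq> V"
  using Z by (auto simp: ZR_def)

lemma subring_Z: "V \<in> Z \<Longrightarrow> subring V F"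
  using valuation_Z by (auto simp: valuation_ring_of_def)

lemma topspace_ZZ [simp]: "lrs_points ZZ = Z"
proof -
  have "ZR F D \<subseteq> topspace (ZR_topology F D)"
    unfolding ZR_topology_def topology_generated_by_topspace
    by (intro subsetI UnionI[where X = "{V \<in> ZR F D. {} \<subseteq> V}"] CollectI exI[of _ "{}"]) auto
  then show ?thesis using Z by (auto simp: ZR_space_def)
qed

lemma openin_ZZ: "openin (lrs_top ZZ) U \<longleftrightarrow> (\<exists>T. openin (ZR_topology F D) T \<and> U = T \<inter> Z)"
  by (simp add: ZR_space_def openin_subtopology)

text \<open>A basic set asks that finitely many elements of \<open>F\<close> belong to
  \<open>V\<close>, and \<open>F\<close> contains them all; hence the point \<open>F\<close> is
  generic.\<close>

lemma ZR_generic: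
  assumes "openin (ZR_topology F D) T" "V \<in> T"
  shows "carrier F \<in> T"
proof -
  have "generate_topology_on {{V \<in> ZR F D. E \<subseteq> V} | E. finite E \<and> E \<subseteq> carrier F} T"
    using assms(1) by (simp add: ZR_topology_def openin_topology_generated_by_iff)
  then show ?thesis using assms(2)
  proof induction
    case (Basis s)
    then show ?case using FZ Z by auto
  qed auto
qed

lemma sections_ZZ: "U \<noteq> {} \<Longrightarrow> lrs_sections ZZ U = F\<lparr>carrier := \<Inter>U\<rparr>"
  by (simp add: ZR_space_def)

lemma restr_ZZ: "V \<noteq> {} \<Longrightarrow> lrs_restr ZZ U V s = s"
  by (simp add: ZR_space_def)

sublocale ffs F ZZ "\<lambda>V. V" "\<lambda>U s. s" "carrier F"
proof unfold_locales
  show "local_subring F V" if "V \<in> lrs_points ZZ" for V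
    using that valuation_local_subring valuation_Z by simp
  show "carrier F \<in> lrs_points ZZ" using FZ by simp
  show "carrier F \<in> U" if "openin (lrs_top ZZ) U" "U \<noteq> {}" for U
    using that ZR_generic FZ by (auto simp: openin_ZZ)
  show "openin (lrs_top ZZ) {V \<in> lrs_points ZZ. y \<in> V}" if "y \<in> carrier F" for y
  proof -
    have "openin (ZR_topology F D) {V \<in> ZR F D. {y} \<subseteq> V}"
      unfolding ZR_topology_def by (rule topology_generated_by_Basis) (use that in blast)
    moreover have "{V \<in> lrs_points ZZ. y \<in> V} = {V \<in> ZR F D. {y} \<subseteq> V} \<inter> Z" using Z by auto
    ultimately show ?thesis unfolding openin_ZZ by blast
  qed
  have sub: "subring (\<Inter>U) F" if "openin (lrs_top ZZ) U" "U \<noteq> {}" for U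
  proof -
    have "U \<subseteq> Z" using openin_subset[OF that(1)] by simp
    then show ?thesis using subring_Inter[of U] subring_Z that(2) by blast
  qed
  fix U :: "'f set set"
  assume U: "openin (lrs_top ZZ) U" "U \<noteq> {}"
  note s = subringE[OF sub[OF U]]
  show "bij_betw (\<lambda>s. s) (carrier (lrs_sections ZZ U)) (\<Inter>V\<in>U. V)"
    using U by (simp add: sections_ZZ bij_betw_def inj_on_def)
  show "\<one>\<^bsub>lrs_sections ZZ U\<^esub> \<in> carrier (lrs_sections ZZ U) \<and> \<one>\<^bsub>lrs_sections ZZ U\<^esub> = \<one>"
    using U s by (simp add: sections_ZZ)
  show "\<zero>\<^bsub>lrs_sections ZZ U\<^esub> \<in> carrier (lrs_sections ZZ U) \<and> \<zero>\<^bsub>lrs_sections ZZ U\<^esub> = \<zero>"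
    using U s by (simp add: sections_ZZ)
  fix x y assume xy: "x \<in> carrier (lrs_sections ZZ U)" "y \<in> carrier (lrs_sections ZZ U)"
  then have xy': "x \<in> \<Inter>U" "y \<in> \<Inter>U" using U by (simp_all add: sections_ZZ)
  show "x \<otimes>\<^bsub>lrs_sections ZZ U\<^esub> y \<in> carrier (lrs_sections ZZ U) \<and> x \<otimes>\<^bsub>lrs_sections ZZ U\<^esub> y = x \<otimes> y"
    using s(6)[OF xy'] U by (simp add: sections_ZZ)
  show "x \<oplus>\<^bsub>lrs_sections ZZ U\<^esub> y \<in> carrier (lrs_sections ZZ U) \<and> x \<oplus>\<^bsub>lrs_sections ZZ U\<^esub> y = x \<oplus> y"
    using s(7)[OF xy'] U by (simp add: sections_ZZ)
next
  fix U V :: "'f set set" and s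
  assume "openin (lrs_top ZZ) U" "openin (lrs_top ZZ) V" "V \<subseteq> U" "V \<noteq> {}" "s \<in> carrier (lrs_sections ZZ U)"
  moreover from this have "U \<noteq> {}" by auto
  ultimately show "lrs_restr ZZ U V s \<in> carrier (lrs_sections ZZ V) \<and> lrs_restr ZZ U V s = s"
    by (auto simp: sections_ZZ restr_ZZ)
next
  show "\<exists>z. carrier (lrs_sections ZZ {}) = {z} \<and> \<one>\<^bsub>lrs_sections ZZ {}\<^esub> = z \<and>
      z \<otimes>\<^bsub>lrs_sections ZZ {}\<^esub> z = z \<and> z \<oplus>\<^bsub>lrs_sections ZZ {}\<^esub> z = z"
    by (simp add: ZR_space_def)
  show "lrs_restr ZZ U {} s \<in> carrier (lrs_sections ZZ {})" for U s
    by (simp add: ZR_space_def)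
qed

end

section \<open>Affine schemes of integral domains\<close>

text \<open>The ring comes with an embedding \<open>j\<close>, so that its elements may have another
  type: the instances are subrings of \<open>F\<close> with the identity, and a copy of
  \<open>\<Inter>Z\<close> in a sum type.\<close>

locale spec_domain = F: field F + R: cring R
  for F :: "('f, 'm) ring_scheme" and R :: "('a, 'n) ring_scheme" (structure) +
  fixes j :: "'a \<Rightarrow> 'f"
  assumes j: "j \<in> ring_hom R F" and j_inj: "inj_on j (carrier R)"
begin

sublocale Y: frac_hom F R "\<lambda>_. carrier R" "zariski_topology R" j
  by (intro frac_hom.intro F.field_axioms frac_data_Spec R.cring_axioms frac_hom_axioms.intro j)

lemma topspace_Spec [simp]: "topspace (zariski_topology R) = {p. primeideal p R}"
  by (rule topspace_zariski[OF R.cring_axioms])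

lemma Q_Spec: "(a, f) \<in> Y.Q p \<longleftrightarrow> a \<in> carrier R \<and> f \<in> carrier R \<and> f \<notin> p"
  by (auto simp: Y.Q_iff)

lemma j_zero: "j \<zero> = \<zero>\<^bsub>F\<^esub>"
proof -
  have "ring_hom_cring R F j" using j by unfold_locales
  then show ?thesis by (rule ring_hom_cring.hom_zero)
qed

lemma j_nonzero: "f \<in> carrier R \<Longrightarrow> f \<noteq> \<zero> \<Longrightarrow> j f \<noteq> \<zero>\<^bsub>F\<^esub>"
  using inj_onD[OF j_inj, of f \<zero>] j_zero by auto

lemma zero_in_prime: "primeideal p R \<Longrightarrow> \<zero> \<in> p"
  using additive_subgroup.zero_closed ideal.axioms(1) primeideal.axioms(1) by blast

lemma j_den: "primeideal p R \<Longrightarrow> f \<in> carrier R \<Longrightarrow> f \<notin> p \<Longrightarrow> j f \<noteq> \<zero>\<^bsub>F\<^esub>"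
  using j_nonzero zero_in_prime by blast

definition loc :: "'a set \<Rightarrow> 'f set" where
  "loc p = {j a \<otimes>\<^bsub>F\<^esub> inv\<^bsub>F\<^esub> j f | a f. a \<in> carrier R \<and> f \<in> carrier R \<and> f \<notin> p}"

lemma j_prime_zero: "primeideal {\<zero>} R"
proof -
  have "domain R"
  proof (rule domain.intro[OF R.cring_axioms], rule domain_axioms.intro)
    show "\<one> \<noteq> \<zero>" using ring_hom_one[OF j] j_zero F.one_not_zero by metis
    fix a b assume ab: "a \<otimes> b = \<zero>" "a \<in> carrier R" "b \<in> carrier R"
    then have "j a \<otimes>\<^bsub>F\<^esub> j b = \<zero>\<^bsub>F\<^esub>" using ring_hom_mult[OF j, of a b] j_zero by simp
    then have "j a = \<zero>\<^bsub>F\<^esub> \<or> j b = \<zero>\<^bsub>F\<^esub>" using F.mult_eq_zero_iff ab Y.e_closed by simp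
    then show "a = \<zero> \<or> b = \<zero>" using j_nonzero ab by blast
  qed
  then show ?thesis by (rule domain.zeroprimeideal)
qed

lemma divide_eq_iff:
  assumes "a \<in> carrier R" "b \<in> carrier R" "f \<in> carrier R" "g \<in> carrier R" "j f \<noteq> \<zero>\<^bsub>F\<^esub>" "j g \<noteq> \<zero>\<^bsub>F\<^esub>"
  shows "j a \<otimes>\<^bsub>F\<^esub> inv\<^bsub>F\<^esub> j f = j b \<otimes>\<^bsub>F\<^esub> inv\<^bsub>F\<^esub> j g \<longleftrightarrow> a \<otimes> g = b \<otimes> f"
proof -
  have "j a \<otimes>\<^bsub>F\<^esub> inv\<^bsub>F\<^esub> j f = j b \<otimes>\<^bsub>F\<^esub> inv\<^bsub>F\<^esub> j g \<longleftrightarrow> j (a \<otimes> g) = j (b \<otimes> f)"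
    using assms by (simp add: F.divide_eq_divide_iff Y.e_closed ring_hom_mult[OF j])
  also have "\<dots> \<longleftrightarrow> a \<otimes> g = b \<otimes> f" using assms inj_on_eq_iff[OF j_inj] by simp
  finally show ?thesis .
qed

lemma locI: "a \<in> carrier R \<Longrightarrow> f \<in> carrier R \<Longrightarrow> f \<notin> p \<Longrightarrow> j a \<otimes>\<^bsub>F\<^esub> inv\<^bsub>F\<^esub> j f \<in> loc p"
  by (auto simp: loc_def)

lemma locE:
  assumes "y \<in> loc p"
  obtains a f where "a \<in> carrier R" "f \<in> carrier R" "f \<notin> p" "y = j a \<otimes>\<^bsub>F\<^esub> inv\<^bsub>F\<^esub> j f"
  using assms by (auto simp: loc_def)

lemma j_in_loc:
  assumes "primeideal p R" "a \<in> carrier R"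
  shows "j a \<in> loc p"
proof -
  have "\<one> \<notin> p" using Y.one_notin[of p] assms by simp
  then have "j a \<otimes>\<^bsub>F\<^esub> inv\<^bsub>F\<^esub> j \<one> \<in> loc p" using assms by (intro locI) auto
  then show ?thesis
    using ring_hom_one[OF j] assms Y.e_closed F.inv_eqI[of "\<one>\<^bsub>F\<^esub>" "\<one>\<^bsub>F\<^esub>"] by simp
qed

context
  fixes p assumes p: "primeideal p R"
begin

lemma p_top: "p \<in> topspace (zariski_topology R)" using p by simp

lemma frac_val_hom_p: "frac_val F j \<in> ring_hom (Y.FR p) F"
  using j_den[OF p] by (intro Y.frac_val_ring_hom[OF p_top]) (auto simp: Y.den_def)

lemma frac_val_frac_p:
  assumes "a \<in> carrier R" "f \<in> carrier R" "f \<notin> p"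
  shows "frac_val F j (Y.frac p a f) = j a \<otimes>\<^bsub>F\<^esub> inv\<^bsub>F\<^esub> j f"
  using j_den[OF p] assms by (intro Y.frac_val_frac[OF p_top]) (auto simp: Y.den_def Q_Spec)

lemma loc_image: "loc p = frac_val F j ` carrier (Y.FR p)"
proof
  show "loc p \<subseteq> frac_val F j ` carrier (Y.FR p)"
  proof
    fix y assume "y \<in> loc p"
    then obtain a f where a: "a \<in> carrier R" "f \<in> carrier R" "f \<notin> p" "y = j a \<otimes>\<^bsub>F\<^esub> inv\<^bsub>F\<^esub> j f"
      by (rule locE)
    then have "y = frac_val F j (Y.frac p a f)" using frac_val_frac_p by simp
    moreover have "Y.frac p a f \<in> carrier (Y.FR p)" using a by (intro Y.frac_closed) (simp add: Q_Spec)
    ultimately show "y \<in> frac_val F j ` carrier (Y.FR p)" by blast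
  qed
  show "frac_val F j ` carrier (Y.FR p) \<subseteq> loc p"
  proof
    fix y assume "y \<in> frac_val F j ` carrier (Y.FR p)"
    then obtain c where c: "c \<in> carrier (Y.FR p)" "y = frac_val F j c" by blast
    obtain a f where "(a, f) \<in> Y.Q p" "c = Y.frac p a f" using Y.FR_cases[OF c(1)] .
    then show "y \<in> loc p" using c frac_val_frac_p locI by (simp add: Q_Spec)
  qed
qed

lemma subring_loc: "subring (loc p) F"
proof -
  interpret hom: ring_hom_ring "Y.FR p" F "frac_val F j"
    using Y.FR_cring[OF p_top] F.ring_axioms frac_val_hom_p
    by (auto simp: ring_hom_ring_def ring_hom_ring_axioms_def cring_def)
  show ?thesis
    unfolding loc_image by (rule hom.img_is_subring[OF ring.carrier_is_subring[OF hom.R.ring_axioms]])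
qed

lemma nonunits_loc_iff:
  assumes "a \<in> carrier R" "f \<in> carrier R" "f \<notin> p"
  shows "j a \<otimes>\<^bsub>F\<^esub> inv\<^bsub>F\<^esub> j f \<in> nonunits F (loc p) \<longleftrightarrow> a \<in> p"
proof -
  interpret p: primeideal p R by (rule p)
  have nf: "j f \<noteq> \<zero>\<^bsub>F\<^esub>" using j_den[OF p] assms by blast
  have y: "j a \<otimes>\<^bsub>F\<^esub> inv\<^bsub>F\<^esub> j f \<in> loc p" using assms by (rule locI)
  have c: "j a \<in> carrier F" "j f \<in> carrier F" using assms Y.e_closed by auto
  have inv: "inv\<^bsub>F\<^esub> (j a \<otimes>\<^bsub>F\<^esub> inv\<^bsub>F\<^esub> j f) = j f \<otimes>\<^bsub>F\<^esub> inv\<^bsub>F\<^esub> j a" if "j a \<noteq> \<zero>\<^bsub>F\<^esub>"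
    using that nf c by (simp add: F.inv_mult F.m_comm)
  show ?thesis
  proof
    assume n: "j a \<otimes>\<^bsub>F\<^esub> inv\<^bsub>F\<^esub> j f \<in> nonunits F (loc p)"
    show "a \<in> p"
    proof (rule ccontr)
      assume a: "a \<notin> p"
      then have na: "j a \<noteq> \<zero>\<^bsub>F\<^esub>" using j_den[OF p] assms by blast
      have "inv\<^bsub>F\<^esub> (j a \<otimes>\<^bsub>F\<^esub> inv\<^bsub>F\<^esub> j f) \<in> loc p" using inv[OF na] locI assms a by simp
      moreover have "j a \<otimes>\<^bsub>F\<^esub> inv\<^bsub>F\<^esub> j f \<noteq> \<zero>\<^bsub>F\<^esub>" using na nf c by (simp add: F.mult_eq_zero_iff)
      ultimately show False using n by (simp add: nonunits_def)
    qed
  next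
    assume a: "a \<in> p"
    have "inv\<^bsub>F\<^esub> (j a \<otimes>\<^bsub>F\<^esub> inv\<^bsub>F\<^esub> j f) \<notin> loc p" if nz: "j a \<otimes>\<^bsub>F\<^esub> inv\<^bsub>F\<^esub> j f \<noteq> \<zero>\<^bsub>F\<^esub>"
    proof
      have na: "j a \<noteq> \<zero>\<^bsub>F\<^esub>" using nz nf c by auto
      assume "inv\<^bsub>F\<^esub> (j a \<otimes>\<^bsub>F\<^esub> inv\<^bsub>F\<^esub> j f) \<in> loc p"
      then obtain b g where b: "b \<in> carrier R" "g \<in> carrier R" "g \<notin> p"
        "j f \<otimes>\<^bsub>F\<^esub> inv\<^bsub>F\<^esub> j a = j b \<otimes>\<^bsub>F\<^esub> inv\<^bsub>F\<^esub> j g"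
        unfolding inv[OF na] by (rule locE)
      \<comment> \<open>If the inverse were also a fraction \<open>b/g\<close> with \<open>g\<close>
        outside \<open>p\<close>, then \<open>f g = b a\<close> would lie in \<open>p\<close>,
        against primality.\<close>
      then have "f \<otimes> g = b \<otimes> a" using divide_eq_iff[of f b a g] assms na j_den[OF p, of g] by simp
      then have "f \<otimes> g \<in> p" using a b p.I_l_closed by simp
      then show False using p.I_prime assms b by blast
    qed
    then show "j a \<otimes>\<^bsub>F\<^esub> inv\<^bsub>F\<^esub> j f \<in> nonunits F (loc p)" using y by (auto simp: nonunits_def)
  qed
qed

lemma local_loc: "local_subring F (loc p)"
  unfolding local_subring_def
proof (intro conjI ballI subring_loc)
  interpret p: primeideal p R by (rule p)
  fix y z assume yz: "y \<in> nonunits F (loc p)" "z \<in> nonunits F (loc p)"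
  have "y \<in> loc p" "z \<in> loc p" using yz by (auto simp: nonunits_def)
  obtain a f where a: "a \<in> carrier R" "f \<in> carrier R" "f \<notin> p" "y = j a \<otimes>\<^bsub>F\<^esub> inv\<^bsub>F\<^esub> j f"
    using locE[OF \<open>y \<in> loc p\<close>] .
  obtain b g where b: "b \<in> carrier R" "g \<in> carrier R" "g \<notin> p" "z = j b \<otimes>\<^bsub>F\<^esub> inv\<^bsub>F\<^esub> j g"
    using locE[OF \<open>z \<in> loc p\<close>] .
  have ab: "a \<in> p" "b \<in> p" using yz a b nonunits_loc_iff by auto
  have q: "(a, f) \<in> Y.Q p" "(b, g) \<in> Y.Q p" using a b by (auto simp: Q_Spec)
  have fg: "f \<otimes> g \<notin> p" using p.I_prime a b by blast
  have "y \<oplus>\<^bsub>F\<^esub> z = frac_val F j (Y.frac p a f \<oplus>\<^bsub>Y.FR p\<^esub> Y.frac p b g)"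
    using ring_hom_add[OF frac_val_hom_p Y.frac_closed[OF q(1)] Y.frac_closed[OF q(2)]] a b
    by (simp add: frac_val_frac_p)
  also have "\<dots> = j (a \<otimes> g \<oplus> b \<otimes> f) \<otimes>\<^bsub>F\<^esub> inv\<^bsub>F\<^esub> j (f \<otimes> g)"
    using a b fg by (simp add: Y.FR_add[OF p_top q] frac_val_frac_p)
  finally have eq: "y \<oplus>\<^bsub>F\<^esub> z = j (a \<otimes> g \<oplus> b \<otimes> f) \<otimes>\<^bsub>F\<^esub> inv\<^bsub>F\<^esub> j (f \<otimes> g)" .
  have "a \<otimes> g \<oplus> b \<otimes> f \<in> p" using ab a b p.I_r_closed p.a_closed by simp
  then show "y \<oplus>\<^bsub>F\<^esub> z \<in> nonunits F (loc p)"
    unfolding eq using nonunits_loc_iff[of "a \<otimes> g \<oplus> b \<otimes> f" "f \<otimes> g"] fg a b by simp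
qed

end

lemma generic_zero: "openin (zariski_topology R) U \<Longrightarrow> U \<noteq> {} \<Longrightarrow> {\<zero>} \<in> U"
proof -
  assume U: "openin (zariski_topology R) U" "U \<noteq> {}"
  then obtain p where p: "p \<in> U" by blast
  then have "primeideal p R" using openin_subset[OF U(1)] by auto
  then show ?thesis
    using zariski_generization[OF U(1) p j_prime_zero] zero_in_prime by blast
qed

text \<open>The zero ideal is the generic point; by \<open>sval_at\<close> the section has the same
  value at every point of \<open>U\<close>.\<close>

definition sval :: "'a set set \<Rightarrow> ('a set \<Rightarrow> ('a \<times> 'a) set) \<Rightarrow> 'f" where
  "sval U s = frac_val F j (s {\<zero>})"

lemma sval_at:
  assumes U: "openin (zariski_topology R) U" and s: "s \<in> carrier (Y.OX U)" and p: "p \<in> U"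
  shows "frac_val F j (s p) = sval U s"
proof -
  obtain W a f where W: "openin (zariski_topology R) W" "p \<in> W" "W \<subseteq> U" "\<And>q. q \<in> W \<Longrightarrow> (a, f) \<in> Y.Q q"
    "\<And>q. q \<in> W \<Longrightarrow> s q = Y.frac q a f"
    using Y.section_local[OF s p] by metis
  have z: "{\<zero>} \<in> W" using generic_zero[OF W(1)] W(2) by blast
  have "primeideal p R" using openin_subset[OF W(1)] W(2) by auto
  then show ?thesis
    using W(4)[OF W(2)] W(4)[OF z] W(5)[OF W(2)] W(5)[OF z] frac_val_frac_p j_prime_zero
    by (simp add: sval_def Q_Spec)
qed

lemma frac_val_inj:
  assumes p: "primeideal p R" and "c \<in> carrier (Y.FR p)" "d \<in> carrier (Y.FR p)"
    and eq: "frac_val F j c = frac_val F j d"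
  shows "c = d"
proof -
  obtain a f where a: "(a, f) \<in> Y.Q p" "c = Y.frac p a f" using Y.FR_cases[OF assms(2)] .
  obtain b g where b: "(b, g) \<in> Y.Q p" "d = Y.frac p b g" using Y.FR_cases[OF assms(3)] .
  have "a \<otimes> g = b \<otimes> f"
    using eq a b j_den[OF p] by (simp add: frac_val_frac_p[OF p] Q_Spec divide_eq_iff)
  then show ?thesis using Y.frac_eqI[OF p_top[OF p] a(1) b(1)] a b by simp
qed

lemma Spec_XX: "Spec R = Y.XX"
  by (rule Spec_eq)

text \<open>A fraction is determined by its value because \<open>j\<close> is injective. For
  surjectivity an element of all local rings is written as a fraction at each \<open>p\<close>
  separately; the choices glue, since wherever \<open>B p\<close> is still a denominator the
  fractions chosen at \<open>p\<close> and at \<open>q\<close> have the same value.\<close>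

lemma sval_bij:
  assumes U: "openin (zariski_topology R) U" "U \<noteq> {}"
  shows "bij_betw (sval U) (carrier (Y.OX U)) (\<Inter>p\<in>U. loc p)"
  unfolding bij_betw_def
proof
  have prime: "primeideal p R" if "p \<in> U" for p using openin_subset[OF U(1)] that by auto
  show "inj_on (sval U) (carrier (Y.OX U))"
  proof (rule inj_onI)
    fix s t assume s: "s \<in> carrier (Y.OX U)" and t: "t \<in> carrier (Y.OX U)" and eq: "sval U s = sval U t"
    show "s = t"
    proof (rule extensionalityI[OF Y.section_extensional[OF s] Y.section_extensional[OF t]])
      fix p assume p: "p \<in> U"
      show "s p = t p"
        using frac_val_inj[OF prime[OF p] Y.section_value_closed[OF s p] Y.section_value_closed[OF t p]]
          sval_at[OF U(1) s p] sval_at[OF U(1) t p] eq by simp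
    qed
  qed
  show "sval U ` carrier (Y.OX U) = (\<Inter>p\<in>U. loc p)"
  proof (intro equalityI subsetI)
    fix y assume "y \<in> sval U ` carrier (Y.OX U)"
    then obtain s where s: "s \<in> carrier (Y.OX U)" "y = sval U s" by blast
    then have "y = frac_val F j (s p)" if "p \<in> U" for p using sval_at[OF U(1) s(1) that] by simp
    then show "y \<in> (\<Inter>p\<in>U. loc p)"
      using Y.section_value_closed[OF s(1)] loc_image[OF prime] by blast
  next
    fix y assume y: "y \<in> (\<Inter>p\<in>U. loc p)"
    have "\<exists>a f. a \<in> carrier R \<and> f \<in> carrier R \<and> f \<notin> p \<and> y = j a \<otimes>\<^bsub>F\<^esub> inv\<^bsub>F\<^esub> j f" if "p \<in> U" for p
    proof -
      have "y \<in> loc p" using y that by blast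
      then show ?thesis by (rule locE) blast
    qed
    then obtain A B where AB: "\<And>p. p \<in> U \<Longrightarrow> A p \<in> carrier R \<and> B p \<in> carrier R \<and> B p \<notin> p \<and>
        y = j (A p) \<otimes>\<^bsub>F\<^esub> inv\<^bsub>F\<^esub> j (B p)" by metis
    let ?s = "\<lambda>p\<in>U. Y.frac p (A p) (B p)"
    have closed: "?s \<in> carrier (Y.OX U)"
    proof (rule Y.sectionI)
      fix p assume p: "p \<in> U"
      let ?W = "{q. primeideal q R \<and> B p \<notin> q} \<inter> U"
      have "(A p, B p) \<in> Y.Q q \<and> ?s q = Y.frac q (A p) (B p)" if q: "q \<in> ?W" for q
      proof
        have q': "primeideal q R" "B p \<notin> q" "q \<in> U" using q by auto
        show Q: "(A p, B p) \<in> Y.Q q" using AB[OF p] q' by (simp add: Q_Spec)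
        have "(A q, B q) \<in> Y.Q q" using AB[OF q'(3)] by (simp add: Q_Spec)
        moreover have "A q \<otimes> B p = A p \<otimes> B q"
          using AB[OF p] AB[OF q'(3)] divide_eq_iff[of "A q" "A p" "B q" "B p"] j_den[OF q'(1)] q' by simp
        ultimately show "?s q = Y.frac q (A p) (B p)"
          using Y.frac_eqI[OF p_top[OF q'(1)] _ Q] q'(3) by simp
      qed
      moreover have "openin (zariski_topology R) ?W"
        using openin_zariski_basic AB[OF p] U(1) by (intro openin_Int) auto
      moreover have "p \<in> ?W" using p AB[OF p] prime[OF p] by simp
      ultimately show "\<exists>W a f. openin (zariski_topology R) W \<and> p \<in> W \<and> W \<subseteq> U \<and>
          (\<forall>q\<in>W. (a, f) \<in> Y.Q q \<and> ?s q = Y.frac q a f)"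
        by (intro exI[of _ ?W] exI[of _ "A p"] exI[of _ "B p"]) auto
    qed simp
    have "sval U ?s = y"
      using generic_zero[OF U] AB[OF generic_zero[OF U]]
      by (simp add: sval_def frac_val_frac_p[OF j_prime_zero])
    then show "y \<in> sval U ` carrier (Y.OX U)"
      using closed by (intro image_eqI[where x = ?s]) (rule sym)
  qed
qed

sublocale X: ffs F "Spec R" loc sval "{\<zero>}"
proof (unfold_locales; unfold Spec_XX Y.XX_simps)
  show "local_subring F (loc p)" if "p \<in> topspace (zariski_topology R)" for p
    using that local_loc by simp
  show "{\<zero>} \<in> topspace (zariski_topology R)" using j_prime_zero by simp
  show "{\<zero>} \<in> U" if "openin (zariski_topology R) U" "U \<noteq> {}" for U
    using generic_zero[OF that] .
  show "openin (zariski_topology R) {p \<in> topspace (zariski_topology R). y \<in> loc p}" if "y \<in> carrier F" for y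
  proof (subst openin_subopen, intro ballI)
    fix p assume "p \<in> {p \<in> topspace (zariski_topology R). y \<in> loc p}"
    then have p: "primeideal p R" "y \<in> loc p" by auto
    obtain a f where a: "a \<in> carrier R" "f \<in> carrier R" "f \<notin> p" "y = j a \<otimes>\<^bsub>F\<^esub> inv\<^bsub>F\<^esub> j f"
      using locE[OF p(2)] .
    then show "\<exists>W. openin (zariski_topology R) W \<and> p \<in> W \<and>
        W \<subseteq> {p \<in> topspace (zariski_topology R). y \<in> loc p}"
      using openin_zariski_basic[OF a(2)] p locI
      by (intro exI[of _ "{q. primeideal q R \<and> f \<notin> q}"]) auto
  qed
  fix U assume U: "openin (zariski_topology R) U" "U \<noteq> {}"
  note z = generic_zero[OF U]
  note hom = frac_val_hom_p[OF j_prime_zero]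
  have U': "q \<in> topspace (zariski_topology R)" if "q \<in> U" for q using openin_subset[OF U(1)] that by blast
  show "bij_betw (sval U) (carrier (Y.OX U)) (\<Inter>p\<in>U. loc p)" by (rule sval_bij[OF U])
  show "\<one>\<^bsub>Y.OX U\<^esub> \<in> carrier (Y.OX U) \<and> sval U \<one>\<^bsub>Y.OX U\<^esub> = \<one>\<^bsub>F\<^esub>"
    using Y.sec_closed[OF U(1) Y.Q_one[OF U']] ring_hom_one[OF hom] z
    by (simp add: Y.OX_one sval_def Y.FR_one)
  show "\<zero>\<^bsub>Y.OX U\<^esub> \<in> carrier (Y.OX U) \<and> sval U \<zero>\<^bsub>Y.OX U\<^esub> = \<zero>\<^bsub>F\<^esub>"
    using Y.sec_closed[OF U(1) Y.Q_zero[OF U']] z j_zero frac_val_frac_p[OF j_prime_zero, of "\<zero>" "\<one>"]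
      Y.one_notin[OF U'[OF z]] ring_hom_one[OF j] F.inv_eqI[of "\<one>\<^bsub>F\<^esub>" "\<one>\<^bsub>F\<^esub>"]
    by (simp add: Y.OX_zero sval_def)
  fix s t assume s: "s \<in> carrier (Y.OX U)" and t: "t \<in> carrier (Y.OX U)"
  show "s \<otimes>\<^bsub>Y.OX U\<^esub> t \<in> carrier (Y.OX U) \<and> sval U (s \<otimes>\<^bsub>Y.OX U\<^esub> t) = sval U s \<otimes>\<^bsub>F\<^esub> sval U t"
    using Y.OX_mult_closed[OF s t] z
      ring_hom_mult[OF hom Y.section_value_closed[OF s z] Y.section_value_closed[OF t z]]
    by (simp add: sval_def) (simp add: Y.OX_mult)
  show "s \<oplus>\<^bsub>Y.OX U\<^esub> t \<in> carrier (Y.OX U) \<and> sval U (s \<oplus>\<^bsub>Y.OX U\<^esub> t) = sval U s \<oplus>\<^bsub>F\<^esub> sval U t"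
    using Y.OX_add_closed[OF s t] z
      ring_hom_add[OF hom Y.section_value_closed[OF s z] Y.section_value_closed[OF t z]]
    by (simp add: sval_def) (simp add: Y.OX_add)
next
  fix U V s
  assume *: "openin (zariski_topology R) U" "openin (zariski_topology R) V" "V \<subseteq> U" "V \<noteq> {}"
    "s \<in> carrier (Y.OX U)"
  show "restrict s V \<in> carrier (Y.OX V) \<and> sval V (restrict s V) = sval U s"
    using Y.restrict_closed[OF *(2,3,5)] generic_zero[OF *(2,4)] by (simp add: sval_def)
next
  \<comment> \<open>Over the empty set the only section is the function that is undefined
    everywhere, and all operations return it.\<close>
  have "Y.OX {} = \<lparr>carrier = {\<lambda>_. undefined}, monoid.mult = (\<lambda>_ _. \<lambda>_. undefined), one = (\<lambda>_. undefined),
      zero = (\<lambda>_. undefined), add = (\<lambda>_ _. \<lambda>_. undefined)\<rparr>"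
    by (simp add: frac_sections_def restrict_def)
  then show "\<exists>z. carrier (Y.OX {}) = {z} \<and> \<one>\<^bsub>Y.OX {}\<^esub> = z \<and>
      z \<otimes>\<^bsub>Y.OX {}\<^esub> z = z \<and> z \<oplus>\<^bsub>Y.OX {}\<^esub> z = z" by simp
  show "restrict s {} \<in> carrier (Y.OX {})" if "openin (zariski_topology R) U" "s \<in> carrier (Y.OX U)" for U s
    using Y.restrict_closed[OF openin_empty _ that(2)] by simp
qed

end

section \<open>The structure morphism of the projective line\<close>

context spec_domain
begin

text \<open>Evaluates the definite description in \<open>ZR_structure_map\<close>. All
  representatives satisfy the equation because their values agree; a single representative at the
  zero ideal, with nonzero denominator, forces the solution.\<close>

lemma section_value_unique:
  assumes U: "openin (zariski_topology R) U" "U \<noteq> {}" and s: "s \<in> carrier (Y.OX U)"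
  shows "(THE x. x \<in> carrier F \<and> (\<forall>p\<in>U. \<forall>(a, f)\<in>s p. j a = j f \<otimes>\<^bsub>F\<^esub> x)) = sval U s"
proof (rule the_equality)
  have prime: "primeideal p R" if "p \<in> U" for p using openin_subset[OF U(1)] that by auto
  note z = generic_zero[OF U]
  have rep: "j f \<noteq> \<zero>\<^bsub>F\<^esub> \<and> j a \<in> carrier F \<and> j f \<in> carrier F \<and> sval U s = j a \<otimes>\<^bsub>F\<^esub> inv\<^bsub>F\<^esub> j f"
    if p: "p \<in> U" and af: "(a, f) \<in> s p" for p a f
  proof -
    obtain b g where b: "(b, g) \<in> Y.Q p" "s p = Y.frac p b g"
      using Y.FR_cases[OF Y.section_value_closed[OF s p]] .
    have q: "(a, f) \<in> Y.Q p" "s p = Y.frac p a f"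
      using Y.mem_frac[OF p_top[OF prime[OF p]], of a f b g] af b by auto
    then show ?thesis
      using sval_at[OF U(1) s p] frac_val_frac_p[OF prime[OF p], of a f] j_den[OF prime[OF p], of f]
      by (simp add: Q_Spec Y.e_closed)
  qed
  have sv: "sval U s \<in> carrier F"
  proof -
    have "sval U s \<in> loc {\<zero>}" using X.val_in_L[of U "{\<zero>}" s] U(1) z s by (simp add: Spec_XX)
    then show ?thesis using subringE(1)[OF subring_loc[OF j_prime_zero]] by blast
  qed
  have "j a = j f \<otimes>\<^bsub>F\<^esub> sval U s" if "p \<in> U" "(a, f) \<in> s p" for p a f
    using rep[OF that] F.eq_divide_iff[of "j a" "j f" "sval U s"] sv F.m_comm by simp
  then show "sval U s \<in> carrier F \<and> (\<forall>p\<in>U. \<forall>(a, f)\<in>s p. j a = j f \<otimes>\<^bsub>F\<^esub> sval U s)"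
    using sv by blast
  fix x assume x: "x \<in> carrier F \<and> (\<forall>p\<in>U. \<forall>(a, f)\<in>s p. j a = j f \<otimes>\<^bsub>F\<^esub> x)"
  obtain a f where a: "(a, f) \<in> Y.Q {\<zero>}" "s {\<zero>} = Y.frac {\<zero>} a f"
    using Y.FR_cases[OF Y.section_value_closed[OF s z]] .
  have af: "(a, f) \<in> s {\<zero>}" using a Y.frac_self[OF p_top[OF j_prime_zero] a(1)] by simp
  then have "j a = j f \<otimes>\<^bsub>F\<^esub> x" using x z by blast
  then show "x = sval U s"
    using rep[OF z af] x F.eq_divide_iff[of "j a" "j f" x] F.m_comm[of "j f" x] by simp
qed

end

section \<open>The structure morphism of the projective line on points and on fractions\<close>

context proj_field
begin

abbreviation "RD \<equiv> F\<lparr>carrier := D\<rparr>"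
abbreviation "\<pi> \<equiv> Proj_line_structure_map RD"

lemma spec_D: "spec_domain F RD (\<lambda>a. a)"
  by (intro spec_domain.intro field_axioms subring_cring D spec_domain_axioms.intro incl_hom) simp

sublocale SD: spec_domain F RD "\<lambda>a. a"
  by (rule spec_D)

lemma const_hom: "const \<in> ring_hom RD S"
  by (rule pl.const_hom)

definition pi_pt :: "(nat \<Rightarrow> nat \<Rightarrow> 'f) set \<Rightarrow> 'f set" where
  "pi_pt q = {a \<in> D. const a \<in> q}"

definition pi_pre :: "'f set set \<Rightarrow> (nat \<Rightarrow> nat \<Rightarrow> 'f) set set" where
  "pi_pre U = {q \<in> Proj_points S G. pi_pt q \<in> U}"

lemma lrs_pt_pi: "lrs_pt \<pi> q = pi_pt q"
  by (simp add: Proj_line_structure_map_def Proj_structure_map_def pi_pt_def)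

lemma lrs_pre_pi: "lrs_pre (Proj_line RD) \<pi> U = pi_pre U"
  by (simp add: lrs_pre_def pi_pre_def lrs_pt_pi pl.Proj_line_eq)

lemma lrs_comorph_pi:
  "lrs_comorph \<pi> U s = (\<lambda>q\<in>pi_pre U. \<Union>(a, f)\<in>s (pi_pt q). pl.proj.frac q (const a) (const f))"
  by (simp add: Proj_line_structure_map_def Proj_structure_map_def pi_pt_def pi_pre_def)

lemma prime_pi_pt:
  assumes "q \<in> Proj_points S G"
  shows "primeideal (pi_pt q) RD"
proof -
  have q: "primeideal q S" using assms by (simp add: Proj_points_def)
  have "ring_hom_ring RD S const"
    using const_hom pl.R0.ring_axioms pl.S.P.ring_axioms by (simp add: ring_hom_ring_def ring_hom_ring_axioms_def)
  then have "primeideal {a \<in> carrier RD. const a \<in> q} RD"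
    by (rule ring_hom_ring.primeideal_vimage[OF _ pl.R0.cring_axioms q])
  then show ?thesis by (simp add: pi_pt_def)
qed

lemma continuous_pi: "continuous_map pl.proj_top (zariski_topology RD) pi_pt"
  unfolding zariski_topology_def
proof (rule continuous_on_generated_topo)
  have "pi_pt q \<in> topspace (zariski_topology RD)" if "q \<in> Proj_points S G" for q
    using prime_pi_pt[OF that] by simp
  then show "pi_pt ` topspace pl.proj_top \<subseteq> \<Union> ((\<lambda>f. {p. primeideal p RD \<and> f \<notin> p}) ` carrier RD)"
    unfolding zariski_topology_def topology_generated_by_topspace by auto
  fix U assume "U \<in> (\<lambda>f. {p. primeideal p RD \<and> f \<notin> p}) ` carrier RD"
  then obtain f where f: "f \<in> D" "U = {p. primeideal p RD \<and> f \<notin> p}" by auto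
  have "pi_pt -` U \<inter> topspace pl.proj_top = {q \<in> Proj_points S G. const f \<notin> q}"
    using f prime_pi_pt by (auto simp: pi_pt_def)
  then show "openin pl.proj_top (pi_pt -` U \<inter> topspace pl.proj_top)"
    using pl.openin_proj_basic[OF pl.const_closed] f by simp
qed

lemma open_pi_pre:
  assumes "openin (zariski_topology RD) U"
  shows "openin pl.proj_top (pi_pre U)"
  using openin_continuous_map_preimage[OF continuous_pi assms] by (simp add: pi_pre_def)

lemma Q_const:
  assumes "(a, f) \<in> SD.Y.Q (pi_pt q)"
  shows "(const a, const f) \<in> pl.proj.Q q"
proof -
  have "a \<in> carrier RD" "f \<in> carrier RD" "f \<notin> pi_pt q"
    using assms unfolding SD.Q_Spec by blast+
  then show ?thesis using pl.G_const[of a] pl.G_const[of f] by (auto simp: pl.proj.Q_iff pi_pt_def)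
qed

text \<open>A witness \<open>u\<close> outside the contracted prime becomes \<open>const u\<close>,
  a form of degree zero outside \<open>q\<close>, so the union in \<open>Proj_structure_map\<close>
  is independent of the representative.\<close>

lemma pi_value:
  assumes s: "s \<in> carrier (SD.Y.OX U)" and q: "q \<in> pi_pre U"
    and af: "(a, f) \<in> SD.Y.Q (pi_pt q)" "s (pi_pt q) = SD.Y.frac (pi_pt q) a f"
  shows "lrs_comorph \<pi> U s q = pl.proj.frac q (const a) (const f)"
proof -
  have q': "q \<in> Proj_points S G" "pi_pt q \<in> U" using q by (auto simp: pi_pre_def)
  note p = SD.p_top[OF prime_pi_pt[OF q'(1)]]
  have qt: "q \<in> topspace pl.proj_top" using q' by simp
  have "(\<Union>(b, g)\<in>SD.Y.frac (pi_pt q) a f. pl.proj.frac q (const b) (const g)) =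
      pl.proj.frac q (const a) (const f)"
  proof (rule SD.Y.UN_frac[OF p af(1)])
    fix b g assume b: "(b, g) \<in> SD.Y.Q (pi_pt q)" "SD.Y.frac (pi_pt q) b g = SD.Y.frac (pi_pt q) a f"
    note c = SD.Y.QD[OF b(1)] SD.Y.QD[OF af(1)]
    obtain u where u: "u \<in> SD.Y.den (pi_pt q)" "u \<otimes>\<^bsub>RD\<^esub> (b \<otimes>\<^bsub>RD\<^esub> f) = u \<otimes>\<^bsub>RD\<^esub> (a \<otimes>\<^bsub>RD\<^esub> g)"
      using b(2) SD.Y.frac_eq_iff[OF p b(1) af(1)] by auto
    have uD: "u \<in> carrier RD" "u \<notin> pi_pt q" using u(1) unfolding SD.Y.den_def by blast+
    have "const u \<in> pl.proj.den q"
      using pl.G_const[OF uD(1)] uD by (auto simp: pl.proj.den_def pi_pt_def)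
    moreover have "const u \<otimes>\<^bsub>S\<^esub> (const b \<otimes>\<^bsub>S\<^esub> const f) = const u \<otimes>\<^bsub>S\<^esub> (const a \<otimes>\<^bsub>S\<^esub> const g)"
    proof -
      have m: "x \<otimes>\<^bsub>RD\<^esub> y \<in> carrier RD" if "x \<in> carrier RD" "y \<in> carrier RD" for x y
        using that pl.R0.m_closed by blast
      have "const u \<otimes>\<^bsub>S\<^esub> (const b \<otimes>\<^bsub>S\<^esub> const f) = const (u \<otimes>\<^bsub>RD\<^esub> (b \<otimes>\<^bsub>RD\<^esub> f))"
        using c uD m by (simp only: ring_hom_mult[OF const_hom])
      also have "\<dots> = const u \<otimes>\<^bsub>S\<^esub> (const a \<otimes>\<^bsub>S\<^esub> const g)"
        unfolding u(2) using c uD m by (simp only: ring_hom_mult[OF const_hom])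
      finally show ?thesis .
    qed
    ultimately show "(case (b, g) of (b, g) \<Rightarrow> pl.proj.frac q (const b) (const g)) =
        pl.proj.frac q (const a) (const f)"
      using pl.proj.frac_eq_iff[OF qt Q_const[OF b(1)] Q_const[OF af(1)]] by auto
  qed
  then show ?thesis using q by (simp add: lrs_comorph_pi af(2))
qed

lemma pi_closed:
  assumes U: "openin (zariski_topology RD) U" and s: "s \<in> carrier (SD.Y.OX U)"
  shows "lrs_comorph \<pi> U s \<in> carrier (pl.proj.OX (pi_pre U))"
proof (rule pl.proj.sectionI)
  show "lrs_comorph \<pi> U s \<in> extensional (pi_pre U)" by (simp add: lrs_comorph_pi)
  fix q assume q: "q \<in> pi_pre U"
  then have q': "q \<in> Proj_points S G" "pi_pt q \<in> U" by (auto simp: pi_pre_def)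
  obtain W a f where W: "openin (zariski_topology RD) W" "pi_pt q \<in> W" "W \<subseteq> U"
    "\<And>p. p \<in> W \<Longrightarrow> (a, f) \<in> SD.Y.Q p" "\<And>p. p \<in> W \<Longrightarrow> s p = SD.Y.frac p a f"
    using SD.Y.section_local[OF s q'(2)] by metis
  have "(const a, const f) \<in> pl.proj.Q r \<and> lrs_comorph \<pi> U s r = pl.proj.frac r (const a) (const f)"
    if r: "r \<in> pi_pre W" for r
  proof -
    have r': "pi_pt r \<in> W" "r \<in> pi_pre U" using r W(3) by (auto simp: pi_pre_def)
    then show ?thesis using Q_const[OF W(4)] pi_value[OF s r'(2) W(4) W(5)] by blast
  qed
  then show "\<exists>W a f. openin pl.proj_top W \<and> q \<in> W \<and> W \<subseteq> pi_pre U \<and>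
      (\<forall>r\<in>W. (a, f) \<in> pl.proj.Q r \<and> lrs_comorph \<pi> U s r = pl.proj.frac r a f)"
    using open_pi_pre[OF W(1)] W(2,3) q'
    by (intro exI[of _ "pi_pre W"] exI[of _ "const a"] exI[of _ "const f"]) (auto simp: pi_pre_def)
qed

end

section \<open>Factorization through an affine scheme\<close>

text \<open>If a coordinate is zero, the other one is the denominator and the ratios are zero and
  one; otherwise the valuation property is applied to the quotient of the two.\<close>

lemma (in field) valuation_ratio:
  fixes t :: "bool \<Rightarrow> 'a"
  assumes V: "valuation_ring_of R V" and tc: "\<And>k. t k \<in> carrier R" and nz: "\<exists>k. t k \<noteq> \<zero>"
  shows "\<exists>k. t k \<noteq> \<zero> \<and> (\<forall>j. t j \<otimes> inv t k \<in> V)"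
proof -
  have "subring V R" using V by (simp add: valuation_ring_of_def)
  note s = subringE[OF this]
  show ?thesis
  proof (cases "t True = \<zero> \<or> t False = \<zero>")
    case True
    obtain k where k: "t k \<noteq> \<zero>" using nz by blast
    then have "t j \<otimes> inv t k \<in> V" for j
      using True s tc by (cases j; cases k) auto
    then show ?thesis using k by blast
  next
    case False
    let ?x = "t True \<otimes> inv t False"
    have x: "?x \<in> carrier R" "?x \<noteq> \<zero>" using False tc by (auto simp: mult_eq_zero_iff)
    have i: "inv ?x = t False \<otimes> inv t True" using False tc by (simp add: inv_mult m_comm)
    have "?x \<in> V \<or> inv ?x \<in> V" using V x by (simp add: valuation_ring_of_def)
    then show ?thesis
    proof
      assume "?x \<in> V"
      then have "t j \<otimes> inv t False \<in> V" for j using False s tc by (cases j) auto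
      then show ?thesis using False by blast
    next
      assume "inv ?x \<in> V"
      then have "t j \<otimes> inv t True \<in> V" for j using False s tc by (cases j) (auto simp: i)
      then show ?thesis using False by blast
    qed
  qed
qed

locale zr_proj = zr_space F D Z for F :: "'f ring" (structure) and D and Z
begin

sublocale proj_field F D
  by (rule proj_field.intro[OF field_axioms proj_field_axioms.intro[OF D]])

lemma nonunits_carrier: "nonunits F (carrier F) = {\<zero>}"
  using inv_closed unfolding nonunits_def by blast

lemma center_eq: "V \<in> Z \<Longrightarrow> center F D V = D \<inter> nonunits F V"
  using the_maximal_ideal_eq[OF ffs_local] by (simp add: center_def)

lemma center_F: "center F D (carrier F) = {\<zero>}"
  using center_eq[OF FZ] subringE(2)[OF D] by (auto simp: nonunits_carrier)

end

locale zr_proj_mor = zr_proj F D Z for F :: "'f ring" (structure) and D and Z +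
  fixes t :: "bool \<Rightarrow> 'f"
  assumes tc: "t k \<in> carrier F" and tr: "\<exists>k. t k \<noteq> \<zero>"
begin

sublocale PM: proj_mor F D ZZ "\<lambda>V. V" "\<lambda>U s. s" "carrier F" t
  by unfold_locales (use D_sub_Z tc valuation_ratio[OF valuation_Z tc tr] in auto)

text \<open>A constant has itself as value in every chart, so the image of \<open>V\<close>
  contracts to the center of \<open>V\<close>. On sections both sides are elements of
  \<open>F\<close>, read off at the point \<open>F\<close> from one fraction over
  \<open>D\<close>.\<close>

lemma mor_over: "lrs_morphism_over (Spec RD) ZZ (ZR_structure_map F D) (Proj_line RD) \<pi> PM.M.mor"
  unfolding lrs_morphism_over_def
proof
  show "lrs_morphism ZZ (Proj_line RD) PM.M.mor"
    using PM.M.mor_morphism by (simp add: pl.Proj_line_eq)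
  show "lrs_map_eq ZZ (Spec RD) (lrs_comp (Proj_line RD) \<pi> PM.M.mor) (ZR_structure_map F D)"
    unfolding lrs_map_eq_def
  proof (intro conjI ballI allI impI)
    have pt: "pi_pt (PM.pt V) = center F D V" if V: "V \<in> Z" for V
    proof -
      have V': "V \<in> lrs_points ZZ" using V by simp
      note k = PM.adm_chart[OF V']
      have "const a \<in> PM.pt V \<longleftrightarrow> a \<in> nonunits F V" if a: "a \<in> D" for a
        using PM.mem_pt[OF V' k pl.G_const[of a]] a e_const[OF PM.quot_closed[OF PM.adm_nz[OF k]], of a]
        by simp
      then show ?thesis using center_eq[OF V] by (auto simp: pi_pt_def)
    qed
    show "lrs_pt (lrs_comp (Proj_line RD) \<pi> PM.M.mor) V = lrs_pt (ZR_structure_map F D) V"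
      if "V \<in> lrs_points ZZ" for V
      using pt that by (simp add: lrs_comp_def lrs_pt_pi PM.M.mor_def ZR_structure_map_def)
    fix U s assume "openin (lrs_top (Spec RD)) U" "s \<in> carrier (lrs_sections (Spec RD) U)"
    then have U: "openin (zariski_topology RD) U" and s: "s \<in> carrier (SD.Y.OX U)"
      by (simp_all only: SD.Spec_XX SD.Y.XX_simps)
    have L: "lrs_comorph (lrs_comp (Proj_line RD) \<pi> PM.M.mor) U s =
        lrs_comorph PM.M.mor (pi_pre U) (lrs_comorph \<pi> U s)"
      by (simp add: lrs_comp_def lrs_pre_pi)
    show "lrs_comorph (lrs_comp (Proj_line RD) \<pi> PM.M.mor) U s = lrs_comorph (ZR_structure_map F D) U s"
    proof (cases "U = {}")
      case True
      \<comment> \<open>Over the empty set both maps return zero, the sole section there.\<close>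
      then have "PM.M.gpre (pi_pre U) = {}" by (simp add: pi_pre_def PM.M.gpre_def)
      then show ?thesis unfolding L using True
        by (simp add: PM.M.mor_def ZR_structure_map_def) (simp add: ZR_space_def)
    next
      case False
      have R: "lrs_comorph (ZR_structure_map F D) U s = SD.sval U s"
        using SD.section_value_unique[OF U False s] False by (simp add: ZR_structure_map_def)
      have F: "carrier F \<in> lrs_points ZZ" using FZ by simp
      have z: "pi_pt (PM.pt (carrier F)) \<in> U"
        using pt[OF FZ] center_F SD.generic_zero[OF U False] by simp
      then have q: "PM.pt (carrier F) \<in> pi_pre U" using PM.pt_Proj[OF F] by (simp add: pi_pre_def)
      then have ne: "PM.M.gpre (pi_pre U) \<noteq> {}" using F by (auto simp: PM.M.gpre_def)
      obtain a f where a: "(a, f) \<in> SD.Y.Q (pi_pt (PM.pt (carrier F)))"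
        "s (pi_pt (PM.pt (carrier F))) = SD.Y.frac (pi_pt (PM.pt (carrier F))) a f"
        using SD.Y.FR_cases[OF SD.Y.section_value_closed[OF s z]] .
      have aD: "a \<in> D" "f \<in> D" using SD.Y.QD[OF a(1)] by auto
      have "lrs_comorph PM.M.mor (pi_pre U) (lrs_comorph \<pi> U s) =
          frac_val F (e t) (lrs_comorph \<pi> U s (PM.pt (carrier F)))"
        using PM.M.mor_realizes open_pi_pre[OF U] pi_closed[OF U s] ne by (simp add: PM.M.realizes_def)
      also have "\<dots> = frac_val F (e t) (pl.proj.frac (PM.pt (carrier F)) (const a) (const f))"
        using pi_value[OF s q a] by simp
      also have "\<dots> = a \<otimes> inv f"
        using PM.M.frac_val_frac[OF F Q_const[OF a(1)]] aD by (simp add: e_const[OF tc])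
      also have "\<dots> = frac_val F (\<lambda>a. a) (s (pi_pt (PM.pt (carrier F))))"
        using SD.frac_val_frac_p[OF prime_pi_pt[OF PM.pt_Proj[OF F]], of a f] a SD.Y.QD[OF a(1)] by simp
      also have "\<dots> = SD.sval U s" by (rule SD.sval_at[OF U s z])
      finally show ?thesis unfolding L R .
    qed
  qed
qed

text \<open>If the morphism given by \<open>t\<close> factors through \<open>Spec R\<close> then, locally on \<open>Spec R\<close>, the coordinate
  \<open>t\<^sub>i / t\<^sub>k\<close> is a fraction with numerator and denominator in the image of \<open>R\<close> in \<open>\<Inter>Z\<close>.\<close>

lemma factor_quotient:
  fixes R :: "('r, 'n) ring_scheme"
  assumes R: "cring R" and \<alpha>: "lrs_morphism ZZ (Spec R) \<alpha>" and \<beta>: "lrs_morphism (Spec R) (Proj_line RD) \<beta>"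
    and eq: "lrs_map_eq ZZ (Proj_line RD) PM.M.mor (lrs_comp (Spec R) \<beta> \<alpha>)"
    and P: "primeideal P (F\<lparr>carrier := \<Inter>Z\<rparr>)"
  obtains k where "t k \<noteq> \<zero>" "t (\<not> k) \<otimes> inv t k \<in> localization_in F (\<Inter>Z) P"
proof -
  interpret Y: frac_data R "\<lambda>_. carrier R" "zariski_topology R" by (rule frac_data_Spec[OF R])
  have zeroP: "\<zero> \<in> P"
    using additive_subgroup.zero_closed[OF ideal.axioms(1)[OF primeideal.axioms(1)[OF P]]] by simp
  have Spec: "Spec R = Y.XX" by (rule Spec_eq)
  let ?T = "zariski_topology R" and ?A = "F\<lparr>carrier := \<Inter>Z\<rparr>"
  let ?X = "topspace ?T"
  have X: "?X = {p. primeideal p R}" by (rule topspace_zariski[OF R])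
  have Q: "(a, f) \<in> Y.Q p \<longleftrightarrow> a \<in> carrier R \<and> f \<in> carrier R \<and> f \<notin> p" for a f p
    by (auto simp: Y.Q_iff)
  have Q1: "(a, \<one>\<^bsub>R\<^esub>) \<in> Y.Q p" if "a \<in> carrier R" "p \<in> ?X" for a p
    using that Y.one_notin by (simp add: Q)
  have \<alpha>c: "continuous_map (lrs_top ZZ) ?T (lrs_pt \<alpha>)"
    and \<alpha>h: "\<And>U. openin ?T U \<Longrightarrow> lrs_comorph \<alpha> U \<in> ring_hom (Y.OX U) (lrs_sections ZZ (lrs_pre ZZ \<alpha> U))"
    and \<alpha>r: "\<And>U V s. openin ?T U \<Longrightarrow> openin ?T V \<Longrightarrow> V \<subseteq> U \<Longrightarrow> s \<in> carrier (Y.OX U) \<Longrightarrow>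
      lrs_comorph \<alpha> V (restrict s V) = lrs_restr ZZ (lrs_pre ZZ \<alpha> U) (lrs_pre ZZ \<alpha> V) (lrs_comorph \<alpha> U s)"
    using \<alpha> unfolding lrs_morphism_def Spec Y.XX_simps by blast+
  have \<beta>c: "continuous_map ?T pl.proj_top (lrs_pt \<beta>)"
    and \<beta>h: "\<And>U. openin pl.proj_top U \<Longrightarrow>
      lrs_comorph \<beta> U \<in> ring_hom (pl.proj.OX U) (Y.OX (lrs_pre (Spec R) \<beta> U))"
    using \<beta> unfolding lrs_morphism_def Spec Y.XX_simps pl.Proj_line_eq pl.proj.XX_simps by blast+
  define h where "h r = lrs_comorph \<alpha> ?X (Y.sec ?X r \<one>\<^bsub>R\<^esub>)" for r
  have sec: "Y.sec W r \<one>\<^bsub>R\<^esub> \<in> carrier (Y.OX W)" if "openin ?T W" "r \<in> carrier R" for r W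
    using that Q1 openin_subset[OF that(1)] by (intro Y.sec_closed) auto
  have preX: "lrs_pre ZZ \<alpha> ?X = Z"
    using \<alpha>c by (auto simp: lrs_pre_def continuous_map_def)
  have Zne: "Z \<noteq> {}" using FZ by auto
  have hh: "h \<in> ring_hom R ?A"
  proof -
    have "(\<lambda>r. Y.sec ?X r \<one>\<^bsub>R\<^esub>) \<in> ring_hom R (Y.OX ?X)"
    proof (rule ring_hom_memI)
      fix a b assume a: "a \<in> carrier R" and b: "b \<in> carrier R"
      show "Y.sec ?X a \<one>\<^bsub>R\<^esub> \<in> carrier (Y.OX ?X)" by (rule sec[OF openin_topspace a])
      show "Y.sec ?X (a \<otimes>\<^bsub>R\<^esub> b) \<one>\<^bsub>R\<^esub> = Y.sec ?X a \<one>\<^bsub>R\<^esub> \<otimes>\<^bsub>Y.OX ?X\<^esub> Y.sec ?X b \<one>\<^bsub>R\<^esub>"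
        using Y.sec_mult[OF subset_refl Q1[OF a] Q1[OF b]] by simp
      show "Y.sec ?X (a \<oplus>\<^bsub>R\<^esub> b) \<one>\<^bsub>R\<^esub> = Y.sec ?X a \<one>\<^bsub>R\<^esub> \<oplus>\<^bsub>Y.OX ?X\<^esub> Y.sec ?X b \<one>\<^bsub>R\<^esub>"
        using Y.sec_add[OF subset_refl Q1[OF a] Q1[OF b]] a b by simp
    qed (simp add: Y.OX_one)
    then have "lrs_comorph \<alpha> ?X \<circ> (\<lambda>r. Y.sec ?X r \<one>\<^bsub>R\<^esub>) \<in> ring_hom R (lrs_sections ZZ (lrs_pre ZZ \<alpha> ?X))"
      using \<alpha>h[OF openin_topspace] by (rule ring_hom_trans)
    then show ?thesis
      by (simp add: preX sections_ZZ[OF Zne] comp_def h_def[abs_def])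
  qed
  define p where "p = {r \<in> carrier R. h r \<in> P}"
  have A: "cring ?A" using subring_cring[OF subring_Inter[of Z]] subring_Z Zne by blast
  have pp: "primeideal p R"
  proof -
    have "ring_hom_ring R ?A h"
      using hh R A by (simp add: ring_hom_ring_def ring_hom_ring_axioms_def cring_def)
    then show ?thesis unfolding p_def by (rule ring_hom_ring.primeideal_vimage[OF _ R P])
  qed
  have pX: "p \<in> ?X" using pp X by simp
  have "lrs_pt \<beta> p \<in> Proj_points S G" using \<beta>c pX by (auto simp: continuous_map_def)
  \<comment> \<open>\<open>k\<close> is the chart of the image of \<open>p\<close>; the section to
    pull back is the other variable divided by this one.\<close>
  then obtain k where k: "var k \<notin> lrs_pt \<beta> p" using pl.Proj_points_pvar by blast
  define U where "U = {q \<in> Proj_points S G. var k \<notin> q}"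
  have U: "openin pl.proj_top U" unfolding U_def by (rule pl.openin_proj_basic[OF pl.pvar_closed])
  have pU: "lrs_pt \<beta> p \<in> U" using k \<open>lrs_pt \<beta> p \<in> Proj_points S G\<close> by (simp add: U_def)
  define \<sigma> where "\<sigma> = pl.proj.sec U (var (\<not> k)) (var k)"
  have QU: "(var (\<not> k), var k) \<in> pl.proj.Q q" if "q \<in> U" for q
    using that pl.G_pvar by (auto simp: pl.proj.Q_iff U_def)
  have \<sigma>: "\<sigma> \<in> carrier (pl.proj.OX U)" unfolding \<sigma>_def by (rule pl.proj.sec_closed[OF U QU])
  define B where "B = lrs_pre (Spec R) \<beta> U"
  have Bo: "openin ?T B"
    using lrs_morphism_pre[OF \<beta>] U unfolding B_def Spec pl.Proj_line_eq by simp
  define \<tau> where "\<tau> = lrs_comorph \<beta> U \<sigma>"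
  have \<tau>: "\<tau> \<in> carrier (Y.OX B)" unfolding \<tau>_def B_def using ring_hom_closed[OF \<beta>h[OF U] \<sigma>] .
  have pB: "p \<in> B" using pU pX by (simp add: B_def lrs_pre_def Spec)
  obtain W a f where W: "openin ?T W" "p \<in> W" "W \<subseteq> B" "\<And>q. q \<in> W \<Longrightarrow> (a, f) \<in> Y.Q q"
    "restrict \<tau> W = Y.sec W a f"
    using Y.section_local[OF \<tau> pB] by metis
  have a: "a \<in> carrier R" and f: "f \<in> carrier R" "f \<notin> p" using W(4)[OF W(2)] by (auto simp: Q)
  have F: "carrier F \<in> lrs_points ZZ" using FZ by simp
  let ?q = "lrs_pt \<alpha> (carrier F)"
  have qX: "?q \<in> ?X" using \<alpha>c F by (auto simp: continuous_map_def)
  have hA: "h r \<in> \<Inter>Z" if "r \<in> carrier R" for r using ring_hom_closed[OF hh that] by simp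
  \<comment> \<open>An element \<open>r\<close> of the image of \<open>F\<close> is a nonunit germ
    there. By locality \<open>h r\<close> is a nonunit of the field, hence zero, and zero lies in
    \<open>P\<close>.\<close>
  have "?q \<subseteq> p"
  proof
    fix r assume r: "r \<in> ?q"
    have rR: "r \<in> carrier R" using r qX X ideal.Icarr[of ?q R r] by (auto dest: primeideal.axioms(1))
    have g: "germ_at (Spec R) ?q ?X (Y.sec ?X r \<one>\<^bsub>R\<^esub>)"
      unfolding Spec using sec[OF openin_topspace rR] qX by (simp add: Y.germ_at_XX)
    have "Y.sec ?X r \<one>\<^bsub>R\<^esub> ?q \<in> Y.frac_max ?q"
      using Y.frac_in_max_iff[OF qX Q1[OF rR qX]] qX r by simp
    then have "lrs_comorph \<alpha> ?X (Y.sec ?X r \<one>\<^bsub>R\<^esub>) \<in> nonunits F (carrier F)"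
      using lrs_morphism_local[OF \<alpha> F stalk_model_ffs[OF F] _ ffs_local[OF F] Y.FR_local[OF qX] g]
        Y.stalk_model_XX[OF qX] by (simp add: Spec)
    then have "h r = \<zero>" by (simp add: h_def nonunits_carrier)
    then show "r \<in> p" using rR zeroP by (simp add: p_def)
  qed
  then have qW: "?q \<in> W" using zariski_generization[OF W(1,2)] qX X by simp
  have FW: "carrier F \<in> lrs_pre ZZ \<alpha> W" using qW F by (simp add: lrs_pre_def)
  then have ne: "lrs_pre ZZ \<alpha> W \<noteq> {}" by auto
  have hW: "lrs_comorph \<alpha> W (Y.sec W r \<one>\<^bsub>R\<^esub>) = h r" if r: "r \<in> carrier R" for r
    using \<alpha>r[OF openin_topspace W(1) openin_subset[OF W(1)] sec[OF openin_topspace r]]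
      openin_subset[OF W(1)] by (simp add: h_def restr_ZZ[OF ne])
  have \<phi>pt: "PM.pt (carrier F) = lrs_pt \<beta> ?q"
    using eq F by (simp add: lrs_map_eq_def lrs_comp_def PM.M.mor_def)
  have "?q \<in> B" using qW W(3) by blast
  then have ptU: "PM.pt (carrier F) \<in> U" by (simp add: \<phi>pt B_def lrs_pre_def)
  have tk: "t k \<noteq> \<zero>"
    using PM.M.adapted[OF F QU[OF ptU]] e_var[OF tc] by simp
  \<comment> \<open>Restriction between nonempty open sets of \<open>Z\<close> does not change
    elements of \<open>F\<close>, so the value over \<open>W\<close> is computed over
    \<open>U\<close> at the point \<open>F\<close>.\<close>
  have val: "lrs_comorph \<alpha> W (Y.sec W a f) = t (\<not> k) \<otimes> inv t k"
  proof -
    have "lrs_comorph \<alpha> W (restrict \<tau> W) = lrs_comorph \<alpha> B \<tau>"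
      using \<alpha>r[OF Bo W(1,3) \<tau>] by (simp add: restr_ZZ[OF ne])
    also have "\<dots> = lrs_comorph (lrs_comp (Spec R) \<beta> \<alpha>) U \<sigma>"
      by (simp add: lrs_comp_def \<tau>_def B_def)
    also have "\<dots> = lrs_comorph PM.M.mor U \<sigma>"
      using eq U \<sigma> by (simp add: lrs_map_eq_def pl.Proj_line_eq)
    also have "\<dots> = frac_val F (e t) (\<sigma> (PM.pt (carrier F)))"
    proof -
      have "PM.M.gpre U \<noteq> {}" using ptU F by (auto simp: PM.M.gpre_def)
      then show ?thesis using PM.M.mor_realizes U \<sigma> by (simp add: PM.M.realizes_def)
    qed
    also have "\<dots> = t (\<not> k) \<otimes> inv t k"
      using PM.M.frac_val_frac[OF F QU[OF ptU]] ptU e_var[OF tc] by (simp add: \<sigma>_def)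
    finally show ?thesis by (simp add: W(5))
  qed
  have secW: "Y.sec W a f \<in> carrier (Y.OX W)" by (rule Y.sec_closed[OF W(1,4)])
  have WX: "q \<in> ?X" if "q \<in> W" for q using openin_subset[OF W(1)] that by blast
  \<comment> \<open>\<open>f\<close> need not be invertible in \<open>R\<close>; instead the
    identity \<open>f (a/f) = a\<close> of sections over \<open>W\<close> is pulled back, and the
    division takes place in \<open>F\<close>.\<close>
  have "Y.sec W f \<one>\<^bsub>R\<^esub> \<otimes>\<^bsub>Y.OX W\<^esub> Y.sec W a f = Y.sec W (f \<otimes>\<^bsub>R\<^esub> a) (\<one>\<^bsub>R\<^esub> \<otimes>\<^bsub>R\<^esub> f)"
    by (rule Y.sec_mult[OF openin_subset[OF W(1)] Q1[OF f(1) WX] W(4)])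
  also have "\<dots> = Y.sec W a \<one>\<^bsub>R\<^esub>"
  proof (rule Y.sec_eqI[OF openin_subset[OF W(1)]])
    show "(f \<otimes>\<^bsub>R\<^esub> a, \<one>\<^bsub>R\<^esub> \<otimes>\<^bsub>R\<^esub> f) \<in> Y.Q q" if "q \<in> W" for q
      using W(4)[OF that] a f by (simp add: Q)
    show "(a, \<one>\<^bsub>R\<^esub>) \<in> Y.Q q" if "q \<in> W" for q by (rule Q1[OF a WX[OF that]])
    show "f \<otimes>\<^bsub>R\<^esub> a \<otimes>\<^bsub>R\<^esub> \<one>\<^bsub>R\<^esub> = a \<otimes>\<^bsub>R\<^esub> (\<one>\<^bsub>R\<^esub> \<otimes>\<^bsub>R\<^esub> f)"
      using a f Y.m_comm by simp
  qed
  finally have "h f \<otimes> (t (\<not> k) \<otimes> inv t k) = h a"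
    using ring_hom_mult[OF \<alpha>h[OF W(1)] sec[OF W(1) f(1)] secW] hW[OF f(1)] hW[OF a] val
    by (simp add: sections_ZZ[OF ne])
  moreover have hc: "h a \<in> \<Inter>Z" "h f \<in> \<Inter>Z" "h f \<notin> P" using hA a f by (auto simp: p_def)
  moreover have "h f \<noteq> \<zero>" using hc zeroP by auto
  moreover have "\<Inter>Z \<subseteq> carrier F" using FZ by blast
  ultimately have "t (\<not> k) \<otimes> inv t k = h a \<otimes> inv h f"
    using eq_divide_iff[of "h a" "h f" "t (\<not> k) \<otimes> inv t k"] tc tk m_comm[of "h f" "t (\<not> k) \<otimes> inv t k"]
    by (simp add: subset_iff)
  then have "t (\<not> k) \<otimes> inv t k \<in> localization_in F (\<Inter>Z) P"
    using hc by (auto simp: localization_in_def)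
  then show ?thesis using that tk by blast
qed

end

context zr_proj
begin

lemma pruefer_if_factors:
  assumes factors: "\<And>\<phi>. lrs_morphism_over (Spec RD) ZZ (ZR_structure_map F D) (Proj_line RD) \<pi> \<phi> \<Longrightarrow>
     factors_through_affine TYPE('r) ZZ (Proj_line RD) \<phi>"
  shows "pruefer_domain_in F (\<Inter>Z)"
  unfolding pruefer_domain_in_def
proof (intro conjI allI impI)
  show A: "subring (\<Inter>Z) F" using subring_Inter[of Z] subring_Z FZ by blast
  fix P assume P: "primeideal P (F\<lparr>carrier := \<Inter>Z\<rparr>)"
  interpret SA: spec_domain F "F\<lparr>carrier := \<Inter>Z\<rparr>" "\<lambda>a. a"
    using subringE(1)[OF A]
    by (intro spec_domain.intro field_axioms subring_cring[OF A] spec_domain_axioms.intro ring_hom_memI) auto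
  have loc: "localization_in F (\<Inter>Z) P = SA.loc P"
    by (auto simp: localization_in_def SA.loc_def)
  show "valuation_ring_of F (localization_in F (\<Inter>Z) P)"
    unfolding valuation_ring_of_def
  proof (intro conjI ballI impI)
    show "subring (localization_in F (\<Inter>Z) P) F" unfolding loc by (rule SA.subring_loc[OF P])
    fix x assume x: "x \<in> carrier F" "x \<noteq> \<zero>"
    let ?t = "\<lambda>k. if k then x else \<one>"
    interpret T: zr_proj_mor F D Z ?t
      using x by unfold_locales auto
    obtain R :: "'r ring" and \<alpha> \<beta> where "cring R" "lrs_morphism ZZ (Spec R) \<alpha>"
      "lrs_morphism (Spec R) (Proj_line RD) \<beta>"
      "lrs_map_eq ZZ (Proj_line RD) T.PM.M.mor (lrs_comp (Spec R) \<beta> \<alpha>)"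
      using factors[OF T.mor_over] by (auto simp: factors_through_affine_def)
    then obtain k where "?t k \<noteq> \<zero>" "?t (\<not> k) \<otimes> inv ?t k \<in> localization_in F (\<Inter>Z) P"
      using T.factor_quotient[OF _ _ _ _ P] by blast
    \<comment> \<open>The chart \<open>k = False\<close> yields \<open>x\<close>, the chart
      \<open>k = True\<close> its inverse.\<close>
    then show "x \<in> localization_in F (\<Inter>Z) P \<or> inv x \<in> localization_in F (\<Inter>Z) P"
      using x inv_eqI[of \<one> \<one>] by (cases k) auto
  qed
qed

end

section \<open>Coordinates of a morphism to the projective line\<close>

context poly2
begin

lemma pvar_pow_G: "pvar R k [^]\<^bsub>S\<^esub> n \<in> G n"
proof (induction n)
  case 0
  then show ?case using G_one by simp
next
  case (Suc n)
  then show ?case using G_mult[OF Suc G_pvar] by simp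
qed

lemma pvar_pow_notin:
  assumes "q \<in> Proj_points S G" "pvar R k \<notin> q"
  shows "pvar R k [^]\<^bsub>S\<^esub> (n :: nat) \<notin> q"
proof (induction n)
  case 0
  then show ?case using proj.one_notin[of q] assms by simp
next
  case (Suc n)
  then show ?case using proj.not_in_prime_mult[of q] assms by simp
qed

end

context proj_field
begin

text \<open>For charts \<open>i\<close> of \<open>q\<close> and \<open>j\<close> of
  \<open>q'\<close> both ratios of \<open>t i\<close> and \<open>t j\<close> lie in
  \<open>L\<close>, so they are units and the variable \<open>j\<close> avoids \<open>q\<close> as
  well. A form of degree \<open>n\<close> over the \<open>n\<close>-th power of that variable is
  then a fraction at both points, and its value decides membership in either.\<close>

lemma adapted_unique:
  assumes L: "subring L F" and t: "\<And>k. t k \<in> carrier F"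
    and q: "q \<in> Proj_points S G" "q' \<in> Proj_points S G"
    and ad: "\<And>a f. (a, f) \<in> pl.proj.Q q \<Longrightarrow>
      e t f \<noteq> \<zero> \<and> e t a \<otimes> inv e t f \<in> L \<and> (e t a \<otimes> inv e t f \<in> nonunits F L \<longleftrightarrow> a \<in> q)"
    and ad': "\<And>a f. (a, f) \<in> pl.proj.Q q' \<Longrightarrow>
      e t f \<noteq> \<zero> \<and> e t a \<otimes> inv e t f \<in> L \<and> (e t a \<otimes> inv e t f \<in> nonunits F L \<longleftrightarrow> a \<in> q')"
  shows "q = q'"
proof (rule pl.Proj_points_eqI[OF q])
  obtain i where i: "var i \<notin> q" using pl.Proj_points_pvar[OF q(1)] .
  obtain j where j: "var j \<notin> q'" using pl.Proj_points_pvar[OF q(2)] .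
  have ji: "(var j, var i) \<in> pl.proj.Q q" and ij: "(var i, var j) \<in> pl.proj.Q q'"
    using i j pl.G_pvar by (auto simp: pl.proj.Q_iff)
  note ti = ad[OF ji, unfolded e_var[OF t]] and tj = ad'[OF ij, unfolded e_var[OF t]]
  have nz: "t i \<noteq> \<zero>" "t j \<noteq> \<zero>" using ti tj by auto
  have "inv (t j \<otimes> inv t i) = t i \<otimes> inv t j" using nz t by (simp add: inv_mult m_comm)
  then have "t j \<otimes> inv t i \<notin> nonunits F L"
    using tj nz t by (simp add: nonunits_def mult_eq_zero_iff)
  then have j': "var j \<notin> q" using ti by blast
  fix n a assume a: "a \<in> G n"
  have "(a, var j [^]\<^bsub>S\<^esub> n) \<in> pl.proj.Q q" "(a, var j [^]\<^bsub>S\<^esub> n) \<in> pl.proj.Q q'"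
    using a pl.pvar_pow_G pl.pvar_pow_notin[OF q(1) j'] pl.pvar_pow_notin[OF q(2) j]
    unfolding pl.proj.Q_iff by blast+
  then show "a \<in> q \<longleftrightarrow> a \<in> q'" using ad ad' by blast
qed

end

text \<open>\<open>k\<close> is a standard chart containing the image of the generic point
  \<open>F\<close>; the coordinates of \<open>\<phi>\<close> are read in this chart.\<close>

locale zr_morphism = zr_proj F D Z for F :: "'f ring" (structure) and D and Z +
  fixes \<phi> :: "('f set, 'f, (nat \<Rightarrow> nat \<Rightarrow> 'f) set, (nat \<Rightarrow> nat \<Rightarrow> 'f) set \<Rightarrow> ((nat \<Rightarrow> nat \<Rightarrow> 'f) \<times> (nat \<Rightarrow> nat \<Rightarrow> 'f)) set) lrs_map"
    and k :: bool
  assumes over: "lrs_morphism_over (Spec (F\<lparr>carrier := D\<rparr>)) (ZR_space F D Z) (ZR_structure_map F D)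
      (Proj_line (F\<lparr>carrier := D\<rparr>)) (Proj_line_structure_map (F\<lparr>carrier := D\<rparr>)) \<phi>"
    and k: "pvar (F\<lparr>carrier := D\<rparr>) k \<notin> lrs_pt \<phi> (carrier F)"
begin

lemma \<phi>_mor: "lrs_morphism ZZ (Proj_line RD) \<phi>"
  using over by (simp add: lrs_morphism_over_def)

lemma \<phi>_mor': "lrs_morphism ZZ pl.proj.XX \<phi>"
  using \<phi>_mor by (simp add: pl.Proj_line_eq)

lemma \<phi>_continuous: "continuous_map (lrs_top ZZ) pl.proj_top (lrs_pt \<phi>)"
  and \<phi>_hom: "openin pl.proj_top U \<Longrightarrow>
      lrs_comorph \<phi> U \<in> ring_hom (pl.proj.OX U) (lrs_sections ZZ (lrs_pre ZZ \<phi> U))"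
  and \<phi>_restr: "openin pl.proj_top U \<Longrightarrow> openin pl.proj_top V \<Longrightarrow> V \<subseteq> U \<Longrightarrow> s \<in> carrier (pl.proj.OX U) \<Longrightarrow>
      lrs_comorph \<phi> V (restrict s V) = lrs_restr ZZ (lrs_pre ZZ \<phi> U) (lrs_pre ZZ \<phi> V) (lrs_comorph \<phi> U s)"
  using \<phi>_mor' unfolding lrs_morphism_def pl.proj.XX_simps by blast+

lemma \<phi>_Proj: "V \<in> Z \<Longrightarrow> lrs_pt \<phi> V \<in> Proj_points S G"
  using \<phi>_continuous by (auto simp: continuous_map_def)

abbreviation pre where "pre \<equiv> lrs_pre ZZ \<phi>"

lemma pre_iff: "V \<in> pre U \<longleftrightarrow> V \<in> Z \<and> lrs_pt \<phi> V \<in> U"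
  by (simp add: lrs_pre_def)

lemma pre_open: "openin pl.proj_top U \<Longrightarrow> openin (lrs_top ZZ) (pre U)"
  using lrs_morphism_pre[OF \<phi>_mor'] by simp

lemma pre_generic: "openin pl.proj_top U \<Longrightarrow> pre U \<noteq> {} \<Longrightarrow> carrier F \<in> pre U"
  using generic pre_open by blast

lemma \<phi>_restr':
  assumes "openin pl.proj_top U" "openin pl.proj_top V" "V \<subseteq> U" "pre V \<noteq> {}" "s \<in> carrier (pl.proj.OX U)"
  shows "lrs_comorph \<phi> V (restrict s V) = lrs_comorph \<phi> U s"
  using \<phi>_restr[OF assms(1,2,3,5)] by (simp add: restr_ZZ[OF assms(4)])

context
  fixes W assumes W: "openin pl.proj_top W" and ne: "pre W \<noteq> {}"
begin

lemma \<phi>_mult: "s \<in> carrier (pl.proj.OX W) \<Longrightarrow> s' \<in> carrier (pl.proj.OX W) \<Longrightarrow>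
    lrs_comorph \<phi> W (s \<otimes>\<^bsub>pl.proj.OX W\<^esub> s') = lrs_comorph \<phi> W s \<otimes> lrs_comorph \<phi> W s'"
  and \<phi>_add: "s \<in> carrier (pl.proj.OX W) \<Longrightarrow> s' \<in> carrier (pl.proj.OX W) \<Longrightarrow>
    lrs_comorph \<phi> W (s \<oplus>\<^bsub>pl.proj.OX W\<^esub> s') = lrs_comorph \<phi> W s \<oplus> lrs_comorph \<phi> W s'"
  and \<phi>_one: "lrs_comorph \<phi> W \<one>\<^bsub>pl.proj.OX W\<^esub> = \<one>"
  and \<phi>_closed: "s \<in> carrier (pl.proj.OX W) \<Longrightarrow> lrs_comorph \<phi> W s \<in> \<Inter>(pre W)"
  and \<phi>_carrier: "s \<in> carrier (pl.proj.OX W) \<Longrightarrow> lrs_comorph \<phi> W s \<in> carrier F"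
proof -
  note hom = \<phi>_hom[OF W, unfolded sections_ZZ[OF ne]]
  show "lrs_comorph \<phi> W \<one>\<^bsub>pl.proj.OX W\<^esub> = \<one>" using ring_hom_one[OF hom] by simp
  assume s: "s \<in> carrier (pl.proj.OX W)"
  show cl: "lrs_comorph \<phi> W s \<in> \<Inter>(pre W)" using ring_hom_closed[OF hom s] by simp
  show "lrs_comorph \<phi> W s \<in> carrier F" using cl pre_generic[OF W ne] by blast
  assume s': "s' \<in> carrier (pl.proj.OX W)"
  show "lrs_comorph \<phi> W (s \<otimes>\<^bsub>pl.proj.OX W\<^esub> s') = lrs_comorph \<phi> W s \<otimes> lrs_comorph \<phi> W s'"
    using ring_hom_mult[OF hom s s'] by simp
  show "lrs_comorph \<phi> W (s \<oplus>\<^bsub>pl.proj.OX W\<^esub> s') = lrs_comorph \<phi> W s \<oplus> lrs_comorph \<phi> W s'"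
    using ring_hom_add[OF hom s s'] by simp
qed

lemma W_top: "W \<subseteq> topspace pl.proj_top"
  using openin_subset[OF W] .

text \<open>Commutation with the maps to \<open>Spec RD\<close> enters here: the section
  \<open>c/1\<close> is the pullback of the global section \<open>c\<close> of the spectrum, which
  the structure map of \<open>Z\<close> sends to \<open>c\<close>.\<close>

lemma \<phi>_const:
  assumes c: "c \<in> D"
  shows "lrs_comorph \<phi> W (pl.proj.sec W (const c) \<one>\<^bsub>S\<^esub>) = c"
proof -
  let ?T = "zariski_topology RD" and ?P = "topspace pl.proj_top"
  let ?s = "SD.Y.sec (topspace ?T) c \<one>"
  have Q: "(c, \<one>) \<in> SD.Y.Q p" if "p \<in> topspace ?T" for p
    using SD.Y.one_notin[OF that] subringE(3)[OF D] c unfolding SD.Q_Spec by simp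
  have s: "?s \<in> carrier (SD.Y.OX (topspace ?T))" by (rule SD.Y.sec_closed[OF openin_topspace Q])
  have pre: "pi_pre (topspace ?T) = ?P"
    using continuous_pi by (auto simp: pi_pre_def continuous_map_def)
  have const1: "const \<one> = \<one>\<^bsub>S\<^esub>" using ring_hom_one[OF const_hom] by simp
  have Q1: "(const c, \<one>\<^bsub>S\<^esub>) \<in> pl.proj.Q q" if "q \<in> ?P" for q
    using pl.G_const[of c] pl.G_one pl.proj.one_notin[OF that] c unfolding pl.proj.Q_iff by auto
  have sc: "pl.proj.sec ?P (const c) \<one>\<^bsub>S\<^esub> \<in> carrier (pl.proj.OX ?P)"
    by (rule pl.proj.sec_closed[OF openin_topspace Q1])
  have pis: "lrs_comorph \<pi> (topspace ?T) ?s = pl.proj.sec ?P (const c) \<one>\<^bsub>S\<^esub>"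
  proof (rule extensionalityI[OF pl.proj.section_extensional pl.proj.section_extensional[OF sc]])
    show "lrs_comorph \<pi> (topspace ?T) ?s \<in> carrier (pl.proj.OX ?P)"
      using pi_closed[OF openin_topspace s] by (simp only: pre)
    fix q assume q: "q \<in> ?P"
    then have q': "q \<in> pi_pre (topspace ?T)" by (simp only: pre)
    then have p: "pi_pt q \<in> topspace ?T" by (simp add: pi_pre_def)
    show "lrs_comorph \<pi> (topspace ?T) ?s q = pl.proj.sec ?P (const c) \<one>\<^bsub>S\<^esub> q"
      by (simp only: pi_value[OF s q' Q[OF p] SD.Y.sec_apply[OF p]] pl.proj.sec_apply[OF q] const1)
  qed
  have tne: "topspace ?T \<noteq> {}" using SD.j_prime_zero by auto
  have "lrs_comorph \<phi> ?P (pl.proj.sec ?P (const c) \<one>\<^bsub>S\<^esub>) =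
      lrs_comorph (lrs_comp (Proj_line RD) \<pi> \<phi>) (topspace ?T) ?s"
    by (simp only: lrs_comp_def lrs_pre_pi pre pis lrs_map.simps comp_apply)
  also have "\<dots> = lrs_comorph (ZR_structure_map F D) (topspace ?T) ?s"
    using over s unfolding lrs_morphism_over_def lrs_map_eq_def SD.Spec_XX SD.Y.XX_simps by blast
  also have "\<dots> = SD.sval (topspace ?T) ?s"
    by (simp only: ZR_structure_map_def lrs_map.simps if_not_P[OF tne]
        SD.section_value_unique[OF openin_topspace tne s])
  also have "\<dots> = c"
  proof -
    have z: "{\<zero>\<^bsub>RD\<^esub>} \<in> topspace ?T" using SD.j_prime_zero by simp
    have "SD.sval (topspace ?T) ?s = frac_val F (\<lambda>a. a) (SD.Y.frac {\<zero>\<^bsub>RD\<^esub>} c \<one>)"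
      by (simp only: SD.sval_def SD.Y.sec_apply[OF z])
    also have "\<dots> = c \<otimes> inv \<one>"
      using c subringE(3)[OF D] by (intro SD.frac_val_frac_p[OF SD.j_prime_zero]) auto
    finally have "SD.sval (topspace ?T) ?s = c \<otimes> inv \<one>" .
    then show ?thesis using c D_carrier inv_eqI[of \<one> \<one>] by simp
  qed
  finally have "lrs_comorph \<phi> ?P (pl.proj.sec ?P (const c) \<one>\<^bsub>S\<^esub>) = c" .
  then show ?thesis
    using \<phi>_restr'[OF openin_topspace W W_top ne sc] by (simp only: pl.proj.restrict_sec[OF W_top])
qed

end

definition U where "U = {q \<in> Proj_points S G. var k \<notin> q}"

lemma U_open: "openin pl.proj_top U"
  unfolding U_def by (rule pl.openin_proj_basic[OF pl.pvar_closed])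

lemma U_ne: "pre U \<noteq> {}"
proof -
  have "carrier F \<in> pre U" using k \<phi>_Proj FZ by (simp add: pre_iff U_def)
  then show ?thesis by blast
qed

lemma QU: "f \<in> G n \<Longrightarrow> q \<in> U \<Longrightarrow> (f, var k [^]\<^bsub>S\<^esub> n) \<in> pl.proj.Q q"
  using pl.pvar_pow_G pl.pvar_pow_notin unfolding pl.proj.Q_iff U_def by blast

lemma QU1: "q \<in> U \<Longrightarrow> (var i, var k) \<in> pl.proj.Q q"
  using pl.G_pvar unfolding pl.proj.Q_iff U_def by blast

definition t :: "bool \<Rightarrow> 'f" where
  "t i = lrs_comorph \<phi> U (pl.proj.sec U (var i) (var k))"

lemma t_closed: "t i \<in> carrier F"
  unfolding t_def by (rule \<phi>_carrier[OF U_open U_ne pl.proj.sec_closed[OF U_open QU1]])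

lemma t_k: "t k = \<one>"
proof -
  have "pl.proj.sec U (var k) (var k) = \<one>\<^bsub>pl.proj.OX U\<^esub>"
    unfolding pl.proj.OX_one
  proof (rule pl.proj.sec_eqI[OF openin_subset[OF U_open] QU1])
    show "(\<one>\<^bsub>S\<^esub>, \<one>\<^bsub>S\<^esub>) \<in> pl.proj.Q q" if "q \<in> U" for q
      using that by (intro pl.proj.Q_one) (simp add: U_def)
  qed auto
  then show ?thesis unfolding t_def using \<phi>_one[OF U_open U_ne] by simp
qed

text \<open>Dividing by a power of the variable \<open>k\<close> turns a form into a polynomial in
  the two ratios, which pull back to \<open>t\<close>; constants are settled by
  \<open>\<phi>_const\<close>.\<close>

lemma \<phi>_dehomogenize:
  assumes W: "openin pl.proj_top W" "W \<subseteq> U" "pre W \<noteq> {}" and f: "f \<in> G n"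
  shows "lrs_comorph \<phi> W (pl.proj.sec W f (var k [^]\<^bsub>S\<^esub> n)) = e t f"
  using f
proof (induction rule: pl.G_induct)
  case (const a)
  then show ?case using \<phi>_const[OF W(1,3)] e_const[OF t_closed] by simp
next
  case (var n f i)
  note WT = W_top[OF W(1,3)]
  have Q: "(f, var k [^]\<^bsub>S\<^esub> n) \<in> pl.proj.Q q" "(var i, var k) \<in> pl.proj.Q q" if "q \<in> W" for q
    using QU[OF var(1)] QU1 W(2) that by blast+
  note c = pl.proj.sec_closed[OF W(1) Q(1)] pl.proj.sec_closed[OF W(1) Q(2)]
  have "pl.proj.sec W (f \<otimes>\<^bsub>S\<^esub> var i) (var k [^]\<^bsub>S\<^esub> Suc n) =
      pl.proj.sec W f (var k [^]\<^bsub>S\<^esub> n) \<otimes>\<^bsub>pl.proj.OX W\<^esub> pl.proj.sec W (var i) (var k)"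
    using pl.proj.sec_mult[OF WT Q] by simp
  moreover have "lrs_comorph \<phi> W (pl.proj.sec W (var i) (var k)) = t i"
    using \<phi>_restr'[OF U_open W(1,2,3) pl.proj.sec_closed[OF U_open QU1]]
    by (simp add: pl.proj.restrict_sec[OF W(2)] t_def)
  moreover have "e t (f \<otimes>\<^bsub>S\<^esub> var i) = e t f \<otimes> t i"
    using ring_hom_mult[OF e_hom[OF t_closed] pl.G_carrier[OF var(1)] pl.pvar_closed] e_var[OF t_closed]
    by simp
  ultimately show ?case using \<phi>_mult[OF W(1,3) c] var(2) by simp
next
  case (add n f g)
  note WT = W_top[OF W(1,3)]
  let ?v = "var k [^]\<^bsub>S\<^esub> n"
  have Q: "(f, ?v) \<in> pl.proj.Q q" "(g, ?v) \<in> pl.proj.Q q" "(f \<oplus>\<^bsub>S\<^esub> g, ?v) \<in> pl.proj.Q q" if "q \<in> W" for q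
    using QU[OF add(1)] QU[OF add(2)] QU[OF pl.G_add[OF add(1,2)]] W(2) that by blast+
  note c = pl.proj.sec_closed[OF W(1) Q(1)] pl.proj.sec_closed[OF W(1) Q(2)]
  note fc = pl.G_carrier[OF add(1)] pl.G_carrier[OF add(2)] pl.G_carrier[OF pl.pvar_pow_G[of k n]]
  have "pl.proj.sec W f ?v \<oplus>\<^bsub>pl.proj.OX W\<^esub> pl.proj.sec W g ?v =
      pl.proj.sec W (f \<otimes>\<^bsub>S\<^esub> ?v \<oplus>\<^bsub>S\<^esub> g \<otimes>\<^bsub>S\<^esub> ?v) (?v \<otimes>\<^bsub>S\<^esub> ?v)"
    by (rule pl.proj.sec_add[OF WT Q(1,2)])
  \<comment> \<open>The sum of sections is formed over the squared denominator and has to be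
    reduced.\<close>
  also have "\<dots> = pl.proj.sec W (f \<oplus>\<^bsub>S\<^esub> g) ?v"
  proof (rule pl.proj.sec_eqI[OF WT _ Q(3)])
    show "(f \<otimes>\<^bsub>S\<^esub> ?v \<oplus>\<^bsub>S\<^esub> g \<otimes>\<^bsub>S\<^esub> ?v, ?v \<otimes>\<^bsub>S\<^esub> ?v) \<in> pl.proj.Q q" if "q \<in> W" for q
      using pl.proj.Q_add[OF _ Q(1)[OF that] Q(2)[OF that]] WT that by blast
    show "(f \<otimes>\<^bsub>S\<^esub> ?v \<oplus>\<^bsub>S\<^esub> g \<otimes>\<^bsub>S\<^esub> ?v) \<otimes>\<^bsub>S\<^esub> ?v = (f \<oplus>\<^bsub>S\<^esub> g) \<otimes>\<^bsub>S\<^esub> (?v \<otimes>\<^bsub>S\<^esub> ?v)"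
      using fc by (simp add: pl.S.P.l_distr pl.S.P.m_assoc)
  qed
  finally show ?case
    using \<phi>_add[OF W(1,3) c] add(3,4) ring_hom_add[OF e_hom[OF t_closed] fc(1,2)] by simp
qed

text \<open>On \<open>W \<inter> U\<close>, with \<open>v\<close> the \<open>n\<close>-th power of
  the variable \<open>k\<close>, the section \<open>f/v\<close> is invertible with inverse
  \<open>v/f\<close>, and \<open>a/f\<close> times \<open>f/v\<close> is \<open>a/v\<close>; the
  values of \<open>f/v\<close> and \<open>a/v\<close> are known. The preimage of
  \<open>W \<inter> U\<close> is nonempty since both preimages contain \<open>F\<close>.\<close>

lemma \<phi>_frac:
  assumes W: "openin pl.proj_top W" "pre W \<noteq> {}" and Q: "\<And>q. q \<in> W \<Longrightarrow> (a, f) \<in> pl.proj.Q q"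
  shows "e t f \<noteq> \<zero>" "lrs_comorph \<phi> W (pl.proj.sec W a f) = e t a \<otimes> inv e t f"
proof -
  let ?W = "W \<inter> U"
  have W': "openin pl.proj_top ?W" "?W \<subseteq> U" "?W \<subseteq> W" using W U_open by auto
  have "carrier F \<in> pre W" "carrier F \<in> pre U"
    using pre_generic[OF W] pre_generic[OF U_open U_ne] by auto
  then have F: "carrier F \<in> pre ?W" by (simp add: pre_iff)
  then have ne: "pre ?W \<noteq> {}" by blast
  have FW: "lrs_pt \<phi> (carrier F) \<in> ?W" using F by (simp add: pre_iff)
  then obtain n where n: "a \<in> G n" "f \<in> G n" using Q by (auto simp: pl.proj.Q_iff)
  let ?v = "var k [^]\<^bsub>S\<^esub> n"
  note c = pl.G_carrier[OF n(1)] pl.G_carrier[OF n(2)] pl.G_carrier[OF pl.pvar_pow_G[of k n]]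
  have Q': "(a, f) \<in> pl.proj.Q q" "(f, ?v) \<in> pl.proj.Q q" "(a, ?v) \<in> pl.proj.Q q" "(?v, f) \<in> pl.proj.Q q"
    if "q \<in> ?W" for q
  proof -
    show "(a, f) \<in> pl.proj.Q q" using Q that by blast
    show "(f, ?v) \<in> pl.proj.Q q" "(a, ?v) \<in> pl.proj.Q q" using QU n that by blast+
    show "(?v, f) \<in> pl.proj.Q q"
      using n pl.pvar_pow_G pl.proj.QD(3)[OF Q[of q]] that unfolding pl.proj.Q_iff by blast
  qed
  note WT = W_top[OF W'(1) ne]
  note sc = pl.proj.sec_closed[OF W'(1) Q'(1)] pl.proj.sec_closed[OF W'(1) Q'(2)]
    pl.proj.sec_closed[OF W'(1) Q'(4)]
  have prod: "pl.proj.sec ?W a f \<otimes>\<^bsub>pl.proj.OX ?W\<^esub> pl.proj.sec ?W f ?v = pl.proj.sec ?W a ?v"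
  proof -
    have "pl.proj.sec ?W a f \<otimes>\<^bsub>pl.proj.OX ?W\<^esub> pl.proj.sec ?W f ?v =
        pl.proj.sec ?W (a \<otimes>\<^bsub>S\<^esub> f) (f \<otimes>\<^bsub>S\<^esub> ?v)"
      by (rule pl.proj.sec_mult[OF WT Q'(1,2)])
    also have "\<dots> = pl.proj.sec ?W a ?v"
    proof (rule pl.proj.sec_eqI[OF WT _ Q'(3)])
      show "(a \<otimes>\<^bsub>S\<^esub> f, f \<otimes>\<^bsub>S\<^esub> ?v) \<in> pl.proj.Q q" if "q \<in> ?W" for q
        using pl.proj.Q_mult[OF _ Q'(1,2)[OF that]] WT that by blast
      show "a \<otimes>\<^bsub>S\<^esub> f \<otimes>\<^bsub>S\<^esub> ?v = a \<otimes>\<^bsub>S\<^esub> (f \<otimes>\<^bsub>S\<^esub> ?v)"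
        by (rule pl.S.P.m_assoc[OF c])
    qed
    finally show ?thesis .
  qed
  have unit: "pl.proj.sec ?W f ?v \<otimes>\<^bsub>pl.proj.OX ?W\<^esub> pl.proj.sec ?W ?v f = \<one>\<^bsub>pl.proj.OX ?W\<^esub>"
  proof -
    have "pl.proj.sec ?W f ?v \<otimes>\<^bsub>pl.proj.OX ?W\<^esub> pl.proj.sec ?W ?v f =
        pl.proj.sec ?W (f \<otimes>\<^bsub>S\<^esub> ?v) (?v \<otimes>\<^bsub>S\<^esub> f)"
      by (rule pl.proj.sec_mult[OF WT Q'(2,4)])
    also have "\<dots> = pl.proj.sec ?W \<one>\<^bsub>S\<^esub> \<one>\<^bsub>S\<^esub>"
    proof (rule pl.proj.sec_eqI[OF WT])
      show "(f \<otimes>\<^bsub>S\<^esub> ?v, ?v \<otimes>\<^bsub>S\<^esub> f) \<in> pl.proj.Q q" if "q \<in> ?W" for q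
        using pl.proj.Q_mult[OF _ Q'(2,4)[OF that]] WT that by blast
      show "(\<one>\<^bsub>S\<^esub>, \<one>\<^bsub>S\<^esub>) \<in> pl.proj.Q q" if "q \<in> ?W" for q
        using pl.proj.Q_one WT that by blast
    qed (use c in \<open>simp add: pl.S.P.m_comm\<close>)
    finally show ?thesis by (simp add: pl.proj.OX_one)
  qed
  have ef: "lrs_comorph \<phi> ?W (pl.proj.sec ?W f ?v) = e t f"
    and ea: "lrs_comorph \<phi> ?W (pl.proj.sec ?W a ?v) = e t a"
    using \<phi>_dehomogenize[OF W'(1,2) ne] n by auto
  have "e t f \<otimes> lrs_comorph \<phi> ?W (pl.proj.sec ?W ?v f) = \<one>"
    using \<phi>_mult[OF W'(1) ne sc(2,3)] unit \<phi>_one[OF W'(1) ne] ef by simp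
  then show nz: "e t f \<noteq> \<zero>" using \<phi>_carrier[OF W'(1) ne sc(3)] by auto
  have eq: "lrs_comorph \<phi> ?W (pl.proj.sec ?W a f) = lrs_comorph \<phi> W (pl.proj.sec W a f)"
    using \<phi>_restr'[OF W(1) W'(1,3) ne pl.proj.sec_closed[OF W(1) Q]]
    by (simp add: pl.proj.restrict_sec[OF W'(3)])
  have "lrs_comorph \<phi> ?W (pl.proj.sec ?W a f) \<otimes> e t f = e t a"
    using \<phi>_mult[OF W'(1) ne sc(1,2)] prod ef ea by simp
  then show "lrs_comorph \<phi> W (pl.proj.sec W a f) = e t a \<otimes> inv e t f"
    using eq_divide_iff[OF e_closed[OF t_closed c(1)] e_closed[OF t_closed c(2)]
        \<phi>_carrier[OF W'(1) ne sc(1)] nz] eq by simp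
qed

text \<open>Values come from \<open>\<phi>_frac\<close> on a neighbourhood where the fraction is
  defined; locality of \<open>\<phi>\<close> at \<open>V\<close> then decides whether the numerator
  lies in the image prime.\<close>

lemma \<phi>_adapted:
  assumes V: "V \<in> Z" and q: "(a, f) \<in> pl.proj.Q (lrs_pt \<phi> V)"
  shows "e t f \<noteq> \<zero> \<and> e t a \<otimes> inv e t f \<in> V \<and> (e t a \<otimes> inv e t f \<in> nonunits F V \<longleftrightarrow> a \<in> lrs_pt \<phi> V)"
proof -
  have p: "lrs_pt \<phi> V \<in> topspace pl.proj_top" using \<phi>_Proj[OF V] by simp
  obtain W where W: "openin pl.proj_top W" "lrs_pt \<phi> V \<in> W" "\<And>q. q \<in> W \<Longrightarrow> (a, f) \<in> pl.proj.Q q"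
    using pl.proj.Q_open[OF q p] by metis
  have VW: "V \<in> pre W" using V W(2) by (simp add: pre_iff)
  then have ne: "pre W \<noteq> {}" by blast
  note s = pl.proj.sec_closed[OF W(1,3)]
  note val = \<phi>_frac[OF W(1) ne W(3)]
  have V': "V \<in> lrs_points ZZ" using V by simp
  have g: "germ_at pl.proj.XX (lrs_pt \<phi> V) W (pl.proj.sec W a f)"
    using s W by (simp add: pl.proj.germ_at_XX)
  have "lrs_comorph \<phi> W (pl.proj.sec W a f) \<in> nonunits F V \<longleftrightarrow>
      pl.proj.sec W a f (lrs_pt \<phi> V) \<in> pl.proj.frac_max (lrs_pt \<phi> V)"
    by (rule lrs_morphism_local[OF \<phi>_mor' V' stalk_model_ffs[OF V'] pl.proj.stalk_model_XX[OF p]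
          ffs_local[OF V'] pl.proj.FR_local[OF p] g])
  then show ?thesis
    using val \<phi>_closed[OF W(1) ne s] VW W(2) pl.proj.frac_in_max_iff[OF p q] by auto
qed

sublocale K: ffs_frac F ZZ "\<lambda>V. V" "\<lambda>U s. s" "carrier F" S G pl.proj_top "e t" "lrs_pt \<phi>"
proof unfold_locales
  show "e t \<in> ring_hom S F" by (rule e_hom[OF t_closed])
  show "lrs_pt \<phi> V \<in> topspace pl.proj_top" if "V \<in> lrs_points ZZ" for V
    using that \<phi>_Proj by simp
  show "e t f \<noteq> \<zero> \<and> e t a \<otimes> inv e t f \<in> V \<and> (e t a \<otimes> inv e t f \<in> nonunits F V \<longleftrightarrow> a \<in> lrs_pt \<phi> V)"
    if "V \<in> lrs_points ZZ" "(a, f) \<in> pl.proj.Q (lrs_pt \<phi> V)" for V a f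
    using \<phi>_adapted that by simp
qed

lemma K_gpre: "K.gpre W = pre W"
  by (auto simp: K.gpre_def pre_iff)

text \<open>Near the image of \<open>F\<close> a section is a single fraction, and restricting to
  that neighbourhood leaves its pullback in \<open>F\<close> unchanged.\<close>

lemma \<phi>_realizes: "K.realizes \<phi>"
  unfolding K.realizes_def K_gpre
proof (intro conjI ballI allI impI)
  fix W s assume W: "openin pl.proj_top W" and s: "s \<in> carrier (pl.proj.OX W)"
  show "lrs_comorph \<phi> W s \<in> carrier (lrs_sections ZZ (pre W))"
    using ring_hom_closed[OF \<phi>_hom[OF W] s] .
  assume ne: "pre W \<noteq> {}"
  have F: "carrier F \<in> lrs_points ZZ" using FZ by simp
  have FW: "lrs_pt \<phi> (carrier F) \<in> W" using pre_generic[OF W ne] by (simp add: pre_iff)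
  obtain W' a f where W': "openin pl.proj_top W'" "lrs_pt \<phi> (carrier F) \<in> W'" "W' \<subseteq> W"
    "\<And>q. q \<in> W' \<Longrightarrow> (a, f) \<in> pl.proj.Q q" "\<And>q. q \<in> W' \<Longrightarrow> s q = pl.proj.frac q a f"
    "restrict s W' = pl.proj.sec W' a f"
    using pl.proj.section_local[OF s FW] by metis
  have "carrier F \<in> pre W'" using W'(2) FZ by (simp add: pre_iff)
  then have ne': "pre W' \<noteq> {}" by blast
  have "lrs_comorph \<phi> W s = lrs_comorph \<phi> W' (restrict s W')"
    using \<phi>_restr'[OF W W'(1,3) ne' s] by simp
  also have "\<dots> = e t a \<otimes> inv e t f" using \<phi>_frac[OF W'(1) ne' W'(4)] W'(6) by simp
  also have "\<dots> = frac_val F (e t) (s (lrs_pt \<phi> (carrier F)))"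
    using K.frac_val_frac[OF F W'(4)[OF W'(2)]] W'(5)[OF W'(2)] by simp
  finally show "lrs_comorph \<phi> W s = frac_val F (e t) (s (lrs_pt \<phi> (carrier F)))" .
qed simp

end

section \<open>Factorization over Pruefer domains\<close>

text \<open>The factorization has to be witnessed by a ring on \<open>'f + 'r\<close>, so a subring
  of \<open>F\<close> is placed in the left summand; \<open>projl\<close> leads back to
  \<open>F\<close>.\<close>

definition left_copy :: "('f, 'm) ring_scheme \<Rightarrow> 'f set \<Rightarrow> ('f + 'r) ring" where
  "left_copy F A = \<lparr>carrier = Inl ` A,
     monoid.mult = (\<lambda>x y. Inl (projl x \<otimes>\<^bsub>F\<^esub> projl y)), one = Inl \<one>\<^bsub>F\<^esub>,
     zero = Inl \<zero>\<^bsub>F\<^esub>, add = (\<lambda>x y. Inl (projl x \<oplus>\<^bsub>F\<^esub> projl y))\<rparr>"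

lemma left_copy_iso: "Inl \<in> ring_iso (F\<lparr>carrier := A\<rparr>) (left_copy F A :: ('f + 'r) ring)"
  by (rule ring_iso_memI) (auto simp: left_copy_def bij_betw_def)

lemma left_copy_cring:
  assumes "cring (F\<lparr>carrier := A\<rparr>)"
  shows "cring (left_copy F A :: ('f + 'r) ring)"
proof -
  let ?C = "left_copy F A :: ('f + 'r) ring"
  have "cring (?C\<lparr>zero := Inl \<zero>\<^bsub>F\<lparr>carrier := A\<rparr>\<^esub>\<rparr>)"
    by (rule cring.ring_iso_imp_img_cring[OF assms left_copy_iso])
  then show ?thesis by (simp add: left_copy_def)
qed

context zr_proj
begin

abbreviation "A \<equiv> \<Inter>Z"

lemma subring_A: "subring A F"
  using subring_Inter[of Z] subring_Z FZ by blast

lemma A_carrier: "a \<in> A \<Longrightarrow> a \<in> carrier F"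
  using FZ by blast

abbreviation "RA \<equiv> left_copy F A :: ('f + 'r) ring"

lemma cring_RA: "cring RA"
  by (rule left_copy_cring[OF subring_cring[OF subring_A]])

lemma carrier_RA: "carrier RA = Inl ` A"
  by (simp add: left_copy_def)

lemma projl_hom:
  assumes "A \<subseteq> V"
  shows "projl \<in> ring_hom RA (F\<lparr>carrier := V\<rparr>)"
  by (rule ring_hom_memI) (use assms in \<open>auto simp: left_copy_def\<close>)

lemma projl_hom_F: "projl \<in> ring_hom RA F"
  by (rule ring_hom_memI) (auto simp: left_copy_def A_carrier)

end

text \<open>The parameter \<open>r\<close> fixes the type \<open>'r\<close>, and with it the type of
  the ring \<open>RR\<close>.\<close>

locale zr_pruefer = zr_morphism F D Z \<phi> k
  for F :: "'f ring" (structure) and D and Z and \<phi> and k +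
  fixes r :: "'r itself"
  assumes pruefer: "pruefer_domain_in F (\<Inter>Z)"
begin

abbreviation "RR \<equiv> left_copy F A :: ('f + 'r) ring"

sublocale SA: spec_domain F RR projl
  by (intro spec_domain.intro field_axioms cring_RA spec_domain_axioms.intro projl_hom_F)
    (auto simp: carrier_RA inj_on_def)

lemma cring_RR: "cring RR"
  by (rule cring_RA)

lemma zero_RR: "\<zero>\<^bsub>RR\<^esub> = Inl \<zero>"
  by (simp add: left_copy_def)

text \<open>The Pruefer property concerns primes of the subring itself, so \<open>p\<close> is
  pulled back along \<open>Inl\<close>; both localizations are the same subset of
  \<open>F\<close>.\<close>

lemma loc_valuation:
  assumes p: "primeideal p RR"
  shows "valuation_ring_of F (SA.loc p)"
proof -
  let ?P = "{a \<in> A. Inl a \<in> p}"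
  have "Inl \<in> ring_iso (F\<lparr>carrier := A\<rparr>) RR" by (rule left_copy_iso)
  then have "ring_hom_ring (F\<lparr>carrier := A\<rparr>) RR Inl"
    using subring_cring[OF subring_A] cring_RR
    by (simp add: ring_hom_ring_def ring_hom_ring_axioms_def cring_def ring_iso_def)
  then have "primeideal {a \<in> carrier (F\<lparr>carrier := A\<rparr>). Inl a \<in> p} (F\<lparr>carrier := A\<rparr>)"
    by (rule ring_hom_ring.primeideal_vimage[OF _ subring_cring[OF subring_A] p])
  then have "valuation_ring_of F (localization_in F A ?P)"
    using pruefer by (simp add: pruefer_domain_in_def)
  moreover have "localization_in F A ?P = SA.loc p"
  proof (intro equalityI subsetI)
    fix y assume "y \<in> localization_in F A ?P"
    then obtain a f where a: "a \<in> A" "f \<in> A" "f \<notin> ?P" and y: "y = a \<otimes> inv f"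
      unfolding localization_in_def by blast
    have "projl (Inl a :: 'f + 'r) \<otimes> inv projl (Inl f :: 'f + 'r) \<in> SA.loc p"
      by (rule SA.locI) (use a in \<open>auto simp: carrier_RA\<close>)
    then show "y \<in> SA.loc p" by (simp add: y)
  next
    fix y assume "y \<in> SA.loc p"
    then obtain b h where b: "b \<in> carrier RR" "h \<in> carrier RR" "h \<notin> p"
      and y: "y = projl b \<otimes> inv projl h"
      by (rule SA.locE)
    then obtain a f where "a \<in> A" "f \<in> A" "b = Inl a" "h = Inl f" by (auto simp only: carrier_RA)
    then show "y \<in> localization_in F A ?P" using b(3) y unfolding localization_in_def by auto
  qed
  ultimately show ?thesis by simp
qed

text \<open>The center of \<open>V\<close> on \<open>A\<close>, transported to the copy of
  \<open>A\<close>.\<close>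

definition gA :: "'f set \<Rightarrow> ('f + 'r) set" where
  "gA V = {a \<in> carrier RR. projl a \<in> nonunits F V}"

lemma A_sub: "V \<in> Z \<Longrightarrow> A \<subseteq> V" by blast

lemma prime_nonunits:
  assumes V: "V \<in> Z"
  shows "primeideal (nonunits F V) (F\<lparr>carrier := V\<rparr>)"
proof (rule primeidealI)
  have V': "V \<in> lrs_points ZZ" using V by simp
  have l: "local_with (F\<lparr>carrier := V\<rparr>) (nonunits F V)" by (rule ffs_local[OF V'])
  show "ideal (nonunits F V) (F\<lparr>carrier := V\<rparr>)" "cring (F\<lparr>carrier := V\<rparr>)"
    "carrier (F\<lparr>carrier := V\<rparr>) \<noteq> nonunits F V"
    using l unfolding local_with_def by blast+
  show "a \<in> nonunits F V \<or> b \<in> nonunits F V"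
    if "a \<in> carrier (F\<lparr>carrier := V\<rparr>)" "b \<in> carrier (F\<lparr>carrier := V\<rparr>)"
      "a \<otimes>\<^bsub>F\<lparr>carrier := V\<rparr>\<^esub> b \<in> nonunits F V" for a b
    using nonunits_prime[OF subring_Z[OF V], of a b] that by simp
qed

lemma prime_gA:
  assumes V: "V \<in> Z"
  shows "primeideal (gA V) RR"
proof -
  have "projl \<in> ring_hom RR (F\<lparr>carrier := V\<rparr>)" by (rule projl_hom[OF A_sub[OF V]])
  then have "ring_hom_ring RR (F\<lparr>carrier := V\<rparr>) projl"
    using subring_cring[OF subring_Z[OF V]] cring_RR
    by (simp add: ring_hom_ring_def ring_hom_ring_axioms_def cring_def)
  then show ?thesis
    unfolding gA_def by (rule ring_hom_ring.primeideal_vimage[OF _ cring_RA prime_nonunits[OF V]])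
qed

lemma gA_iff:
  assumes "V \<in> Z" "f \<in> carrier RR"
  shows "f \<notin> gA V \<longleftrightarrow> projl f \<noteq> \<zero> \<and> inv projl f \<in> V"
  using assms by (auto simp: gA_def nonunits_def carrier_RA)

text \<open>\<open>A\<close> lies in \<open>V\<close>, and elements outside the center are units of
  \<open>V\<close>, so \<open>V\<close> dominates the localization. The preimage of a basic open set
  is given by \<open>1/f \<in> V\<close>, or is empty when \<open>f\<close> is zero.\<close>

sublocale \<alpha>: ffs_frac_cont F ZZ "\<lambda>V. V" "\<lambda>U s. s" "carrier F" RR "\<lambda>_. carrier RR" "zariski_topology RR" projl gA
proof unfold_locales
  show "gA V \<in> topspace (zariski_topology RR)" if "V \<in> lrs_points ZZ" for V
    using that prime_gA by simp
  show "projl f \<noteq> \<zero> \<and> projl a \<otimes> inv projl f \<in> V \<and>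
      (projl a \<otimes> inv projl f \<in> nonunits F V \<longleftrightarrow> a \<in> gA V)"
    if V': "V \<in> lrs_points ZZ" and q: "(a, f) \<in> SA.Y.Q (gA V)" for V a f
  proof -
    have V: "V \<in> Z" using V' by simp
    have c: "a \<in> carrier RR" "f \<in> carrier RR" "f \<notin> gA V" using q unfolding SA.Q_Spec by blast+
    have "projl a \<in> V" "projl f \<in> V" using c V by (auto simp: carrier_RA)
    moreover have "projl f \<notin> nonunits F V" using c by (simp add: gA_def)
    ultimately show ?thesis
      using nonunits_divide[OF subring_Z[OF V], of "projl a" "projl f"] c(1) by (simp add: gA_def)
  qed
  show "continuous_map (lrs_top ZZ) (zariski_topology RR) gA"
    unfolding zariski_topology_def
  proof (rule continuous_on_generated_topo)
    have "gA V \<in> topspace (zariski_topology RR)" if "V \<in> Z" for V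
      using prime_gA[OF that] by simp
    then show "gA ` topspace (lrs_top ZZ) \<subseteq> \<Union> ((\<lambda>f. {p. primeideal p RR \<and> f \<notin> p}) ` carrier RR)"
      unfolding zariski_topology_def topology_generated_by_topspace by auto
    fix U assume "U \<in> (\<lambda>f. {p. primeideal p RR \<and> f \<notin> p}) ` carrier RR"
    then obtain f where f: "f \<in> carrier RR" "U = {p. primeideal p RR \<and> f \<notin> p}" by blast
    have "gA -` U \<inter> topspace (lrs_top ZZ) = {V \<in> Z. projl f \<noteq> \<zero> \<and> inv projl f \<in> V}"
      using f prime_gA gA_iff[OF _ f(1)] by auto
    also have "openin (lrs_top ZZ) \<dots>"
    proof (cases "projl f = \<zero>")
      case False
      have "projl f \<in> carrier F" using f(1) by (auto simp: carrier_RA A_carrier)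
      then show ?thesis using L_open[of "inv projl f"] False by simp
    qed simp
    finally show "openin (lrs_top ZZ) (gA -` U \<inter> topspace (lrs_top ZZ))" .
  qed
qed

lemma D_sub_loc:
  assumes p: "primeideal p RR"
  shows "D \<subseteq> SA.loc p"
proof
  fix d assume "d \<in> D"
  then have "Inl d \<in> carrier RR" using D_sub_Z by (auto simp: carrier_RA)
  then show "d \<in> SA.loc p" using SA.j_in_loc[OF p, of "Inl d"] by simp
qed

lemma points_Spec: "p \<in> lrs_points (Spec RR) \<longleftrightarrow> primeideal p RR"
  by (simp add: SA.Spec_XX)

text \<open>The localizations of \<open>A\<close> are valuation rings by the Pruefer property, so
  the coordinates of \<open>\<phi>\<close> have an admissible denominator at every point of the
  spectrum.\<close>

sublocale \<beta>: proj_mor F D "Spec RR" SA.loc SA.sval "{\<zero>\<^bsub>RR\<^esub>}" t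
proof unfold_locales
  show "D \<subseteq> SA.loc p" if "p \<in> lrs_points (Spec RR)" for p
    using that D_sub_loc by (simp only: points_Spec)
  show "t i \<in> carrier F" for i by (rule t_closed)
  show "\<exists>i. t i \<noteq> \<zero> \<and> (\<forall>j. t j \<otimes> inv t i \<in> SA.loc p)" if "p \<in> lrs_points (Spec RR)" for p
  proof (rule valuation_ratio[OF loc_valuation t_closed])
    show "primeideal p RR" using that by (simp only: points_Spec)
    show "\<exists>i. t i \<noteq> \<zero>" using t_k by (intro exI[of _ k]) simp
  qed
qed

text \<open>Both primes are adapted to \<open>t\<close> and \<open>V\<close>, so
  \<open>adapted_unique\<close> applies. For the composite, values lie in the localization at the
  center, and an element of it is a nonunit there exactly when it is a nonunit of
  \<open>V\<close>.\<close>

lemma pt_gA: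
  assumes V: "V \<in> Z"
  shows "\<beta>.pt (gA V) = lrs_pt \<phi> V"
proof (rule adapted_unique[OF subring_Z[OF V] t_closed _ \<phi>_Proj[OF V] _ \<phi>_adapted[OF V]])
  have p: "gA V \<in> lrs_points (Spec RR)" using prime_gA[OF V] by (simp only: points_Spec)
  have V': "V \<in> lrs_points ZZ" using V by simp
  show "\<beta>.pt (gA V) \<in> Proj_points S G" by (rule \<beta>.pt_Proj[OF p])
  fix a f assume q: "(a, f) \<in> pl.proj.Q (\<beta>.pt (gA V))"
  let ?y = "e t a \<otimes> inv e t f"
  note ad = \<beta>.M.adapted[OF p q]
  then obtain b h where b: "b \<in> carrier RR" "h \<in> carrier RR" "h \<notin> gA V" "?y = projl b \<otimes> inv projl h"
    using SA.locE[of ?y "gA V"] by blast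
  have "(b, h) \<in> SA.Y.Q (gA V)" using b unfolding SA.Q_Spec by blast
  then have "?y \<in> V" "?y \<in> nonunits F V \<longleftrightarrow> b \<in> gA V"
    using \<alpha>.adapted[OF V'] unfolding b(4) by blast+
  moreover have "?y \<in> nonunits F (SA.loc (gA V)) \<longleftrightarrow> b \<in> gA V"
    unfolding b(4) by (rule SA.nonunits_loc_iff[OF prime_gA[OF V] b(1-3)])
  ultimately show "e t f \<noteq> \<zero> \<and> ?y \<in> V \<and> (?y \<in> nonunits F V \<longleftrightarrow> a \<in> \<beta>.pt (gA V))"
    using ad by blast
qed

lemma gA_F: "gA (carrier F) = {\<zero>\<^bsub>RR\<^esub>}"
  using subringE(2)[OF subring_A] by (auto simp: gA_def nonunits_carrier carrier_RA zero_RR)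

lemma gpre_comp: "\<alpha>.gpre (\<beta>.M.gpre W) = K.gpre W"
proof -
  have "gA V \<in> lrs_points (Spec RR)" if "V \<in> Z" for V
    using prime_gA[OF that] by (simp only: points_Spec)
  then show ?thesis by (auto simp: \<alpha>.gpre_def \<beta>.M.gpre_def K.gpre_def pt_gA)
qed

text \<open>The point \<open>F\<close> goes to the zero ideal, where sections over the spectrum are
  evaluated, so the composite has the same value at \<open>t\<close> as
  \<open>\<phi>\<close>.\<close>

lemma comp_realizes: "K.realizes (lrs_comp (Spec RR) \<beta>.M.mor \<alpha>.mor)"
  unfolding K.realizes_def
proof (intro conjI ballI allI impI)
  show "lrs_pt (lrs_comp (Spec RR) \<beta>.M.mor \<alpha>.mor) V = lrs_pt \<phi> V" if "V \<in> lrs_points ZZ" for V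
    using pt_gA that by (simp add: lrs_comp_def \<alpha>.mor_def \<beta>.M.mor_def)
  fix U s assume U: "openin pl.proj_top U" and s: "s \<in> carrier (pl.proj.OX U)"
  let ?W = "\<beta>.M.gpre U" and ?s = "lrs_comorph \<beta>.M.mor U s"
  have W: "openin (zariski_topology RR) ?W" using \<beta>.M.gpre_open[OF U] unfolding SA.Spec_XX SA.Y.XX_simps .
  have s': "?s \<in> carrier (SA.Y.OX ?W)" "?W \<noteq> {} \<Longrightarrow> SA.sval ?W ?s = frac_val F (e t) (s (\<beta>.pt {\<zero>\<^bsub>RR\<^esub>}))"
  proof -
    note r = \<beta>.M.realizesD[OF \<beta>.M.mor_realizes U s]
    have "lrs_sections (Spec RR) ?W = SA.Y.OX ?W" by (simp only: SA.Spec_XX SA.Y.XX_simps)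
    then show "?s \<in> carrier (SA.Y.OX ?W)" using r(1) by (simp only:)
    show "SA.sval ?W ?s = frac_val F (e t) (s (\<beta>.pt {\<zero>\<^bsub>RR\<^esub>}))" if "?W \<noteq> {}" by (rule r(2)[OF that])
  qed
  have pre: "lrs_pre (Spec RR) \<beta>.M.mor U = ?W"
    by (simp add: lrs_pre_def \<beta>.M.gpre_def \<beta>.M.mor_def)
  have eq: "lrs_comorph (lrs_comp (Spec RR) \<beta>.M.mor \<alpha>.mor) U s = lrs_comorph \<alpha>.mor ?W ?s"
    by (simp add: lrs_comp_def pre)
  have *: "lrs_comorph \<alpha>.mor ?W ?s \<in> carrier (lrs_sections ZZ (K.gpre U))"
    "K.gpre U \<noteq> {} \<Longrightarrow> lrs_comorph \<alpha>.mor ?W ?s = frac_val F projl (?s (gA (carrier F)))"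
  proof -
    note r = \<alpha>.realizesD[OF \<alpha>.mor_realizes W s'(1), unfolded gpre_comp]
    show "lrs_comorph \<alpha>.mor ?W ?s \<in> carrier (lrs_sections ZZ (K.gpre U))" by (rule r(1))
    show "lrs_comorph \<alpha>.mor ?W ?s = frac_val F projl (?s (gA (carrier F)))" if "K.gpre U \<noteq> {}"
      by (rule r(2)[OF that])
  qed
  show "lrs_comorph (lrs_comp (Spec RR) \<beta>.M.mor \<alpha>.mor) U s \<in> carrier (lrs_sections ZZ (K.gpre U))"
    using *(1) by (simp only: eq)
  assume ne: "K.gpre U \<noteq> {}"
  then have Wne: "?W \<noteq> {}" unfolding gpre_comp[symmetric] by (auto simp: \<alpha>.gpre_def)
  have "frac_val F projl (?s (gA (carrier F))) = SA.sval ?W ?s" by (simp only: gA_F SA.sval_def)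
  also have "\<dots> = frac_val F (e t) (s (lrs_pt \<phi> (carrier F)))"
    using s'(2)[OF Wne] pt_gA[OF FZ] by (simp only: gA_F)
  finally show "lrs_comorph (lrs_comp (Spec RR) \<beta>.M.mor \<alpha>.mor) U s =
      frac_val F (e t) (s (lrs_pt \<phi> (carrier F)))"
    using *(2)[OF ne] by (simp only: eq)
qed

lemma factors: "factors_through_affine TYPE('f + 'r) ZZ (Proj_line RD) \<phi>"
  unfolding factors_through_affine_def
proof (intro exI conjI)
  show "cring RR" by (rule cring_RA)
  show "lrs_morphism ZZ (Spec RR) \<alpha>.mor" using \<alpha>.mor_morphism unfolding SA.Spec_XX .
  show "lrs_morphism (Spec RR) (Proj_line RD) \<beta>.M.mor" using \<beta>.M.mor_morphism unfolding pl.Proj_line_eq .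
  show "lrs_map_eq ZZ (Proj_line RD) \<phi> (lrs_comp (Spec RR) \<beta>.M.mor \<alpha>.mor)"
    unfolding pl.Proj_line_eq
    by (rule K.realizes_unique[OF _ \<phi>_realizes comp_realizes]) (simp only: K_gpre pre_open)
qed

end

theorem theorem3p1:
  fixes F :: "'f ring" and D :: "'f set" and Z :: "'f set set"
  assumes "field F"
    and "subring D F"
    and "Z \<subseteq> ZR F D"
    and "carrier F \<in> Z"
  shows "pruefer_domain_in F (\<Inter>Z) \<longleftrightarrow>
    (\<forall>\<phi>. lrs_morphism_over (Spec (F\<lparr>carrier := D\<rparr>))
           (ZR_space F D Z) (ZR_structure_map F D)
           (Proj_line (F\<lparr>carrier := D\<rparr>)) (Proj_line_structure_map (F\<lparr>carrier := D\<rparr>)) \<phi>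
         \<longrightarrow> factors_through_affine TYPE('f + 'r)
               (ZR_space F D Z) (Proj_line (F\<lparr>carrier := D\<rparr>)) \<phi>)"
proof -
  interpret zr_proj F D Z
    using assms by (simp add: zr_proj_def zr_space_def zr_space_axioms_def)
  show ?thesis
  proof (intro iffI allI impI)
    fix \<phi>
    assume pr: "pruefer_domain_in F (\<Inter>Z)"
      and over: "lrs_morphism_over (Spec (F\<lparr>carrier := D\<rparr>)) (ZR_space F D Z) (ZR_structure_map F D)
        (Proj_line (F\<lparr>carrier := D\<rparr>)) (Proj_line_structure_map (F\<lparr>carrier := D\<rparr>)) \<phi>"
    have "continuous_map (lrs_top ZZ) pl.proj_top (lrs_pt \<phi>)"
      using over unfolding lrs_morphism_over_def lrs_morphism_def pl.Proj_line_eq pl.proj.XX_simps by blast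
    then have "lrs_pt \<phi> (carrier F) \<in> Proj_points S G" using FZ by (auto simp: continuous_map_def)
    then obtain k where k: "var k \<notin> lrs_pt \<phi> (carrier F)" using pl.Proj_points_pvar by blast
    interpret zr_pruefer F D Z \<phi> k "TYPE('r)"
      by unfold_locales (fact over k pr)+
    show "factors_through_affine TYPE('f + 'r) (ZR_space F D Z) (Proj_line (F\<lparr>carrier := D\<rparr>)) \<phi>"
      by (rule factors)
  next
    assume "\<forall>\<phi>. lrs_morphism_over (Spec (F\<lparr>carrier := D\<rparr>))
           (ZR_space F D Z) (ZR_structure_map F D)
           (Proj_line (F\<lparr>carrier := D\<rparr>)) (Proj_line_structure_map (F\<lparr>carrier := D\<rparr>)) \<phi>
         \<longrightarrow> factors_through_affine TYPE('f + 'r)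
               (ZR_space F D Z) (Proj_line (F\<lparr>carrier := D\<rparr>)) \<phi>"
    then show "pruefer_domain_in F (\<Inter>Z)"
      using pruefer_if_factors[where ?'r = "'f + 'r"] by blast
  qed
qed

end
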